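(* Let $\underline W\in\underline{\mathcal S}'$ satisfy axioms A1)–A7) listed in the context with a Sobolev dominated Hilbert seminorm $\underline p$ in A5), and let $((\mathcal H,\langle\cdot,\cdot\rangle,\Omega),\eta,\mathsf U,\phi)$ be the associated quantum field theory with indefinite metric. Suppose that $\underline W$ fulfills the strong spectral condition with mass gap $m>0$, i.e. $I_{\rm sp}^m\subseteq\ker\underline W$. Then: (i) The field algebra $\mathcal P(\mathbb R^d)=\phi(\underline{\mathcal S})$ is irreducible, i.e. its weak commutant is $\mathbb C\,1_{\mathcal H}$; (ii) The vacuum $\Omega$ is, up to multiplication with a constant, the unique translation invariant vector in $\mathcal H$.
   Context: **Borchers algebra.** Fix $d\ge2$ and Minkowski space $\mathbb R^d$ with $x\cdot y=x^0y^0-\sum_{j=1}^{d-1}x^jy^j$. Let $\mathcal S_0=\mathbb C$, $\mathcal S_n=\mathcal S(\mathbb R^{dn},\mathbb C)$ (Schwartz functions) and $\underline{\mathcal S}=\bigoplus_{n\ge0}\mathcal S_n$ (finite sequences $\underline f=(f_0,f_1,\dots)$) with the locally convex direct sum topology, product $(\underline f\otimes\underline h)_n=\sum_{j+l=n}f_j\otimes h_l$, unit $\mathbf 1=(1,0,\dots)$, and involution $f_l^*(x_1,\dots,x_l)=\overline{f_l(x_l,\dots,x_1)}$. $\underline{\mathcal S}'$ is the topological dual. The proper orthochronous Poincaré group $P_+^\uparrow$ acts by continuous $*$-automorphisms $\underline\alpha_{\{\Lambda,a\}}$, $(\underline\alpha_{\{\Lambda,a\}}f_n)(x_1,\dots,x_n)=f_n(\Lambda^{-1}(x_1-a),\dots,\Lambda^{-1}(x_n-a))$.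 $I_{\rm sp}$ is the left ideal generated by all $\int_{\mathbb R^d}\underline\alpha_{\{1,a\}}(\underline f)h(a)\,da$ with $\underline f\in\underline{\mathcal S}$, $h\in\mathcal S_1$, $\operatorname{supp}\hat h\cap\bar V_0^+=\emptyset$, where $\hat h(k)=\int e^{ik\cdot a}h(a)\,da$ and $\bar V_0^+=\{k:k^0\ge0,\ k\cdot k\ge0\}$. $I_{\rm sp}^m$ is defined in the same way with $\bar V_0^+$ replaced by $\{0\}\cup\bar V_m^+$, $\bar V_m^+=\{k:k^0\ge0,\ k\cdot k\ge m^2\}$. $I_{\rm loc}$ is the two-sided ideal generated by $(0,0,f_1\otimes h_1-h_1\otimes f_1,0,\dots)$ with $f_1,h_1\in\mathcal S_1$ having space-like separated supports. **Axioms for $\underline W$.** A1) $\underline W\in\underline{\mathcal S}'$, $W_0=1$. A2) $\underline W\circ\underline\alpha_{\{\Lambda,a\}}=\underline W$ for all $\{\Lambda,a\}\in P_+^\uparrow$. A3) $I_{\rm sp}\subseteq\ker\underline W$. A4) $I_{\rm loc}\subseteq\ker\underline W$. A5) There is a Hilbert seminorm $\underline p$ on $\underline{\mathcal S}$ (one coming from a positive semidefinite sesquilinear form) with $|\underline W(\underline f^*\otimes\underline g)|\le\underline p(\underline f)\underline p(\underline g)$ for all $\underline f,\underline g$. A6) $\lim_{t\to\infty}\underline W(\underline f\otimes\underline\alpha_{\{1,ta\}}(\underline g))=\underline W(\underline f)\underline W(\underline g)$ for all $\underline f,\underline g$ and space-like $a$. A7) $\underline W(\underline f^* )=\overline{\underline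 W(\underline f)}$. The seminorm $\underline p$ is *Sobolev dominated* if it is continuous in the topology of $\underline{\mathcal S}$. **Associated QFT with indefinite metric.** If $\underline p$ is not a norm, replace it by $\sqrt{\underline p^2+\underline p_1^2}$, with $\underline p_1$ a Hilbert norm on $\underline{\mathcal S}$ that is a direct sum of Sobolev Hilbert norms on the $\mathcal S_n$. Let $\mathcal H_1$ be the completion of $\underline{\mathcal S}$ in $\underline p$; extend $\langle\underline f,\underline g\rangle=\underline W(\underline f^*\otimes\underline g)$ continuously to $\mathcal H_1$. Let $\mathcal K_0=\{v\in\mathcal H_1:\langle w,v\rangle=0\ \forall w\in\mathcal H_1\}$, $\mathcal H_2=\mathcal H_1/\mathcal K_0$ (quotient Hilbert space, scalar product $(\cdot,\cdot)_2$) with quotient map $\pi$; $\langle\cdot,\cdot\rangle$ descends to $\mathcal H_2$ and equals $(\cdot,\eta_2\cdot)_2$ for an injective self-adjoint contraction $\eta_2$. Set $\mathcal D=\pi(\underline{\mathcal S})$, $\Omega=\pi(\mathbf 1)$, $(\cdot,\cdot)=(\cdot,|\eta_2|\cdot)_2$, let $\mathcal H$ be the completion of $\mathcal D$ in $\|\cdot\|=(\cdot,\cdot)^{1/2}$ and $\eta=\operatorname{sign}(\eta_2)$ extended to $\mathcal H$, so that $\eta=\eta^*$, $\eta^2=1$ and $\langle\cdot,\cdot\rangle=(\cdot,\eta\,\cdot)$; passing if necessary to a topologically equivalent scalar product and corresponding metric operator for the same $\langle\cdot,\cdot\rangle$, $\eta$ is chosen so that $\eta\Omega=\Omega$. On $\mathcal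 D$ one has the well-defined operators $\phi(\underline f)\pi(\underline g)=\pi(\underline f\otimes\underline g)$ and $\mathsf U(\Lambda,a)\pi(\underline g)=\pi(\underline\alpha_{\{\Lambda,a\}}(\underline g))$. The $\eta$-adjoint is $\mathsf L^{[*]}=\eta\mathsf L^*\eta|_{\mathcal D}$; $\phi(\underline f)^{[*]}=\phi(\underline f^* )$. **Further definitions.** For a set $\mathcal A$ of operators $\mathsf L:\mathcal D\to\mathcal D$ having $\eta$-adjoints $\mathsf L^{[*]}:\mathcal D\to\mathcal D$, the weak commutant is $\mathcal A'=\{C\in\mathcal B(\mathcal H):\langle\Psi_1,C\mathsf L\Psi_2\rangle=\langle\mathsf L^{[*]}\Psi_1,C\Psi_2\rangle\ \forall\Psi_1,\Psi_2\in\mathcal D,\ \mathsf L\in\mathcal A\}$. A vector $\tilde\Omega\in\mathcal H$ is translation invariant if $\langle\tilde\Omega,\mathsf U(1,a)\Psi\rangle=\langle\tilde\Omega,\Psi\rangle$ for all $a\in\mathbb R^d$, $\Psi\in\mathcal D$. *)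

theory Defs
  imports "HOL-Analysis.Analysis"
begin

section \<open>Complex Hilbert spaces\<close>

text \<open>Scalar products are antilinear in the first and linear in the second argument.\<close>

class complex_hilbert = banach +
  fixes scaleC :: "complex \<Rightarrow> 'a \<Rightarrow> 'a"  (infixr "*\<^sub>C" 75)
    and cinner :: "'a \<Rightarrow> 'a \<Rightarrow> complex"
  assumes scaleC_add_right: "c *\<^sub>C (x + y) = c *\<^sub>C x + c *\<^sub>C y"
    and scaleC_add_left: "(b + c) *\<^sub>C x = b *\<^sub>C x + c *\<^sub>C x"
    and scaleC_scaleC: "b *\<^sub>C c *\<^sub>C x = (b * c) *\<^sub>C x"
    and scaleC_of_real: "complex_of_real r *\<^sub>C x = r *\<^sub>R x"
    and cinner_commute: "cinner x y = cnj (cinner y x)"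
    and cinner_add_right: "cinner x (y + z) = cinner x y + cinner x z"
    and cinner_scaleC_right: "cinner x (c *\<^sub>C y) = c * cinner x y"
    and cinner_self: "cinner x x = complex_of_real ((norm x)\<^sup>2)"

instantiation complex :: complex_hilbert
begin

definition scaleC_complex :: "complex \<Rightarrow> complex \<Rightarrow> complex" where
  "scaleC_complex c x = c * x"

definition cinner_complex :: "complex \<Rightarrow> complex \<Rightarrow> complex" where
  "cinner_complex x y = cnj x * y"

instance
proof
  fix x :: complex
  show "cinner x x = complex_of_real ((norm x)\<^sup>2)"
    by (simp only: cinner_complex_def complex_norm_square mult.commute)
qed (simp_all add: scaleC_complex_def cinner_complex_def algebra_simps scaleR_conv_of_real)

end

definition bounded_clinear :: "('a::complex_hilbert \<Rightarrow> 'b::complex_hilbert) \<Rightarrow> bool" where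
  "bounded_clinear T \<longleftrightarrow> bounded_linear T \<and> (\<forall>c x. T (c *\<^sub>C x) = c *\<^sub>C T x)"

definition bounded_sesquilinear :: "('a::complex_hilbert \<Rightarrow> 'a \<Rightarrow> complex) \<Rightarrow> bool" where
  "bounded_sesquilinear F \<longleftrightarrow>
     (\<forall>u v w. F (u + v) w = F u w + F v w \<and> F w (u + v) = F w u + F w v) \<and>
     (\<forall>c u v. F (c *\<^sub>C u) v = cnj c * F u v \<and> F u (c *\<^sub>C v) = c * F u v) \<and>
     (\<exists>C. \<forall>u v. cmod (F u v) \<le> C * norm u * norm v)"

text \<open>A scalar product on a Hilbert space inducing the same topology as the given one.\<close>

definition equivalent_scalar_product :: "('a::complex_hilbert \<Rightarrow> 'a \<Rightarrow> complex) \<Rightarrow> bool" where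
  "equivalent_scalar_product S \<longleftrightarrow>
     bounded_sesquilinear S \<and> (\<forall>x y. S x y = cnj (S y x)) \<and>
     (\<exists>c>0. \<forall>x. c * (norm x)\<^sup>2 \<le> Re (S x x))"

text \<open>\<open>A = \<bar>T\<bar>\<close>: the positive operator with \<open>A\<^sup>2 = T\<^sup>*T\<close>.\<close>

definition is_abs_of :: "('a::complex_hilbert \<Rightarrow> 'a) \<Rightarrow> ('a \<Rightarrow> 'a) \<Rightarrow> bool" where
  "is_abs_of T A \<longleftrightarrow>
     bounded_clinear A \<and>
     (\<forall>x. cinner x (A x) \<in> \<real> \<and> 0 \<le> Re (cinner x (A x))) \<and>
     (\<forall>x y. cinner x (A (A y)) = cinner (T x) (T y))"

text \<open>\<open>V = sign T\<close> for injective self-adjoint \<open>T\<close>, given by the polar decomposition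
  \<open>T = sign T \<bar>T\<bar>\<close>; as \<open>\<bar>T\<bar>\<close> then has dense range, this determines \<open>V\<close>.\<close>

definition is_sign_of :: "('a::complex_hilbert \<Rightarrow> 'a) \<Rightarrow> ('a \<Rightarrow> 'a) \<Rightarrow> bool" where
  "is_sign_of T V \<longleftrightarrow> bounded_clinear V \<and> (\<exists>A. is_abs_of T A \<and> (\<forall>x. V (A x) = T x))"

text \<open>\<open>q\<close> is the quotient map onto the quotient by the closed subspace \<open>K\<close> with its quotient
  norm, which is the distance to \<open>K\<close>.\<close>

definition hilbert_quotient ::
    "'a::complex_hilbert set \<Rightarrow> ('a \<Rightarrow> 'b::complex_hilbert) \<Rightarrow> bool" where
  "hilbert_quotient K q \<longleftrightarrow> bounded_clinear q \<and> surj q \<and> (\<forall>v. norm (q v) = infdist v K)"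


section \<open>Minkowski space and the Poincare group\<close>

text \<open>The time component is the one with index \<open>0 :: 'd\<close>; the class \<open>zero\<close> only serves to single it
  out.\<close>

type_synonym 'd spacetime = "real^'d"
type_synonym 'd spacetime_matrix = "real^'d^'d"

definition mink :: "'d::{finite,zero} spacetime \<Rightarrow> 'd spacetime \<Rightarrow> real"  (infixl "\<cdot>\<^sub>M" 70) where
  "x \<cdot>\<^sub>M y = x $ 0 * y $ 0 - (\<Sum>j\<in>UNIV - {0}. x $ j * y $ j)"

definition spacelike :: "'d::{finite,zero} spacetime \<Rightarrow> bool" where
  "spacelike x \<longleftrightarrow> x \<cdot>\<^sub>M x < 0"

definition forward_mass_shells :: "real \<Rightarrow> 'd::{finite,zero} spacetime set"  ("V\<^sub>+") where
  "V\<^sub>+ m = {k. k $ 0 \<ge> 0 \<and> k \<cdot>\<^sub>M k \<ge> m\<^sup>2}"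

definition proper_orthochronous :: "'d::{finite,zero} spacetime_matrix \<Rightarrow> bool" where
  "proper_orthochronous \<Lambda> \<longleftrightarrow>
     (\<forall>x y. (\<Lambda> *v x) \<cdot>\<^sub>M (\<Lambda> *v y) = x \<cdot>\<^sub>M y) \<and> det \<Lambda> = 1 \<and> \<Lambda> $ 0 $ 0 > 0"


section \<open>Schwartz functions of n space-time points\<close>

text \<open>A function of \<open>n\<close> points is a function on lists, restricted to lists of length \<open>n\<close>. A
  sequence \<open>(f\<^sub>0, f\<^sub>1, \<dots>)\<close> with \<open>f\<^sub>n\<close> a function of \<open>n\<close> points is accordingly a single function \<open>f\<close>
  on lists: \<open>f\<^sub>n(x\<^sub>1,\<dots>,x\<^sub>n) = f [x\<^sub>1,\<dots>,x\<^sub>n]\<close>. An element of the \<open>n\<close>-th summand vanishes on lists of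
  any other length.\<close>

type_synonym 'd test_seq = "'d spacetime list \<Rightarrow> complex"

definition component :: "nat \<Rightarrow> 'd::finite test_seq \<Rightarrow> 'd test_seq" where
  "component n f = (\<lambda>xs. if length xs = n then f xs else 0)"

definition list_norm :: "'a::real_normed_vector list \<Rightarrow> real" where
  "list_norm xs = sqrt (\<Sum>x\<leftarrow>xs. (norm x)\<^sup>2)"

text \<open>Partial derivative with respect to the coordinate \<open>b\<close> of the \<open>i\<close>-th point.\<close>

definition shift_coord :: "nat \<times> 'd::finite \<Rightarrow> 'd spacetime list \<Rightarrow> real \<Rightarrow> 'd spacetime list" where
  "shift_coord = (\<lambda>(i, b) xs t. xs[i := xs ! i + t *\<^sub>R axis b 1])"

definition partial :: "nat \<times> 'd::finite \<Rightarrow> 'd test_seq \<Rightarrow> 'd test_seq" where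
  "partial ib f = (\<lambda>xs. vector_derivative (\<lambda>t. f (shift_coord ib xs t)) (at 0))"

definition partials :: "(nat \<times> 'd::finite) list \<Rightarrow> 'd test_seq \<Rightarrow> 'd test_seq" where
  "partials \<alpha> f = foldr partial \<alpha> f"

definition multi_indices :: "nat \<Rightarrow> (nat \<times> 'd::finite) list set" where
  "multi_indices n = {\<alpha>. set \<alpha> \<subseteq> {..<n} \<times> UNIV}"

text \<open>All iterated partial derivatives exist and are continuous; continuity of a function of \<open>n\<close>
  points is expressed through the product topology on \<open>nat \<Rightarrow> 'd spacetime\<close>.\<close>

definition smooth :: "nat \<Rightarrow> 'd::finite test_seq \<Rightarrow> bool" where
  "smooth n f \<longleftrightarrow>
     (\<forall>\<alpha>\<in>multi_indices n.
        continuous_on UNIV (\<lambda>x :: nat \<Rightarrow> 'd spacetime. partials \<alpha> f (map x [0..<n])) \<and>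
        (\<forall>ib\<in>{..<n} \<times> UNIV. \<forall>xs. length xs = n \<longrightarrow>
           (\<lambda>t. partials \<alpha> f (shift_coord ib xs t)) differentiable at 0))"

definition schwartz :: "nat \<Rightarrow> 'd::finite test_seq set" where
  "schwartz n =
     {f. (\<forall>xs. length xs \<noteq> n \<longrightarrow> f xs = 0) \<and> smooth n f \<and>
         (\<forall>N. \<forall>\<alpha>\<in>multi_indices n. \<exists>C. \<forall>xs. length xs = n \<longrightarrow>
            (1 + list_norm xs) ^ N * cmod (partials \<alpha> f xs) \<le> C)}"

definition schwartz_seminorm :: "nat \<Rightarrow> nat \<Rightarrow> nat \<Rightarrow> 'd::finite test_seq \<Rightarrow> real" where
  "schwartz_seminorm n N l f =
     (SUP (\<alpha>, xs) \<in> {\<alpha> \<in> multi_indices n. length \<alpha> \<le> l} \<times> {xs. length xs = n}.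
        (1 + list_norm xs) ^ N * cmod (partials \<alpha> f xs))"

definition schwartz_topology :: "nat \<Rightarrow> 'd::finite test_seq topology" where
  "schwartz_topology n = topology_generated_by
     {{g \<in> schwartz n. schwartz_seminorm n N l (\<lambda>xs. g xs - f xs) < r} | f N l r.
        f \<in> schwartz n \<and> r > 0}"

text \<open>The Sobolev Hilbert norm with derivatives of order at most \<open>l\<close> and polynomial weight
  \<open>(1 + \<bar>x\<bar>\<^sup>2) ^ N\<close>.\<close>

definition sobolev_norm :: "nat \<Rightarrow> nat \<Rightarrow> nat \<Rightarrow> 'd::finite test_seq \<Rightarrow> real" where
  "sobolev_norm n N l f = sqrt
     (\<Sum>\<alpha> \<in> {\<alpha> \<in> multi_indices n. length \<alpha> \<le> l}.
        LINT x | PiM {..<n} (\<lambda>_. lborel).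
          (1 + (list_norm (map x [0..<n]))\<^sup>2) ^ N * (cmod (partials \<alpha> f (map x [0..<n])))\<^sup>2)"


section \<open>The Borchers algebra\<close>

definition borchers :: "'d::finite test_seq set" where
  "borchers = {f. (\<forall>n. component n f \<in> schwartz n) \<and> (\<exists>N. \<forall>xs. length xs > N \<longrightarrow> f xs = 0)}"

definition tensor :: "'d::finite test_seq \<Rightarrow> 'd test_seq \<Rightarrow> 'd test_seq"  (infixr "\<otimes>\<^sub>B" 75) where
  "f \<otimes>\<^sub>B h = (\<lambda>xs. \<Sum>j\<le>length xs. f (take j xs) * h (drop j xs))"

definition unit_seq :: "'d::finite test_seq" where
  "unit_seq = (\<lambda>xs. if xs = [] then 1 else 0)"

definition star :: "'d::finite test_seq \<Rightarrow> 'd test_seq" where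
  "star f = (\<lambda>xs. cnj (f (rev xs)))"

definition poincare :: "'d::finite spacetime_matrix \<Rightarrow> 'd spacetime \<Rightarrow> 'd test_seq \<Rightarrow> 'd test_seq" where
  "poincare \<Lambda> a f = (\<lambda>xs. f (map (\<lambda>x. matrix_inv \<Lambda> *v (x - a)) xs))"

definition linear_on_borchers :: "('d::finite test_seq \<Rightarrow> 'h::complex_hilbert) \<Rightarrow> bool" where
  "linear_on_borchers T \<longleftrightarrow>
     (\<forall>f\<in>borchers. \<forall>g\<in>borchers. T (\<lambda>xs. f xs + g xs) = T f + T g) \<and>
     (\<forall>c. \<forall>f\<in>borchers. T (\<lambda>xs. c * f xs) = c *\<^sub>C T f)"

definition seminorm_on_borchers :: "('d::finite test_seq \<Rightarrow> real) \<Rightarrow> bool" where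
  "seminorm_on_borchers q \<longleftrightarrow>
     (\<forall>f\<in>borchers. \<forall>g\<in>borchers. q (\<lambda>xs. f xs + g xs) \<le> q f + q g) \<and>
     (\<forall>c. \<forall>f\<in>borchers. q (\<lambda>xs. c * f xs) = cmod c * q f)"

text \<open>The locally convex direct sum topology is the finest locally convex topology for which the
  inclusions of the summands are continuous, that is, the topology defined by all seminorms with
  continuous restriction to each summand.\<close>

definition borchers_topology :: "'d::finite test_seq topology" where
  "borchers_topology = topology_generated_by
     {{g \<in> borchers. q (\<lambda>xs. g xs - f xs) < r} | f q r.
        f \<in> borchers \<and> r > 0 \<and> seminorm_on_borchers q \<and>
        (\<forall>n. continuous_map (schwartz_topology n) euclideanreal q)}"

definition borchers_dual :: "('d::finite test_seq \<Rightarrow> complex) set" where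
  "borchers_dual = {W. linear_on_borchers W \<and> continuous_map borchers_topology euclidean W}"

definition functional_kernel :: "('d::finite test_seq \<Rightarrow> complex) \<Rightarrow> 'd test_seq set" where
  "functional_kernel W = {f \<in> borchers. W f = 0}"

definition hilbert_seminorm :: "('d::finite test_seq \<Rightarrow> real) \<Rightarrow> bool" where
  "hilbert_seminorm p \<longleftrightarrow> (\<exists>B :: 'd test_seq \<Rightarrow> 'd test_seq \<Rightarrow> complex.
     (\<forall>f\<in>borchers. linear_on_borchers (B f)) \<and>
     (\<forall>f\<in>borchers. linear_on_borchers (\<lambda>g. cnj (B g f))) \<and>
     (\<forall>f\<in>borchers. B f f \<in> \<real> \<and> 0 \<le> Re (B f f)) \<and>
     (\<forall>f\<in>borchers. p f = sqrt (Re (B f f))))"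

definition sobolev_dominated :: "('d::finite test_seq \<Rightarrow> real) \<Rightarrow> bool" where
  "sobolev_dominated p \<longleftrightarrow> continuous_map borchers_topology euclideanreal p"

text \<open>The Hilbert norm obtained from \<open>p\<close>: \<open>p\<close> itself if it is a norm, otherwise the combination of
  \<open>p\<close> with the direct sum of Sobolev norms of weights \<open>N n\<close> and orders \<open>l n\<close> on the summands.\<close>

definition sobolev_sum :: "(nat \<Rightarrow> nat) \<Rightarrow> (nat \<Rightarrow> nat) \<Rightarrow> 'd::finite test_seq \<Rightarrow> real" where
  "sobolev_sum N l f = sqrt (\<Sum>n. (sobolev_norm n (N n) (l n) (component n f))\<^sup>2)"

definition hilbert_norm_of ::
    "('d::finite test_seq \<Rightarrow> real) \<Rightarrow> (nat \<Rightarrow> nat) \<Rightarrow> (nat \<Rightarrow> nat) \<Rightarrow> 'd test_seq \<Rightarrow> real" where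
  "hilbert_norm_of p N l f =
     (if \<forall>g\<in>borchers. p g = 0 \<longrightarrow> g = (\<lambda>_. 0) then p f
      else sqrt ((p f)\<^sup>2 + (sobolev_sum N l f)\<^sup>2))"


subsection \<open>Ideals\<close>

definition left_ideal :: "'d::finite test_seq set \<Rightarrow> bool" where
  "left_ideal I \<longleftrightarrow> I \<subseteq> borchers \<and> (\<lambda>_. 0) \<in> I \<and>
     (\<forall>f\<in>I. \<forall>g\<in>I. (\<lambda>xs. f xs + g xs) \<in> I) \<and> (\<forall>c. \<forall>f\<in>I. (\<lambda>xs. c * f xs) \<in> I) \<and>
     (\<forall>h\<in>borchers. \<forall>f\<in>I. h \<otimes>\<^sub>B f \<in> I)"

definition two_sided_ideal :: "'d::finite test_seq set \<Rightarrow> bool" where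
  "two_sided_ideal I \<longleftrightarrow> left_ideal I \<and> (\<forall>h\<in>borchers. \<forall>f\<in>I. f \<otimes>\<^sub>B h \<in> I)"

definition support1 :: "'d::finite test_seq \<Rightarrow> 'd spacetime set" where
  "support1 f = closure {x. f [x] \<noteq> 0}"

definition fourier :: "'d::{finite,zero} test_seq \<Rightarrow> 'd spacetime \<Rightarrow> complex" where
  "fourier h k = (LINT a | lborel. exp (\<i> * complex_of_real (k \<cdot>\<^sub>M a)) * h [a])"

text \<open>The integral of \<open>h(a)\<close> times the translate of \<open>f\<close> by \<open>a\<close>, evaluated pointwise.\<close>

definition smear_translates :: "'d::finite test_seq \<Rightarrow> 'd test_seq \<Rightarrow> 'd test_seq" where
  "smear_translates f h = (\<lambda>xs. LINT a | lborel. poincare (mat 1) a f xs * h [a])"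

definition spectral_ideal :: "'d::{finite,zero} spacetime set \<Rightarrow> 'd test_seq set" where
  "spectral_ideal K = left_ideal hull
     {smear_translates f h | f h.
        f \<in> borchers \<and> h \<in> schwartz 1 \<and> closure {k. fourier h k \<noteq> 0} \<inter> K = {}}"

definition locality_ideal :: "'d::{finite,zero} test_seq set" where
  "locality_ideal = two_sided_ideal hull
     {\<lambda>xs. (f \<otimes>\<^sub>B h) xs - (h \<otimes>\<^sub>B f) xs | f h.
        f \<in> schwartz 1 \<and> h \<in> schwartz 1 \<and>
        (\<forall>x\<in>support1 f. \<forall>y\<in>support1 h. spacelike (x - y))}"


section \<open>Wightman functionals and quantum fields with indefinite metric\<close>

locale wightman_functional =
  fixes W :: "'d::{finite,zero} test_seq \<Rightarrow> complex"
    and p :: "'d test_seq \<Rightarrow> real"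
  assumes continuous: "W \<in> borchers_dual" and normalized: "W unit_seq = 1"
    and invariant:
      "\<And>\<Lambda> a f. \<lbrakk>proper_orthochronous \<Lambda>; f \<in> borchers\<rbrakk> \<Longrightarrow> W (poincare \<Lambda> a f) = W f"
    and spectral: "spectral_ideal (V\<^sub>+ 0) \<subseteq> functional_kernel W"
    and local: "locality_ideal \<subseteq> functional_kernel W"
    and seminorm: "hilbert_seminorm p"
    and dominated:
      "\<And>f g. \<lbrakk>f \<in> borchers; g \<in> borchers\<rbrakk> \<Longrightarrow> cmod (W (star f \<otimes>\<^sub>B g)) \<le> p f * p g"
    and cluster:
      "\<And>f g a. \<lbrakk>f \<in> borchers; g \<in> borchers; spacelike a\<rbrakk> \<Longrightarrow>
         ((\<lambda>t. W (f \<otimes>\<^sub>B poincare (mat 1) (t *\<^sub>R a) g)) \<longlongrightarrow> W f * W g) at_top"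
    and hermitian: "\<And>f. f \<in> borchers \<Longrightarrow> W (star f) = cnj (W f)"

text \<open>The underlying Hilbert space is the type \<open>'h\<close> with scalar product \<open>sp\<close>, which may differ from
  \<open>cinner\<close>. The map \<open>state\<close> sends a test sequence to the corresponding vector of the domain;
  operators on the domain are functions on \<open>'h\<close> of which only the values on the domain matter.\<close>

record ('d::finite, 'h) iqft =
  state :: "'d test_seq \<Rightarrow> 'h"
  sp :: "'h \<Rightarrow> 'h \<Rightarrow> complex"
  metric :: "'h \<Rightarrow> 'h"
  rep :: "'d spacetime_matrix \<Rightarrow> 'd spacetime \<Rightarrow> 'h \<Rightarrow> 'h"
  field_op :: "'d test_seq \<Rightarrow> 'h \<Rightarrow> 'h"

definition dom :: "('d::finite, 'h) iqft \<Rightarrow> 'h set" where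
  "dom Q = state Q ` borchers"

definition vacuum :: "('d::finite, 'h) iqft \<Rightarrow> 'h" where
  "vacuum Q = state Q unit_seq"

definition indef :: "('d::finite, 'h) iqft \<Rightarrow> 'h \<Rightarrow> 'h \<Rightarrow> complex" where
  "indef Q v w = sp Q v (metric Q w)"

definition field_algebra :: "('d::finite, 'h) iqft \<Rightarrow> ('h \<Rightarrow> 'h) set" where
  "field_algebra Q = field_op Q ` borchers"

text \<open>The steps of the construction: \<open>\<iota>\<close> maps the Borchers algebra into its completion \<open>'h1\<close>, on
  which \<open>F\<close> is the extension of \<open>W (star f \<otimes>\<^sub>B g)\<close>; \<open>quot\<close> divides out the kernel of \<open>F\<close>, giving
  \<open>'h2\<close> with metric operator \<open>\<eta>2\<close>; and \<open>emb\<close> is the canonical map of \<open>'h2\<close> into \<open>'h\<close>, the completion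
  of the domain in the scalar product \<open>(x, \<bar>\<eta>2\<bar> y)\<close>. It is defined on all of \<open>'h2\<close> by continuity.
  The sign of \<open>\<eta>2\<close> extends to \<open>\<eta>0\<close>; finally \<open>sp Q\<close> and \<open>metric Q\<close> are an equivalent scalar product
  and metric operator for the same indefinite form, with the metric operator fixing the vacuum.\<close>

locale associated_qft =
  fixes W :: "'d::{finite,zero} test_seq \<Rightarrow> complex"
    and p :: "'d test_seq \<Rightarrow> real"
    and N l :: "nat \<Rightarrow> nat"
    and \<iota> :: "'d test_seq \<Rightarrow> 'h1::complex_hilbert"
    and F :: "'h1 \<Rightarrow> 'h1 \<Rightarrow> complex"
    and quot :: "'h1 \<Rightarrow> 'h2::complex_hilbert"
    and \<eta>2 abs_\<eta>2 sign_\<eta>2 :: "'h2 \<Rightarrow> 'h2"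
    and emb :: "'h2 \<Rightarrow> 'h::complex_hilbert"
    and \<eta>0 :: "'h \<Rightarrow> 'h"
    and Q :: "('d, 'h) iqft"
  assumes \<iota>_linear: "linear_on_borchers \<iota>"
    and \<iota>_norm: "\<And>f. f \<in> borchers \<Longrightarrow> norm (\<iota> f) = hilbert_norm_of p N l f"
    and \<iota>_dense: "closure (\<iota> ` borchers) = UNIV"
    and F_bounded: "bounded_sesquilinear F"
    and F_eq: "\<And>f g. \<lbrakk>f \<in> borchers; g \<in> borchers\<rbrakk> \<Longrightarrow> F (\<iota> f) (\<iota> g) = W (star f \<otimes>\<^sub>B g)"
    and quot: "hilbert_quotient {v. \<forall>w. F w v = 0} quot"
    and \<eta>2: "\<And>v w. F v w = cinner (quot v) (\<eta>2 (quot w))"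
    and abs_\<eta>2: "is_abs_of \<eta>2 abs_\<eta>2"
    and sign_\<eta>2: "is_sign_of \<eta>2 sign_\<eta>2"
    and emb_linear: "bounded_clinear emb"
    and emb_cinner: "\<And>x y. cinner (emb x) (emb y) = cinner x (abs_\<eta>2 y)"
    and emb_dense: "closure ((\<lambda>f. emb (quot (\<iota> f))) ` borchers) = UNIV"
    and \<eta>0_linear: "bounded_clinear \<eta>0"
    and \<eta>0_emb: "\<And>x. \<eta>0 (emb x) = emb (sign_\<eta>2 x)"
    and state: "state Q = (\<lambda>f. emb (quot (\<iota> f)))"
    and sp: "equivalent_scalar_product (sp Q)"
    and metric_linear: "bounded_clinear (metric Q)"
    and metric_self_adjoint: "\<And>x y. sp Q (metric Q x) y = sp Q x (metric Q y)"
    and metric_involution: "\<And>x. metric Q (metric Q x) = x"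
    and metric_indef: "\<And>x y. indef Q x y = cinner x (\<eta>0 y)"
    and metric_vacuum: "metric Q (vacuum Q) = vacuum Q"
    and rep: "\<And>\<Lambda> a g. \<lbrakk>proper_orthochronous \<Lambda>; g \<in> borchers\<rbrakk> \<Longrightarrow>
                rep Q \<Lambda> a (state Q g) = state Q (poincare \<Lambda> a g)"
    and field_op: "\<And>f g. \<lbrakk>f \<in> borchers; g \<in> borchers\<rbrakk> \<Longrightarrow>
                field_op Q f (state Q g) = state Q (f \<otimes>\<^sub>B g)"

text \<open>The adjoint, with respect to \<open>sp Q\<close>, of an operator with dense domain \<open>dom Q\<close>. The value
  at \<open>v\<close> is only meaningful if \<open>v\<close> is in the domain of the adjoint.\<close>

definition adjoint_op :: "('d::finite, 'h) iqft \<Rightarrow> ('h \<Rightarrow> 'h) \<Rightarrow> 'h \<Rightarrow> 'h" where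
  "adjoint_op Q L v = (THE w. \<forall>\<Psi>\<in>dom Q. sp Q w \<Psi> = sp Q v (L \<Psi>))"

definition eta_adjoint :: "('d::finite, 'h) iqft \<Rightarrow> ('h \<Rightarrow> 'h) \<Rightarrow> 'h \<Rightarrow> 'h" where
  "eta_adjoint Q L \<Psi> = metric Q (adjoint_op Q L (metric Q \<Psi>))"

text \<open>Boundedness with respect to \<open>sp Q\<close> is the same as boundedness with respect to \<open>norm\<close>.\<close>

definition weak_commutant ::
    "('d::finite, 'h::complex_hilbert) iqft \<Rightarrow> ('h \<Rightarrow> 'h) set \<Rightarrow> ('h \<Rightarrow> 'h) set" where
  "weak_commutant Q \<A> =
     {C. bounded_clinear C \<and>
         (\<forall>\<Psi>1\<in>dom Q. \<forall>\<Psi>2\<in>dom Q. \<forall>L\<in>\<A>.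
            indef Q \<Psi>1 (C (L \<Psi>2)) = indef Q (eta_adjoint Q L \<Psi>1) (C \<Psi>2))}"

definition irreducible_algebra ::
    "('d::finite, 'h::complex_hilbert) iqft \<Rightarrow> ('h \<Rightarrow> 'h) set \<Rightarrow> bool" where
  "irreducible_algebra Q \<A> \<longleftrightarrow> weak_commutant Q \<A> = {\<lambda>v. c *\<^sub>C v | c. True}"

definition translation_invariant :: "('d::finite, 'h) iqft \<Rightarrow> 'h \<Rightarrow> bool" where
  "translation_invariant Q v \<longleftrightarrow>
     (\<forall>a. \<forall>\<Psi>\<in>dom Q. indef Q v (rep Q (mat 1) a \<Psi>) = indef Q v \<Psi>)"

end

theory Submission
  imports Defs "HOL-Probability.Characteristic_Functions" "HOL-Probability.Sinc_Integral"
begin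

text \<open>
  Write \<open>[f]\<close> for the vector of a test sequence \<open>f\<close> and smear its translates with
  \<open>h(a) = \<Prod>\<^sub>j u\<^sub>j(a\<^sup>j)\<close>, where the Fourier transforms of the \<open>u\<^sub>j\<close> are smooth, compactly supported
  and equal to 1 near 0, that of \<open>u\<^sub>0\<close> vanishing for \<open>\<bar>k\<^sup>0\<bar> \<ge> m\<close>. By the mass gap only the momentum
  \<open>k = 0\<close> contributes, so matrix elements of the translates of the smeared vector are polynomial
  along every line; by the cluster property they converge in space-like directions, so they are
  constant and the smeared vector equals \<open>W(f) \<Omega>\<close>. A translation invariant functional does not
  notice the smearing, hence takes the value \<open>c W(f)\<close> on \<open>[f]\<close>; this is (ii). For \<open>C\<close> in the weak
  commutant, \<open>\<langle>\<Omega>, C U(a) [f]\<rangle>\<close> is the complex conjugate of \<open>\<langle>C \<Omega>, U(a) [f\<^sup>*]\<rangle>\<close>. One of these has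
  its momenta in the spectrum, the other in its negative, so again only \<open>k = 0\<close> contributes and
  \<open>\<langle>\<Omega>, C [f]\<rangle> = W(f) \<langle>\<Omega>, C \<Omega>\<rangle>\<close>; the commutation relations extend this to all matrix elements of \<open>C\<close>.

  That \<open>\<langle>[f], [g]\<rangle> = W(f\<^sup>* \<otimes> g)\<close> rests on \<open>\<bar>\<eta>\<^sub>2\<bar> sign \<eta>\<^sub>2 = \<eta>\<^sub>2\<close>, hence on the uniqueness of
  positive square roots.
\<close>

section \<open>Positive operators on complex Hilbert spaces\<close>

text \<open>As the metric is indefinite, translations need not be unitary or even bounded on
  \<open>'h\<close>, and no spectral projection isolates momentum 0. In place of spectral theory,
  Sobolev domination makes every matrix element a tempered functional of the test function, so that
  it grows at most polynomially under translations. Its Fourier transform could still contain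
  derivatives of a delta distribution at 0, that is, polynomials in the translation. Iterated
  differences together with clustering rule these out and stand in for the structure theorem on
  distributions supported in a point. Fourier transforms of distributions are never formed:
  conditions on momenta are imposed on the smearing function, and passing a functional under the
  smearing integral is the task of \<open>tempered_convolve\<close>.

  The energy window below m suffices because k . k is at most the square of the energy: a nonzero
  momentum whose energy is below m in modulus lies outside the massive spectrum. For the commutant
  no energy window is given in advance; there the smearing function is split into parts with
  energies above, below and near 0.\<close>

lemma scaleC_minus_one: "(-1) *\<^sub>C x = - (x::'a::complex_hilbert)"
  using scaleC_of_real[of "-1" x] by simp

lemma cinner_add_left: "cinner (x + y) z = cinner x z + cinner y (z::'a::complex_hilbert)"
  by (metis cinner_commute cinner_add_right complex_cnj_add)

lemma cinner_scaleC_left: "cinner (c *\<^sub>C x) y = cnj c * cinner x (y::'a::complex_hilbert)"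
  by (metis cinner_commute cinner_scaleC_right complex_cnj_mult complex_cnj_cnj)

lemma cinner_minus_right: "cinner x (- y) = - cinner x (y::'a::complex_hilbert)"
  using cinner_scaleC_right[of x "-1" y] by (simp add: scaleC_minus_one)

lemma cinner_minus_left: "cinner (- x) y = - cinner x (y::'a::complex_hilbert)"
  using cinner_scaleC_left[of "-1" x y] by (simp add: scaleC_minus_one)

lemma cinner_diff_right: "cinner x (y - z) = cinner x y - cinner x (z::'a::complex_hilbert)"
  using cinner_add_right[of x y "-z"] by (simp add: cinner_minus_right)

lemma cinner_diff_left: "cinner (x - y) z = cinner x z - cinner y (z::'a::complex_hilbert)"
  using cinner_add_left[of x "-y" z] by (simp add: cinner_minus_left)

lemma cinner_zero_right [simp]: "cinner x 0 = (0::complex)" for x :: "'a::complex_hilbert"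
  using cinner_diff_right[of x x x] by simp

lemma cinner_zero_left [simp]: "cinner 0 x = (0::complex)" for x :: "'a::complex_hilbert"
  using cinner_diff_left[of x x x] by simp

lemmas cinner_algebra = cinner_add_left cinner_add_right cinner_diff_left cinner_diff_right
  cinner_scaleC_left cinner_scaleC_right cinner_minus_left cinner_minus_right

lemma cinner_self_eq_0: "cinner x x = 0 \<longleftrightarrow> x = (0::'a::complex_hilbert)"
  by (simp add: cinner_self)

lemma cinner_ext: "(\<And>x. cinner x y = cinner x z) \<Longrightarrow> y = (z::'a::complex_hilbert)"
  by (metis cinner_diff_right cinner_self_eq_0 eq_iff_diff_eq_0)

text \<open>The form is evaluated at x + c y, with c a real multiple of the conjugate of B x y. Only
  semidefiniteness is assumed, since the lemma is also applied to the form of a positive operator,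
  which may have a kernel.\<close>

lemma psd_form_Cauchy_Schwarz:
  fixes B :: "'a::complex_hilbert \<Rightarrow> 'a \<Rightarrow> complex"
  assumes add: "\<And>x y z. B x (y + z) = B x y + B x z"
    and scale: "\<And>c x y. B x (c *\<^sub>C y) = c * B x y"
    and herm: "\<And>x y. B x y = cnj (B y x)"
    and pos: "\<And>x. 0 \<le> Re (B x x)"
  shows "(cmod (B x y))\<^sup>2 \<le> Re (B x x) * Re (B y y)"
proof -
  define b where "b = B x y"
  have addl: "B (u + v) z = B u z + B v z" for u v z
    by (metis add herm complex_cnj_add)
  have scl: "B (c *\<^sub>C u) z = cnj c * B u z" for c u z
    by (metis scale herm complex_cnj_mult complex_cnj_cnj)
  have *: "0 \<le> Re (B x x) - 2 * t * (cmod b)\<^sup>2 + t\<^sup>2 * (cmod b)\<^sup>2 * Re (B y y)" for t :: real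
  proof -
    define c where "c = - complex_of_real t * cnj b"
    have "B (x + c *\<^sub>C y) (x + c *\<^sub>C y) = B x x + c * b + cnj c * cnj b + cnj c * c * B y y"
      using herm[of y x] by (simp add: add addl scale scl b_def algebra_simps)
    also have "\<dots> = B x x - complex_of_real (2 * t * (cmod b)\<^sup>2) + complex_of_real (t\<^sup>2 * (cmod b)\<^sup>2) * B y y"
      unfolding c_def of_real_mult complex_norm_square[of b] by (simp add: algebra_simps power2_eq_square)
    finally have "Re (B (x + c *\<^sub>C y) (x + c *\<^sub>C y)) = Re (B x x) - 2 * t * (cmod b)\<^sup>2 + t\<^sup>2 * (cmod b)\<^sup>2 * Re (B y y)"
      by simp
    with pos show ?thesis by metis
  qed
  show ?thesis
  proof (cases "Re (B y y) = 0")
    case True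
    \<comment> \<open>For B y y = 0 the inequality is affine in t; the value of t below would turn
      its right-hand side into -1.\<close>
    have "b = 0"
    proof (rule ccontr)
      assume "b \<noteq> 0"
      then have "(cmod b)\<^sup>2 > 0" by simp
      with *[of "(Re (B x x) + 1) / (2 * (cmod b)\<^sup>2)"] True show False by (simp add: field_simps)
    qed
    then show ?thesis using True by (simp add: b_def)
  next
    case False
    then have Y: "Re (B y y) > 0" using pos[of y] by simp
    from *[of "1 / Re (B y y)"] Y have "0 \<le> Re (B x x) - (cmod b)\<^sup>2 / Re (B y y)"
      by (simp add: field_simps power2_eq_square)
    with Y show ?thesis by (simp add: field_simps b_def)
  qed
qed

lemma Cauchy_Schwarz_cinner: "cmod (cinner x y) \<le> norm x * norm (y::'a::complex_hilbert)"
proof -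
  have "(cmod (cinner x y))\<^sup>2 \<le> (norm x * norm y)\<^sup>2"
    using psd_form_Cauchy_Schwarz[of cinner x y, OF cinner_add_right cinner_scaleC_right cinner_commute]
    by (simp add: cinner_self power_mult_distrib)
  then show ?thesis by (rule power2_le_imp_le) simp
qed

lemma bounded_linear_cinner_right: "bounded_linear (cinner (x::'a::complex_hilbert))"
proof (rule bounded_linear_intro[where K = "norm x"])
  show "cinner x (y + z) = cinner x y + cinner x z" for y z by (rule cinner_add_right)
  show "cinner x (r *\<^sub>R y) = r *\<^sub>R cinner x y" for r y
    by (metis cinner_scaleC_right scaleC_of_real scaleR_conv_of_real)
  show "norm (cinner x y) \<le> norm y * norm x" for y
    using Cauchy_Schwarz_cinner[of x y] by (simp add: mult.commute)
qed

lemma norm_scaleC: "norm (c *\<^sub>C x) = cmod c * norm (x::'a::complex_hilbert)"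
proof -
  have "complex_of_real ((norm (c *\<^sub>C x))\<^sup>2) = complex_of_real ((cmod c * norm x)\<^sup>2)"
    unfolding power_mult_distrib of_real_mult complex_norm_square[of c]
    by (simp only: cinner_self[symmetric] cinner_algebra mult_ac)
  then have "(norm (c *\<^sub>C x))\<^sup>2 = (cmod c * norm x)\<^sup>2" using of_real_eq_iff by blast
  then show ?thesis by (rule power2_eq_imp_eq) auto
qed

lemma bounded_clinearI:
  assumes "bounded_linear T" "\<And>c x. T (c *\<^sub>C x) = c *\<^sub>C T x"
  shows "bounded_clinear T"
  using assms by (simp add: bounded_clinear_def)

lemma bounded_clinear_bounded_linear: "bounded_clinear T \<Longrightarrow> bounded_linear T"
  by (simp add: bounded_clinear_def)

lemma bounded_clinear_simps:
  assumes "bounded_clinear T"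
  shows "T (x + y) = T x + T y" "T (x - y) = T x - T y" "T (- x) = - T x" "T 0 = 0"
    "T (c *\<^sub>C x) = c *\<^sub>C T x" "T (r *\<^sub>R x) = r *\<^sub>R T x"
  using assms bounded_linear.linear[OF bounded_clinear_bounded_linear[OF assms]]
  by (auto simp: bounded_clinear_def linear_add linear_diff linear_neg linear_0 linear_scale)

lemma scaleC_scaleR: "c *\<^sub>C r *\<^sub>R x = r *\<^sub>R c *\<^sub>C (x::'a::complex_hilbert)"
  by (metis scaleC_of_real scaleC_scaleC mult.commute)

lemma scaleC_diff_right: "c *\<^sub>C (x - y) = c *\<^sub>C x - c *\<^sub>C (y::'a::complex_hilbert)"
proof -
  have "c *\<^sub>C (x - y) + c *\<^sub>C y = c *\<^sub>C x" by (simp flip: scaleC_add_right)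
  then show ?thesis by (simp add: eq_diff_eq)
qed

lemma bounded_clinear_scaleC: "bounded_clinear (\<lambda>x. c *\<^sub>C (x::'a::complex_hilbert))"
proof (rule bounded_clinearI)
  show "bounded_linear (\<lambda>x. c *\<^sub>C (x::'a))"
    by (rule bounded_linear_intro[where K = "cmod c"])
       (simp_all add: scaleC_add_right scaleC_scaleR norm_scaleC mult.commute)
qed (simp add: scaleC_scaleC mult.commute)

lemma bounded_clinear_compose:
  "bounded_clinear S \<Longrightarrow> bounded_clinear T \<Longrightarrow> bounded_clinear (\<lambda>x. S (T x))"
  by (auto simp: bounded_clinear_def intro: bounded_linear_compose)

lemma bounded_clinear_add:
  "bounded_clinear S \<Longrightarrow> bounded_clinear T \<Longrightarrow> bounded_clinear (\<lambda>x. S x + T x)"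
  by (auto simp: bounded_clinear_def scaleC_add_right intro: bounded_linear_add)

lemma bounded_clinear_sub:
  "bounded_clinear S \<Longrightarrow> bounded_clinear T \<Longrightarrow> bounded_clinear (\<lambda>x. S x - T x)"
  by (auto simp: bounded_clinear_def scaleC_diff_right intro: bounded_linear_sub)

lemma bounded_clinear_ident: "bounded_clinear (\<lambda>x. x)"
  by (simp add: bounded_clinear_def)

section \<open>Self-adjoint and positive operators, products of commuting positive operators\<close>

definition self_adjoint :: "('a::complex_hilbert \<Rightarrow> 'a) \<Rightarrow> bool" where
  "self_adjoint A \<longleftrightarrow> bounded_clinear A \<and> (\<forall>x y. cinner (A x) y = cinner x (A y))"

definition positive_op :: "('a::complex_hilbert \<Rightarrow> 'a) \<Rightarrow> bool" where
  "positive_op A \<longleftrightarrow> self_adjoint A \<and> (\<forall>x. 0 \<le> Re (cinner x (A x)))"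

text \<open>Polarization: a quadratic form that is real at x + y and at x + i y has symmetric
  off-diagonal values.\<close>

lemma positive_opI:
  assumes A: "bounded_clinear A" and q: "\<And>x. cinner x (A x) \<in> \<real> \<and> 0 \<le> Re (cinner x (A x))"
  shows "positive_op A"
proof -
  note A' = bounded_clinear_simps[OF A]
  have "cinner (A x) y = cinner x (A y)" for x y
  proof -
    define a where "a = cinner x (A y)"
    define b where "b = cinner y (A x)"
    have im: "Im (cinner z (A z)) = 0" for z using q[of z] by (simp add: complex_is_Real_iff)
    have "Im (a + b) = 0"
      using im[of "x + y"] im[of x] im[of y] by (simp add: A' cinner_algebra a_def b_def)
    moreover have "Re (a - b) = 0"
      using im[of "x + \<i> *\<^sub>C y"] im[of x] im[of y] by (simp add: A' cinner_algebra a_def b_def)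
    ultimately have "a = cnj b" by (simp add: complex_eq_iff)
    then show ?thesis using cinner_commute[of "A x" y] by (simp add: a_def b_def)
  qed
  with A q show ?thesis by (simp add: positive_op_def self_adjoint_def)
qed

lemma positive_op_clinear: "positive_op A \<Longrightarrow> bounded_clinear A"
  and positive_op_sym: "positive_op A \<Longrightarrow> cinner (A x) y = cinner x (A y)"
  and positive_op_nonneg: "positive_op A \<Longrightarrow> 0 \<le> Re (cinner x (A x))"
  by (simp_all add: positive_op_def self_adjoint_def)

lemma self_adjoint_clinear: "self_adjoint A \<Longrightarrow> bounded_clinear A"
  and self_adjoint_sym: "self_adjoint A \<Longrightarrow> cinner (A x) y = cinner x (A y)"
  by (simp_all add: self_adjoint_def)

lemma positive_op_Cauchy_Schwarz:
  assumes "positive_op A"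
  shows "(cmod (cinner x (A y)))\<^sup>2 \<le> Re (cinner x (A x)) * Re (cinner y (A y))"
  using bounded_clinear_simps[OF positive_op_clinear[OF assms]] assms
  by (intro psd_form_Cauchy_Schwarz[where B = "\<lambda>x y. cinner x (A y)"])
     (simp_all add: cinner_algebra positive_op_nonneg, metis cinner_commute positive_op_sym)

lemma positive_op_kernel:
  assumes "positive_op A" "Re (cinner x (A x)) = 0"
  shows "A x = 0"
  using positive_op_Cauchy_Schwarz[OF assms(1), of "A x" x] assms(2)
  by (simp add: cinner_self_eq_0)

text \<open>A <= 1 implies A^2 <= A: this is the Cauchy-Schwarz inequality for the form of A,
  applied to x and A x.\<close>

lemma positive_op_norm_le:
  assumes A: "positive_op A" and le: "\<And>x. Re (cinner x (A x)) \<le> (norm x)\<^sup>2"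
  shows "(norm (A x))\<^sup>2 \<le> Re (cinner x (A x))"
proof -
  have "(cmod (cinner x (A (A x))))\<^sup>2 \<le> Re (cinner x (A x)) * Re (cinner (A x) (A (A x)))"
    by (rule positive_op_Cauchy_Schwarz[OF A])
  moreover have "cinner x (A (A x)) = complex_of_real ((norm (A x))\<^sup>2)"
    by (metis positive_op_sym[OF A] cinner_self)
  ultimately have "((norm (A x))\<^sup>2)\<^sup>2 \<le> Re (cinner x (A x)) * Re (cinner (A x) (A (A x)))"
    by (simp only: norm_of_real abs_power2)
  also have "\<dots> \<le> Re (cinner x (A x)) * (norm (A x))\<^sup>2"
    using le positive_op_nonneg[OF A] by (intro mult_left_mono)
  finally show ?thesis using positive_op_nonneg[OF A, of x]
    by (cases "A x = 0") (simp_all add: power2_eq_square)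
qed

text \<open>F. Riesz: \<open>S = \<Sum>\<^sub>n S\<^sub>n\<^sup>2\<close> strongly for \<open>0 \<le> S \<le> 1\<close>, where \<open>S\<^sub>0 = S\<close> and \<open>S\<^sub>n\<^sub>+\<^sub>1 = S\<^sub>n - S\<^sub>n\<^sup>2\<close>, so
  that \<open>P S = \<Sum>\<^sub>n S\<^sub>n P S\<^sub>n\<close> is positive if \<open>P\<close> is positive and commutes with \<open>S\<close>.\<close>

primrec riesz_seq :: "('a::complex_hilbert \<Rightarrow> 'a) \<Rightarrow> nat \<Rightarrow> 'a \<Rightarrow> 'a" where
  "riesz_seq S 0 = S"
| "riesz_seq S (Suc n) = (\<lambda>x. riesz_seq S n x - riesz_seq S n (riesz_seq S n x))"

text \<open>The condition 0 <= R <= 1 is preserved: R - R^2 is nonnegative because R^2 <= R, and it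
  is at most R.\<close>

lemma riesz_seq_step:
  assumes "positive_op R" "\<And>x. Re (cinner x (R x)) \<le> (norm x)\<^sup>2"
  shows "positive_op (\<lambda>x. R x - R (R x))" "Re (cinner x (R x - R (R x))) \<le> (norm x)\<^sup>2"
proof -
  have RR: "cinner x (R (R x)) = complex_of_real ((norm (R x))\<^sup>2)" for x
    by (metis positive_op_sym[OF assms(1)] cinner_self)
  have "self_adjoint (\<lambda>x. R x - R (R x))"
    using assms(1) positive_op_clinear[OF assms(1)] unfolding self_adjoint_def
    by (simp add: cinner_algebra positive_op_sym bounded_clinear_sub bounded_clinear_compose)
  moreover have "0 \<le> Re (cinner x (R x - R (R x)))" for x
    using positive_op_norm_le[OF assms, of x] by (simp add: cinner_algebra RR)
  ultimately show "positive_op (\<lambda>x. R x - R (R x))" by (simp add: positive_op_def)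
  show "Re (cinner x (R x - R (R x))) \<le> (norm x)\<^sup>2"
    using assms(2)[of x] by (simp add: cinner_algebra RR) (smt (verit) zero_le_power2)
qed

lemma positive_op_commuting_product_aux:
  assumes P: "positive_op P" and S: "positive_op S" and le: "\<And>x. Re (cinner x (S x)) \<le> (norm x)\<^sup>2"
    and comm: "\<And>x. P (S x) = S (P x)"
  shows "0 \<le> Re (cinner x (P (S x)))"
proof -
  let ?R = "riesz_seq S"
  have R: "positive_op (?R n) \<and> (\<forall>x. Re (cinner x (?R n x)) \<le> (norm x)\<^sup>2)" for n
    by (induction n) (use S le riesz_seq_step in auto)
  have RP: "P (?R n x) = ?R n (P x)" for n x
    by (induction n arbitrary: x) (simp_all add: comm bounded_clinear_simps[OF positive_op_clinear[OF P]])
  have RR: "cinner y (?R n (?R n x)) = cinner (?R n y) (?R n x)" for n x y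
    using R positive_op_sym by metis
  \<comment> \<open>The sum telescopes because consecutive operators differ by the square of the
    earlier one. Its remainder is nonnegative, so the squared norms are summable and the vectors
    tend to 0.\<close>
  have sum: "(\<Sum>k<n. (norm (?R k x))\<^sup>2) = Re (cinner x (S x)) - Re (cinner x (?R n x))" for n
    by (induction n) (auto simp: cinner_algebra RR cinner_self)
  have "summable (\<lambda>k. (norm (?R k x))\<^sup>2)"
    using R positive_op_nonneg
    by (intro summableI_nonneg_bounded[where x = "Re (cinner x (S x))"]) (auto simp: sum)
  then have "(\<lambda>k. sqrt ((norm (?R k x))\<^sup>2)) \<longlonglongrightarrow> sqrt 0"
    by (intro tendsto_real_sqrt summable_LIMSEQ_zero)
  then have lim0: "(\<lambda>k. ?R k x) \<longlonglongrightarrow> 0" by (simp add: tendsto_norm_zero_iff)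
  have eq: "Re (cinner x (P (S x))) = (\<Sum>k<n. Re (cinner (?R k x) (P (?R k x)))) + Re (cinner x (P (?R n x)))" for n
    by (induction n)
       (auto simp: cinner_algebra RR RP bounded_clinear_simps[OF positive_op_clinear[OF P]])
  have "Re (cinner x (P (?R n x))) \<le> Re (cinner x (P (S x)))" for n
    using eq[of n] positive_op_nonneg[OF P] by (simp add: sum_nonneg)
  moreover have "(\<lambda>n. Re (cinner x (P (?R n x)))) \<longlonglongrightarrow> Re (cinner x (P 0))"
    by (intro tendsto_Re bounded_linear.tendsto[OF bounded_linear_cinner_right]
        bounded_linear.tendsto[OF bounded_clinear_bounded_linear[OF positive_op_clinear[OF P]]] lim0)
  ultimately show ?thesis
    using bounded_clinear_simps(4)[OF positive_op_clinear[OF P]]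
    by (intro LIMSEQ_le_const2[where X = "\<lambda>n. Re (cinner x (P (?R n x)))"]) auto
qed

lemma bounded_clinear_quadratic_bound:
  assumes "bounded_clinear S"
  obtains c where "c > 0" "\<And>x. c * Re (cinner x (S x)) \<le> (norm x)\<^sup>2" "\<And>x. c * norm (S x) \<le> norm x"
proof -
  from bounded_linear.pos_bounded[OF bounded_clinear_bounded_linear[OF assms]]
  obtain K where K: "K > 0" "\<And>x. norm (S x) \<le> norm x * K" by auto
  have "Re (cinner x (S x)) \<le> K * (norm x)\<^sup>2" for x
  proof -
    have "Re (cinner x (S x)) \<le> norm x * norm (S x)"
      using Cauchy_Schwarz_cinner[of x "S x"] complex_Re_le_cmod order_trans by blast
    also have "\<dots> \<le> norm x * (norm x * K)" by (intro mult_left_mono K) auto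
    finally show ?thesis by (simp add: power2_eq_square mult_ac)
  qed
  then show ?thesis using K by (intro that[of "1 / K"]) (auto simp: field_simps)
qed

lemma positive_op_scale:
  assumes "positive_op S" "c \<ge> 0"
  shows "positive_op (\<lambda>x. complex_of_real c *\<^sub>C S x)"
  using assms
  by (auto simp: positive_op_def self_adjoint_def cinner_algebra
      intro!: bounded_clinear_compose[OF bounded_clinear_scaleC])

lemma positive_op_commuting_product:
  assumes P: "positive_op P" and S: "positive_op S" and comm: "\<And>x. P (S x) = S (P x)"
  shows "0 \<le> Re (cinner x (P (S x)))"
proof -
  obtain c where c: "c > 0" "\<And>x. c * Re (cinner x (S x)) \<le> (norm x)\<^sup>2"
    using bounded_clinear_quadratic_bound[OF positive_op_clinear[OF S]] by metis
  have "0 \<le> Re (cinner x (P (complex_of_real c *\<^sub>C S x)))"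
    using c(1) positive_op_clinear[OF P]
    by (intro positive_op_commuting_product_aux[OF P, where S = "\<lambda>x. complex_of_real c *\<^sub>C S x"])
       (auto simp: positive_op_scale S cinner_algebra c(2) comm bounded_clinear_simps)
  with c(1) show ?thesis
    by (simp add: bounded_clinear_simps[OF positive_op_clinear[OF P]] cinner_algebra zero_le_mult_iff)
qed

text \<open>S anticommutes with K, hence commutes with K^2, and K^2 S is a product of commuting
  positive operators. So (K x, S K x) = -(x, K^2 S x) is at most 0, while positivity of S makes it
  at least 0.\<close>

lemma anticommuting_positive_op_zero:
  assumes S: "positive_op S" and K: "self_adjoint K" and anti: "\<And>x. S (K x) = - K (S x)"
  shows "S (K x) = 0"
proof (rule positive_op_kernel[OF S])
  note K' = bounded_clinear_simps[OF self_adjoint_clinear[OF K]]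
  have "0 \<le> Re (cinner x (K (K x)))" for x
    by (simp add: self_adjoint_sym[OF K, symmetric] cinner_self)
  then have P: "positive_op (\<lambda>x. K (K x))"
    using self_adjoint_clinear[OF K]
    by (simp add: positive_op_def self_adjoint_def self_adjoint_sym[OF K] bounded_clinear_compose)
  have "0 \<le> Re (cinner x (K (K (S x))))"
    by (rule positive_op_commuting_product[OF P S]) (simp add: anti K')
  moreover have "cinner (K x) (S (K x)) = - cinner x (K (K (S x)))"
    by (simp add: anti cinner_algebra self_adjoint_sym[OF K])
  ultimately show "Re (cinner (K x) (S (K x))) = 0"
    using positive_op_nonneg[OF S, of "K x"] by simp
qed

section \<open>The modulus of an operator: uniqueness and commutation\<close>

lemma is_abs_of_positive: "is_abs_of T A \<Longrightarrow> positive_op A"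
  by (auto simp: is_abs_of_def intro: positive_opI)

lemma is_abs_of_square:
  assumes "is_abs_of T A" shows "cinner x (A (A y)) = cinner (T x) (T y)"
  using assms by (simp add: is_abs_of_def)

text \<open>\<open>A\<^sup>2 = B\<^sup>2\<close> means that \<open>A + B\<close> and \<open>A - B\<close> anticommute.\<close>

lemma is_abs_of_unique:
  assumes A: "is_abs_of T A" and B: "is_abs_of T B"
  shows "A = B"
proof
  fix x
  note pos = is_abs_of_positive[OF A] is_abs_of_positive[OF B]
  note lin = bounded_clinear_simps[OF positive_op_clinear[OF pos(1)]]
    bounded_clinear_simps[OF positive_op_clinear[OF pos(2)]]
  have sq: "A (A x) = B (B x)" for x
    by (rule cinner_ext) (simp only: is_abs_of_square[OF A] is_abs_of_square[OF B])
  let ?K = "\<lambda>x. A x - B x" and ?S = "\<lambda>x. A x + B x"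
  have K: "self_adjoint ?K"
    using pos by (simp add: positive_op_def self_adjoint_def cinner_algebra bounded_clinear_sub)
  have S: "positive_op ?S"
    using pos by (simp add: positive_op_def self_adjoint_def cinner_algebra bounded_clinear_add)
  have "?S (?K x) = 0"
    by (rule anticommuting_positive_op_zero[OF S K]) (simp add: lin sq)
  then have "Re (cinner (?K x) (?S (?K x))) = 0" by (simp only: cinner_zero_right) simp
  then have "Re (cinner (?K x) (A (?K x))) + Re (cinner (?K x) (B (?K x))) = 0"
    unfolding cinner_add_right by simp
  \<comment> \<open>Both terms of the sum are nonnegative, so both vanish. Then \<open>?K x\<close>
    lies in the kernels of A and B, which gives \<open>?K (?K x) = 0\<close> and, by
    self-adjointness, \<open>?K x = 0\<close>.\<close>
  then have "Re (cinner (?K x) (A (?K x))) = 0" "Re (cinner (?K x) (B (?K x))) = 0"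
    using positive_op_nonneg[OF pos(1), of "?K x"] positive_op_nonneg[OF pos(2), of "?K x"] by auto
  then have "A (?K x) = 0" "B (?K x) = 0" using positive_op_kernel pos by blast+
  then have "?K (?K x) = 0" by simp
  then have "cinner (?K x) (?K x) = 0" unfolding self_adjoint_sym[OF K] by simp
  then show "A x = B x" by (simp add: cinner_self_eq_0)
qed

text \<open>The commutator E = T A - A T is skew-adjoint and anticommutes with A, because A^2 = T^2
  commutes with T. Applied to i E, the previous lemma gives A E = 0, and taking adjoints E A = 0.
  Hence E^2 = -A T E and E^3 = 0, and a nilpotent skew-adjoint operator vanishes.\<close>

lemma is_abs_of_commute:
  assumes T: "self_adjoint T" and A: "is_abs_of T A"
  shows "T (A x) = A (T x)"
proof -
  note pos = is_abs_of_positive[OF A]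
  note lin = bounded_clinear_simps[OF positive_op_clinear[OF pos]]
    bounded_clinear_simps[OF self_adjoint_clinear[OF T]]
  have sq: "A (A x) = T (T x)" for x
    by (rule cinner_ext) (metis is_abs_of_square[OF A] self_adjoint_sym[OF T])
  let ?E = "\<lambda>x. T (A x) - A (T x)"
  have Esym: "cinner (?E x) y = - cinner x (?E y)" for x y
    by (simp add: cinner_algebra self_adjoint_sym[OF T] positive_op_sym[OF pos])
  have E: "bounded_clinear ?E"
    using bounded_clinear_compose self_adjoint_clinear[OF T] positive_op_clinear[OF pos]
    by (intro bounded_clinear_sub) blast+
  have K: "self_adjoint (\<lambda>x. \<i> *\<^sub>C ?E x)"
    unfolding self_adjoint_def
  proof (intro conjI allI)
    show "bounded_clinear (\<lambda>x. \<i> *\<^sub>C ?E x)" by (rule bounded_clinear_compose[OF bounded_clinear_scaleC E])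
    show "cinner (\<i> *\<^sub>C ?E x) y = cinner x (\<i> *\<^sub>C ?E y)" for x y
      unfolding cinner_scaleC_left cinner_scaleC_right Esym by simp
  qed
  have "A (\<i> *\<^sub>C ?E x) = 0" for x
  proof (rule anticommuting_positive_op_zero[OF pos K])
    fix x
    show "A (\<i> *\<^sub>C ?E x) = - (\<i> *\<^sub>C ?E (A x))"
      by (simp add: lin scaleC_diff_right sq)
  qed
  then have AE: "A (?E x) = 0" for x
    by (metis lin(5) norm_scaleC norm_ii mult_1 norm_eq_zero)
  have EA: "?E (A x) = 0" for x
  proof (rule cinner_ext)
    show "cinner y (?E (A x)) = cinner y 0" for y
      using Esym[of y "A x"] positive_op_sym[OF pos, of "?E y" x] AE[of y] by simp
  qed
  have EEE: "?E (?E (?E x)) = 0" for x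
  proof -
    have "?E (?E x) = - A (T (?E x))" using AE[of x] by (simp add: lin)
    also have "?E \<dots> = 0" unfolding bounded_clinear_simps(3)[OF E] EA by simp
    finally show ?thesis .
  qed
  have "cinner (?E (?E x)) (?E (?E x)) = 0" using Esym EEE by (metis cinner_zero_right neg_equal_0_iff_equal)
  then have "?E (?E x) = 0" by (simp only: cinner_self_eq_0)
  then have "cinner (?E x) (?E x) = 0" using Esym by (metis cinner_zero_right neg_equal_0_iff_equal)
  then have "?E x = 0" by (simp only: cinner_self_eq_0)
  then show ?thesis by simp
qed

text \<open>The numbers a k = (y, R^k y) decrease: for even k because R <= 1, for odd k because R^2
  <= R, both applied to a power of R at y. Being nonnegative they converge, and the squared distance
  of two iterates is a combination of them.\<close>

lemma positive_contraction_power_converges: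
  fixes R :: "'a::complex_hilbert \<Rightarrow> 'a"
  assumes R: "positive_op R" and le: "\<And>x. Re (cinner x (R x)) \<le> (norm x)\<^sup>2"
  obtains z where "(\<lambda>n. (R ^^ n) y) \<longlonglongrightarrow> z" "R z = z"
proof -
  define a where "a k = Re (cinner y ((R ^^ k) y))" for k
  have sym: "cinner ((R ^^ n) x) z = cinner x ((R ^^ n) z)" for n x z
    by (induction n arbitrary: x z) (simp_all add: positive_op_sym[OF R] funpow_swap1)
  have ip: "Re (cinner ((R ^^ n) y) ((R ^^ k) y)) = a (n + k)" for n k
    by (simp add: sym a_def funpow_add)
  have dec: "a (Suc k) \<le> a k \<and> 0 \<le> a k" for k
  proof (cases "even k")
    case True
    then obtain j where k: "k = j + j" by (metis mult_2 evenE)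
    have "a (j + Suc j) \<le> a (j + j)" "0 \<le> a (j + j)"
      unfolding ip[symmetric] using le[of "(R ^^ j) y"] by (simp_all add: cinner_self)
    then show ?thesis by (simp add: k)
  next
    case False
    then obtain j where k: "k = j + Suc j" by (metis oddE mult_2 add_Suc_right Suc_eq_plus1)
    have *: "(norm (R x))\<^sup>2 \<le> Re (cinner x (R x))" for x by (rule positive_op_norm_le[OF R le])
    have "a (Suc j + Suc j) \<le> a (j + Suc j)" "0 \<le> a (j + Suc j)"
      unfolding ip[symmetric] using *[of "(R ^^ j) y"] positive_op_nonneg[OF R] by (simp_all add: cinner_self)
    then show ?thesis by (simp add: k)
  qed
  have "convergent a"
    using dec by (intro Bseq_monoseq_convergent decseq_imp_monoseq decseq_SucI)
      (auto intro!: BseqI'[of _ "a 0"] simp: decseq_SucI dec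
        decseqD[OF decseq_SucI[of a]])
  then have "Cauchy a" by (rule convergent_Cauchy)
  have "Cauchy (\<lambda>n. (R ^^ n) y)"
  proof (rule CauchyI)
    fix e :: real assume e: "e > 0"
    obtain M where M: "\<And>m n. m \<ge> M \<Longrightarrow> n \<ge> M \<Longrightarrow> norm (a m - a n) < e\<^sup>2 / 2"
      using CauchyD[OF \<open>Cauchy a\<close>, of "e\<^sup>2 / 2"] e by (metis zero_less_divide_iff zero_less_numeral zero_less_power)
    show "\<exists>M. \<forall>m\<ge>M. \<forall>n\<ge>M. norm ((R ^^ m) y - (R ^^ n) y) < e"
    proof (intro exI[of _ M] allI impI)
      fix m n assume mn: "m \<ge> M" "n \<ge> M"
      let ?d = "(R ^^ m) y - (R ^^ n) y"
      have "(norm ?d)\<^sup>2 = Re (cinner ?d ?d)" by (simp add: cinner_self)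
      also have "\<dots> = (a (m + m) - a (m + n)) + (a (n + n) - a (m + n))"
        using ip[of m m] ip[of n n] ip[of m n] ip[of n m] by (simp add: cinner_algebra add.commute)
      also have "\<dots> < e\<^sup>2"
        using M[of "m + m" "m + n"] M[of "n + n" "m + n"] mn unfolding real_norm_def abs_less_iff by force
      finally show "norm ?d < e" using e by (simp add: power_less_imp_less_base)
    qed
  qed
  then obtain z where z: "(\<lambda>n. (R ^^ n) y) \<longlonglongrightarrow> z" using Cauchy_convergent convergent_def by blast
  have "(\<lambda>n. R ((R ^^ n) y)) \<longlonglongrightarrow> R z"
    by (rule bounded_linear.tendsto[OF bounded_clinear_bounded_linear[OF positive_op_clinear[OF R]] z])
  moreover have "(\<lambda>n. R ((R ^^ n) y)) \<longlonglongrightarrow> z" using LIMSEQ_Suc[OF z] by simp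
  ultimately have "R z = z" by (rule LIMSEQ_unique)
  with z show ?thesis by (rule that)
qed

text \<open>The iterates of \<open>1 - c A\<^sup>2\<close> converge to the projection onto the kernel of \<open>A\<close>.\<close>

lemma positive_op_dense_range:
  assumes A: "positive_op A" and inj: "\<And>x. A x = 0 \<Longrightarrow> x = 0"
  shows "closure (range A) = UNIV"
proof -
  note lin = bounded_clinear_simps[OF positive_op_clinear[OF A]]
  \<comment> \<open>With this c the operator 1 - c^2 A^2 lies between 0 and 1, as convergence of its
    iterates demands.\<close>
  obtain c where c: "c > 0" "\<And>x. c * norm (A x) \<le> norm x"
    using bounded_clinear_quadratic_bound[OF positive_op_clinear[OF A]] by metis
  define R where "R x = x - complex_of_real (c\<^sup>2) *\<^sub>C A (A x)" for x
  have RA: "cinner x (R x) = complex_of_real ((norm x)\<^sup>2 - c\<^sup>2 * (norm (A x))\<^sup>2)" for x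
    unfolding R_def cinner_diff_right cinner_scaleC_right positive_op_sym[OF A, symmetric] cinner_self by simp
  have le: "c\<^sup>2 * (norm (A x))\<^sup>2 \<le> (norm x)\<^sup>2" for x
    using power_mono[OF c(2)[of x], of 2] c(1) by (simp add: power_mult_distrib)
  have R: "positive_op R"
  proof (rule positive_opI)
    show "bounded_clinear R" unfolding R_def
      by (intro bounded_clinear_sub bounded_clinear_ident bounded_clinear_compose[OF bounded_clinear_scaleC]
          bounded_clinear_compose[OF positive_op_clinear positive_op_clinear] A)
    show "cinner x (R x) \<in> \<real> \<and> 0 \<le> Re (cinner x (R x))" for x
      unfolding RA using le[of x] by simp
  qed
  have R1: "Re (cinner x (R x)) \<le> (norm x)\<^sup>2" for x unfolding RA by simp
  show ?thesis
  proof (intro equalityI subset_UNIV subsetI)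
    fix y :: 'a
    obtain z where z: "(\<lambda>n. (R ^^ n) y) \<longlonglongrightarrow> z" "R z = z"
      using positive_contraction_power_converges[OF R R1] .
    then have "complex_of_real (c\<^sup>2) *\<^sub>C A (A z) = 0" by (simp add: R_def)
    then have "norm (complex_of_real (c\<^sup>2) *\<^sub>C A (A z)) = 0" by simp
    then have "A (A z) = 0" unfolding norm_scaleC using c(1) by simp
    then have z0: "z = 0" using inj by blast
    \<comment> \<open>Each iterate differs from y by an element of the range of A. The iterates tend
      to 0, so y is a limit of such elements.\<close>
    have in_range: "\<exists>w. (R ^^ n) y = y - A w" for n
    proof (induction n)
      case 0 show ?case by (rule exI[of _ 0]) (simp add: lin)
    next
      case (Suc n)
      then obtain w where "(R ^^ n) y = y - A w" by blast
      then have "(R ^^ Suc n) y = y - A (w + complex_of_real (c\<^sup>2) *\<^sub>C A (y - A w))"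
        by (simp add: R_def lin)
      then show ?case by blast
    qed
    have "(\<lambda>n. y - (R ^^ n) y) \<longlonglongrightarrow> y - 0" using z(1) unfolding z0 by (intro tendsto_intros)
    moreover have "y - (R ^^ n) y \<in> range A" for n using in_range[of n] by auto
    ultimately show "y \<in> closure (range A)"
      unfolding closure_sequential by (intro exI[of _ "\<lambda>n. y - (R ^^ n) y"]) simp
  qed
qed

text \<open>The polar decomposition supplies V A = T, but the opposite order is needed. On the range
  of A it follows from A V A = A T = T A, and that range is dense because A is injective along with
  T.\<close>

lemma abs_sign:
  assumes T: "self_adjoint T" and inj: "\<And>x. T x = 0 \<Longrightarrow> x = 0"
    and A: "is_abs_of T A" and V: "is_sign_of T V"
  shows "A (V y) = T y"
proof -
  from V obtain B where "is_abs_of T B" and VB: "\<And>x. V (B x) = T x" and Vl: "bounded_clinear V"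
    by (auto simp: is_sign_of_def)
  then have VA: "V (A x) = T x" for x using is_abs_of_unique[OF A] by metis
  note pos = is_abs_of_positive[OF A]
  have "A x = 0 \<Longrightarrow> x = 0" for x
    using is_abs_of_square[OF A, of x x] inj bounded_clinear_simps(4)[OF positive_op_clinear[OF pos]]
    by (simp add: cinner_self_eq_0)
  then have dense: "closure (range A) = UNIV" by (rule positive_op_dense_range[OF pos])
  have "bounded_linear (\<lambda>y. A (V y) - T y)"
    by (rule bounded_clinear_bounded_linear[OF bounded_clinear_sub[OF
          bounded_clinear_compose[OF positive_op_clinear[OF pos] Vl] self_adjoint_clinear[OF T]]])
  then have "continuous_on UNIV (\<lambda>y. A (V y) - T y)" by (simp add: linear_continuous_on)
  then have "A (V y) - T y = 0"
    using continuous_constant_on_closure[where S = "range A" and f = "\<lambda>y. A (V y) - T y" and a = 0 and x = y]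
    unfolding dense by (metis (no_types, lifting) UNIV_I VA is_abs_of_commute[OF T A] image_iff right_minus_eq)
  then show ?thesis by simp
qed

section \<open>Schwartz functions\<close>

lemma has_vector_derivative_iff_LIM:
  "(f has_vector_derivative D) (at (x::real)) \<longleftrightarrow>
     ((\<lambda>y. (f y - f x) /\<^sub>R (y - x)) \<longlongrightarrow> D) (at x)"
proof -
  have "(f has_vector_derivative D) (at x) \<longleftrightarrow>
      ((\<lambda>y. norm ((f y - f x) - (y - x) *\<^sub>R D) / norm (y - x)) \<longlongrightarrow> 0) (at x)"
    by (simp add: has_vector_derivative_def has_derivative_iff_norm bounded_linear_scaleR_left)
  also have "\<dots> \<longleftrightarrow> ((\<lambda>y. norm ((f y - f x) /\<^sub>R (y - x) - D)) \<longlongrightarrow> 0) (at x)"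
  proof (rule tendsto_cong)
    have "norm (f y - f x - (y - x) *\<^sub>R D) / norm (y - x) = norm ((f y - f x) /\<^sub>R (y - x) - D)"
      if "y \<noteq> x" for y
    proof -
      have "(f y - f x) /\<^sub>R (y - x) - D = (f y - f x - (y - x) *\<^sub>R D) /\<^sub>R (y - x)"
        using that by (simp add: scaleR_diff_right)
      then show ?thesis by (simp add: divide_inverse_commute)
    qed
    then show "\<forall>\<^sub>F y in at x. norm (f y - f x - (y - x) *\<^sub>R D) / norm (y - x) =
        norm ((f y - f x) /\<^sub>R (y - x) - D)"
      by (auto simp: eventually_at_filter)
  qed
  also have "\<dots> \<longleftrightarrow> ((\<lambda>y. (f y - f x) /\<^sub>R (y - x)) \<longlongrightarrow> D) (at x)"
    by (simp add: tendsto_norm_zero_iff Lim_null[symmetric])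
  finally show ?thesis .
qed

lemma vector_derivative_bound:
  fixes f :: "real \<Rightarrow> 'a::real_normed_vector"
  assumes "\<And>t. (f has_vector_derivative f' t) (at t)" "\<And>t. t \<in> closed_segment x y \<Longrightarrow> norm (f' t) \<le> B"
  shows "norm (f y - f x) \<le> B * \<bar>y - x\<bar>"
proof -
  have "norm (f y - f x) \<le> B * norm (y - x)"
  proof (rule differentiable_bound[where f' = "\<lambda>t h. h *\<^sub>R f' t" and S = "closed_segment x y"])
    show "(f has_derivative (\<lambda>h. h *\<^sub>R f' t)) (at t within closed_segment x y)" for t
      using assms(1)[of t] by (auto simp: has_vector_derivative_def intro: has_derivative_at_withinI)
    show "onorm (\<lambda>h. h *\<^sub>R f' t) \<le> B" if "t \<in> closed_segment x y" for t
      using assms(2)[OF that] by (intro onorm_le) (simp add: mult.commute[of B] mult_left_mono)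
  qed auto
  then show ?thesis by simp
qed

text \<open>The mean value inequality bounds the difference quotients by B, so dominated convergence
  applies along every sequence tending to t0.\<close>

lemma has_vector_derivative_integral:
  fixes G :: "real \<Rightarrow> 'a \<Rightarrow> complex"
  assumes int: "\<And>t. integrable M (G t)"
    and der: "\<And>a t. a \<in> space M \<Longrightarrow> ((\<lambda>t. G t a) has_vector_derivative G' t a) (at t)"
    and bound: "\<And>a t. a \<in> space M \<Longrightarrow> norm (G' t a) \<le> B a" and B: "integrable M B"
  shows "((\<lambda>t. LINT a|M. G t a) has_vector_derivative (LINT a|M. G' t0 a)) (at t0)"
  unfolding has_vector_derivative_iff_LIM tendsto_at_iff_sequentially
proof (intro allI impI)
  fix X :: "nat \<Rightarrow> real" assume X: "\<forall>i. X i \<in> UNIV - {t0}" "X \<longlonglongrightarrow> t0"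
  let ?q = "\<lambda>i a. (G (X i) a - G t0 a) /\<^sub>R (X i - t0)"
  have lim: "(\<lambda>i. ?q i a) \<longlonglongrightarrow> G' t0 a" if "a \<in> space M" for a
    using der[OF that, of t0] X unfolding has_vector_derivative_iff_LIM tendsto_at_iff_sequentially
    by (auto simp: o_def)
  have meas [measurable]: "G t \<in> borel_measurable M" for t
    by (rule borel_measurable_integrable[OF int])
  have "(\<lambda>i. LINT a|M. ?q i a) \<longlonglongrightarrow> (LINT a|M. G' t0 a)"
  proof (rule integral_dominated_convergence[where w = B])
    show "AE a in M. (\<lambda>i. ?q i a) \<longlonglongrightarrow> G' t0 a" using lim by simp
    show "G' t0 \<in> borel_measurable M"
      by (rule borel_measurable_LIMSEQ_metric[where f = ?q, OF _ lim]) measurable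
    show "AE a in M. norm (?q i a) \<le> B a" for i
    proof (intro AE_I2)
      fix a assume a: "a \<in> space M"
      have "norm (G (X i) a - G t0 a) \<le> B a * \<bar>X i - t0\<bar>"
        by (rule vector_derivative_bound[OF der[OF a] bound[OF a]])
      moreover have "X i \<noteq> t0" using X by auto
      ultimately show "norm (?q i a) \<le> B a" by (simp add: divide_simps mult.commute)
    qed
  qed (use B in auto)
  then show "((\<lambda>y. ((LINT a|M. G y a) - (LINT a|M. G t0 a)) /\<^sub>R (y - t0)) \<circ> X) \<longlonglongrightarrow> (LINT a|M. G' t0 a)"
    by (simp add: o_def int)
qed

section \<open>Partial derivatives of functions on lists\<close>

lemma length_shift_coord [simp]: "length (shift_coord ib xs t) = length xs"
  by (cases ib) (simp add: shift_coord_def)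

lemma shift_coord_0 [simp]: "shift_coord ib xs 0 = xs"
  by (cases ib) (simp add: shift_coord_def)

lemma shift_coord_shift_coord: "shift_coord ib (shift_coord ib xs s) t = shift_coord ib xs (s + t)"
proof (cases ib)
  case (Pair i b)
  then show ?thesis
    by (cases "i < length xs") (simp_all add: shift_coord_def list_update_beyond algebra_simps)
qed

lemma shift_coord_map:
  "i < length xs \<Longrightarrow> shift_coord (i, b) (map (\<lambda>x. x - a) xs) t = map (\<lambda>x. x - a) (shift_coord (i, b) xs t)"
  by (simp add: shift_coord_def map_update algebra_simps)

lemma partials_Nil [simp]: "partials [] f = f"
  and partials_Cons: "partials (ib # \<alpha>) f = partial ib (partials \<alpha> f)"
  and partials_append: "partials (\<alpha> @ \<beta>) f = partials \<alpha> (partials \<beta> f)"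
  by (simp_all add: partials_def)

lemma multi_indices_Nil [simp]: "[] \<in> multi_indices n"
  by (simp add: multi_indices_def)

lemma multi_indices_Cons: "(i, b) # \<alpha> \<in> multi_indices n \<longleftrightarrow> i < n \<and> \<alpha> \<in> multi_indices n"
  by (auto simp: multi_indices_def)

text \<open>The equality holds on lists of every length, not only on those of length n. This allows
  derivatives to be rewritten inside \<open>partials\<close>, which iterates on functions of
  arbitrary lists.\<close>

lemma partial_eq:
  assumes "\<And>xs. length xs \<noteq> n \<Longrightarrow> f xs = 0" "\<And>xs. length xs \<noteq> n \<Longrightarrow> g xs = 0"
    and "\<And>xs. length xs = n \<Longrightarrow> ((\<lambda>t. f (shift_coord ib xs t)) has_vector_derivative g xs) (at 0)"
  shows "partial ib f = g"
proof
  fix xs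
  show "partial ib f xs = g xs"
  proof (cases "length xs = n")
    case True
    then show ?thesis by (simp add: partial_def vector_derivative_at assms(3))
  next
    case False
    then have "(\<lambda>t. f (shift_coord ib xs t)) = (\<lambda>t. 0)" using assms(1) by (intro ext) simp
    then show ?thesis using False assms(2) by (simp add: partial_def)
  qed
qed

text \<open>Schwartz functions form the largest class of rapidly decaying continuous functions that is
  closed under partial derivatives.\<close>

lemma schwartz_coinduct:
  fixes C :: "'d::finite test_seq set"
  assumes f: "f \<in> C"
    and zero: "\<And>f xs. f \<in> C \<Longrightarrow> length xs \<noteq> n \<Longrightarrow> f xs = 0"
    and cont: "\<And>f. f \<in> C \<Longrightarrow> continuous_on UNIV (\<lambda>x :: nat \<Rightarrow> 'd spacetime. f (map x [0..<n]))"
    and decay: "\<And>f N. f \<in> C \<Longrightarrow> \<exists>B. \<forall>xs. length xs = n \<longrightarrow> (1 + list_norm xs) ^ N * cmod (f xs) \<le> B"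
    and deriv: "\<And>f i b. f \<in> C \<Longrightarrow> i < n \<Longrightarrow> \<exists>g\<in>C. \<forall>xs. length xs = n \<longrightarrow>
        ((\<lambda>t. f (shift_coord (i, b) xs t)) has_vector_derivative g xs) (at 0)"
  shows "f \<in> schwartz n"
proof -
  have part: "partial (i, b) f \<in> C \<and> (\<forall>xs. length xs = n \<longrightarrow>
        ((\<lambda>t. f (shift_coord (i, b) xs t)) has_vector_derivative partial (i, b) f xs) (at 0))"
    if "f \<in> C" "i < n" for f i b
  proof -
    from deriv[OF that] obtain g where g: "g \<in> C" "\<And>xs. length xs = n \<Longrightarrow>
        ((\<lambda>t. f (shift_coord (i, b) xs t)) has_vector_derivative g xs) (at 0)" by blast
    have "partial (i, b) f = g"
      by (rule partial_eq[where n = n]) (use zero that g in auto)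
    with g show ?thesis by simp
  qed
  have C: "partials \<alpha> f \<in> C" if "\<alpha> \<in> multi_indices n" for \<alpha>
    using that by (induction \<alpha>) (auto simp: f partials_Cons multi_indices_Cons part)
  have "smooth n f"
    unfolding smooth_def
  proof (intro ballI conjI allI impI)
    fix \<alpha> :: "(nat \<times> 'd) list" and ib :: "nat \<times> 'd" and xs :: "'d spacetime list"
    assume "\<alpha> \<in> multi_indices n" "ib \<in> {..<n} \<times> UNIV" "length xs = n"
    then show "(\<lambda>t. partials \<alpha> f (shift_coord ib xs t)) differentiable at 0"
      using part[OF C, of \<alpha> "fst ib" "snd ib"] differentiableI_vector by fastforce
  qed (use C cont in auto)
  then show ?thesis using C f zero decay by (auto simp: schwartz_def)
qed

lemma list_norm_nonneg [simp]: "0 \<le> list_norm xs"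
  by (auto simp: list_norm_def intro!: sum_list_nonneg)

lemma schwartz_zero_length: "f \<in> schwartz n \<Longrightarrow> length xs \<noteq> n \<Longrightarrow> f xs = 0"
  by (simp add: schwartz_def)

lemma schwartz_continuous:
  "f \<in> schwartz n \<Longrightarrow> continuous_on UNIV (\<lambda>x :: nat \<Rightarrow> 'd::finite spacetime. f (map x [0..<n]))"
  by (auto simp: schwartz_def smooth_def dest!: bspec[where x = "[]"])

lemma schwartz_decay:
  assumes "f \<in> schwartz n"
  obtains B where "B \<ge> 0" "\<And>xs. (1 + list_norm xs) ^ N * cmod (f xs) \<le> B"
proof -
  have "\<exists>C. \<forall>xs. length xs = n \<longrightarrow> (1 + list_norm xs) ^ N * cmod (partials [] f xs) \<le> C"
    using assms multi_indices_Nil unfolding schwartz_def by blast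
  then obtain C where C: "\<And>xs. length xs = n \<Longrightarrow> (1 + list_norm xs) ^ N * cmod (f xs) \<le> C" by auto
  show ?thesis
  proof (rule that[of "max C 0"])
    show "(1 + list_norm xs) ^ N * cmod (f xs) \<le> max C 0" for xs
      using C[of xs] schwartz_zero_length[OF assms, of xs] by (cases "length xs = n") (auto simp: le_max_iff_disj)
  qed simp
qed

lemma schwartz_bounded:
  assumes "f \<in> schwartz n"
  obtains B where "B \<ge> 0" "\<And>xs. cmod (f xs) \<le> B"
  using schwartz_decay[OF assms, of 0] by auto

lemma schwartz_partial_deriv0:
  assumes "f \<in> schwartz n" "i < n" "length xs = n"
  shows "((\<lambda>t. f (shift_coord (i, b) xs t)) has_vector_derivative partial (i, b) f xs) (at 0)"
proof -
  have "(\<lambda>t. partials [] f (shift_coord (i, b) xs t)) differentiable at 0"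
  proof -
    have "\<forall>ib\<in>{..<n} \<times> UNIV. \<forall>xs. length xs = n \<longrightarrow>
        (\<lambda>t. partials [] f (shift_coord ib xs t)) differentiable at 0"
      using assms(1) multi_indices_Nil[of n] unfolding schwartz_def smooth_def by fast
    from bspec[OF this, of "(i, b)"] assms(2,3) show ?thesis by simp
  qed
  then show ?thesis unfolding partial_def partials_Nil by (rule vector_derivative_works[THEN iffD1])
qed

text \<open>Smoothness only speaks of derivatives at parameter 0; the group law of coordinate shifts
  carries them to any t.\<close>

lemma schwartz_partial_deriv:
  assumes "f \<in> schwartz n" "i < n" "length xs = n"
  shows "((\<lambda>t. f (shift_coord (i, b) xs t)) has_vector_derivative
           partial (i, b) f (shift_coord (i, b) xs t)) (at t)"
proof -
  have "((\<lambda>s. f (shift_coord (i, b) (shift_coord (i, b) xs t) s)) has_vector_derivative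
           partial (i, b) f (shift_coord (i, b) xs t)) (at 0)"
    using assms by (intro schwartz_partial_deriv0) auto
  then have "((\<lambda>s. f (shift_coord (i, b) xs (t + s))) has_vector_derivative
           partial (i, b) f (shift_coord (i, b) xs t)) (at (t - t))"
    by (simp add: shift_coord_shift_coord)
  then show ?thesis
    unfolding has_vector_derivative_def
    using has_derivative_compose[OF has_derivative_diff[OF has_derivative_ident has_derivative_const],
       where g = "\<lambda>s. f (shift_coord (i, b) xs (t + s))" and x = t and s = UNIV, of _ t]
    by (simp add: has_vector_derivative_def)
qed

lemma schwartz_partial:
  assumes f: "f \<in> schwartz n" and i: "i < n"
  shows "partial (i, b) f \<in> schwartz n"
proof -
  have app: "partials \<alpha> (partial (i, b) f) = partials (\<alpha> @ [(i, b)]) f" for \<alpha>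
    by (simp add: partials_append partials_Cons)
  have mem: "\<alpha> @ [(i, b)] \<in> multi_indices n" if "\<alpha> \<in> multi_indices n" for \<alpha>
    using that i by (auto simp: multi_indices_def)
  have zero: "partial (i, b) f xs = 0" if "length xs \<noteq> n" for xs
  proof -
    have "(\<lambda>t. f (shift_coord (i, b) xs t)) = (\<lambda>t. 0)"
      using schwartz_zero_length[OF f] that by (intro ext) simp
    then show ?thesis by (simp add: partial_def)
  qed
  have "smooth n (partial (i, b) f)"
    using f mem unfolding smooth_def app by (auto simp: schwartz_def smooth_def)
  moreover have "\<forall>N. \<forall>\<alpha>\<in>multi_indices n. \<exists>C. \<forall>xs. length xs = n \<longrightarrow>
      (1 + list_norm xs) ^ N * cmod (partials \<alpha> (partial (i, b) f) xs) \<le> C"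
    using f mem unfolding app by (auto simp: schwartz_def)
  ultimately show ?thesis using zero by (simp add: schwartz_def)
qed

lemma schwartz_partials:
  "f \<in> schwartz n \<Longrightarrow> \<alpha> \<in> multi_indices n \<Longrightarrow> partials \<alpha> f \<in> schwartz n"
  by (induction \<alpha>) (auto simp: partials_Cons multi_indices_Cons schwartz_partial)

lemma schwartz_zero: "(\<lambda>_. 0) \<in> schwartz n"
  by (rule schwartz_coinduct[where C = "{\<lambda>_. 0}"]) auto

lemma schwartz_linear_combination:
  fixes f :: "'d::finite test_seq"
  assumes "f \<in> schwartz n" "g \<in> schwartz n"
  shows "(\<lambda>xs. c * f xs + d * g xs) \<in> schwartz n"
proof (rule schwartz_coinduct[where C = "{\<lambda>xs. c * f xs + d * g xs | f g. f \<in> schwartz n \<and> g \<in> schwartz n}"])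
  fix h :: "'d test_seq" and N assume "h \<in> {\<lambda>xs. c * f xs + d * g xs | f g. f \<in> schwartz n \<and> g \<in> schwartz n}"
  then obtain f g where h: "h = (\<lambda>xs. c * f xs + d * g xs)" and fg: "f \<in> schwartz n" "g \<in> schwartz n" by auto
  obtain A where A: "\<And>xs. (1 + list_norm xs) ^ N * cmod (f xs) \<le> A" by (rule schwartz_decay[OF fg(1), of N]) blast
  obtain B where B: "\<And>xs. (1 + list_norm xs) ^ N * cmod (g xs) \<le> B" by (rule schwartz_decay[OF fg(2), of N]) blast
  have "(1 + list_norm xs) ^ N * cmod (h xs) \<le> cmod c * A + cmod d * B" for xs
  proof -
    have "(1 + list_norm xs) ^ N * cmod (h xs) \<le> (1 + list_norm xs) ^ N * (cmod c * cmod (f xs) + cmod d * cmod (g xs))"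
      unfolding h by (intro mult_left_mono norm_triangle_le) (auto simp: norm_mult)
    also have "\<dots> = cmod c * ((1 + list_norm xs) ^ N * cmod (f xs)) + cmod d * ((1 + list_norm xs) ^ N * cmod (g xs))"
      by (simp add: algebra_simps)
    also have "\<dots> \<le> cmod c * A + cmod d * B" using A B by (intro add_mono mult_left_mono) auto
    finally show ?thesis .
  qed
  then show "\<exists>B. \<forall>xs. length xs = n \<longrightarrow> (1 + list_norm xs) ^ N * cmod (h xs) \<le> B" by blast
next
  fix h :: "'d test_seq" and i and b :: 'd assume "h \<in> {\<lambda>xs. c * f xs + d * g xs | f g. f \<in> schwartz n \<and> g \<in> schwartz n}" and i: "i < n"
  then obtain f g where h: "h = (\<lambda>xs. c * f xs + d * g xs)" and fg: "f \<in> schwartz n" "g \<in> schwartz n" by auto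
  show "\<exists>g\<in>{\<lambda>xs. c * f xs + d * g xs | f g. f \<in> schwartz n \<and> g \<in> schwartz n}. \<forall>xs. length xs = n \<longrightarrow>
        ((\<lambda>t. h (shift_coord (i, b) xs t)) has_vector_derivative g xs) (at 0)"
    unfolding h using schwartz_partial[OF fg(1) i] schwartz_partial[OF fg(2) i]
    by (intro bexI[of _ "\<lambda>xs. c * partial (i, b) f xs + d * partial (i, b) g xs"])
       (auto intro!: derivative_intros schwartz_partial_deriv0 fg i)
next
  fix h :: "'d test_seq" assume "h \<in> {\<lambda>xs. c * f xs + d * g xs | f g. f \<in> schwartz n \<and> g \<in> schwartz n}"
  then obtain f g where h: "h = (\<lambda>xs. c * f xs + d * g xs)" and fg: "f \<in> schwartz n" "g \<in> schwartz n" by auto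
  show "continuous_on UNIV (\<lambda>x :: nat \<Rightarrow> 'd spacetime. h (map x [0..<n]))"
    unfolding h by (intro continuous_on_add continuous_on_mult continuous_on_const schwartz_continuous fg)
qed (use assms in \<open>auto simp: schwartz_zero_length\<close>)

lemma schwartz_add: "f \<in> schwartz n \<Longrightarrow> g \<in> schwartz n \<Longrightarrow> (\<lambda>xs. f xs + g xs) \<in> schwartz n"
  using schwartz_linear_combination[of f n g 1 1] by simp

lemma schwartz_scale: "f \<in> schwartz n \<Longrightarrow> (\<lambda>xs. c * f xs) \<in> schwartz n"
  using schwartz_linear_combination[of f n f c 0] by simp

lemma partial_linear_combination:
  assumes "f \<in> schwartz n" "g \<in> schwartz n" "i < n"
  shows "partial (i, b) (\<lambda>xs. c * f xs + d * g xs) = (\<lambda>xs. c * partial (i, b) f xs + d * partial (i, b) g xs)"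
  using assms
  by (intro partial_eq[where n = n])
     (auto simp: schwartz_zero_length schwartz_zero_length[OF schwartz_partial]
       intro!: derivative_intros schwartz_partial_deriv0)

lemma partials_linear_combination:
  assumes "f \<in> schwartz n" "g \<in> schwartz n" "\<alpha> \<in> multi_indices n"
  shows "partials \<alpha> (\<lambda>xs. c * f xs + d * g xs) = (\<lambda>xs. c * partials \<alpha> f xs + d * partials \<alpha> g xs)"
  using assms(3)
  by (induction \<alpha>)
     (use assms(1,2) in \<open>auto simp: partials_Cons multi_indices_Cons
        partial_linear_combination[OF schwartz_partials schwartz_partials]\<close>)

lemma schwartz_star:
  fixes f :: "'d::finite test_seq"
  assumes "f \<in> schwartz n"
  shows "star f \<in> schwartz n"
proof (rule schwartz_coinduct[where C = "star ` schwartz n"])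
  fix h :: "'d test_seq" and N assume "h \<in> star ` schwartz n"
  then obtain f where h: "h = star f" and f: "f \<in> schwartz n" by auto
  obtain A where A: "\<And>xs. (1 + list_norm xs) ^ N * cmod (f xs) \<le> A" by (rule schwartz_decay[OF f, of N]) blast
  have "list_norm (rev xs) = list_norm xs" for xs :: "'d spacetime list"
    by (simp add: list_norm_def rev_map[symmetric] sum_list_rev)
  then show "\<exists>B. \<forall>xs. length xs = n \<longrightarrow> (1 + list_norm xs) ^ N * cmod (h xs) \<le> B"
    using A by (intro exI[of _ A]) (metis complex_mod_cnj h star_def)
  \<comment> \<open>Reversal permutes the points by i -> n - 1 - i, so that continuity and
    derivatives of \<open>star f\<close> reduce to those of f with permuted points.\<close>
  have rev: "rev (map x [0..<n]) = map (\<lambda>i. x (n - 1 - i)) [0..<n]" for x :: "nat \<Rightarrow> 'd spacetime"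
    by (rule nth_equalityI) (auto simp: rev_nth)
  have "continuous_on UNIV ((\<lambda>x. f (map x [0..<n])) \<circ> (\<lambda>x i. x (n - 1 - i)))"
    by (intro continuous_on_compose continuous_on_coordinatewise_then_product
        continuous_on_product_coordinates continuous_on_subset[OF schwartz_continuous[OF f]]) auto
  then show "continuous_on UNIV (\<lambda>x. h (map x [0..<n]))"
    unfolding h star_def rev o_def by (intro continuous_intros)
next
  fix h :: "'d test_seq" and i and b :: 'd assume "h \<in> star ` schwartz n" and i: "i < n"
  then obtain f where h: "h = star f" and f: "f \<in> schwartz n" by auto
  have rev: "rev (shift_coord (i, b) xs t) = shift_coord (n - 1 - i, b) (rev xs) t" if "length xs = n" for xs t
    using that i by (simp add: shift_coord_def rev_update rev_nth)
  have "((\<lambda>t. star f (shift_coord (i, b) xs t)) has_vector_derivative star (partial (n - 1 - i, b) f) xs) (at 0)"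
    if "length xs = n" for xs
    unfolding star_def rev[OF that] using i that
    by (intro has_vector_derivative_cnj schwartz_partial_deriv0[OF f]) auto
  then show "\<exists>g\<in>star ` schwartz n. \<forall>xs. length xs = n \<longrightarrow>
        ((\<lambda>t. h (shift_coord (i, b) xs t)) has_vector_derivative g xs) (at 0)"
    unfolding h using schwartz_partial[OF f, of "n - 1 - i" b] i by auto
qed (use assms in \<open>auto simp: star_def schwartz_zero_length\<close>)

lemma tensor_schwartz_eq:
  assumes "f \<in> schwartz j" "g \<in> schwartz l"
  shows "(f \<otimes>\<^sub>B g) xs = (if length xs = j + l then f (take j xs) * g (drop j xs) else 0)"
proof -
  have "(f \<otimes>\<^sub>B g) xs = (\<Sum>i\<le>length xs. if i = j then f (take j xs) * g (drop j xs) else 0)"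
    unfolding tensor_def
    by (rule sum.cong) (auto simp: schwartz_zero_length[OF assms(1)])
  also have "\<dots> = (if j \<le> length xs then f (take j xs) * g (drop j xs) else 0)" by simp
  also have "\<dots> = (if length xs = j + l then f (take j xs) * g (drop j xs) else 0)"
    using schwartz_zero_length[OF assms(2), of "drop j xs"] by auto
  finally show ?thesis .
qed

lemma list_norm_append: "(list_norm (xs @ ys))\<^sup>2 = (list_norm xs)\<^sup>2 + (list_norm ys)\<^sup>2"
proof -
  have "0 \<le> (\<Sum>x\<leftarrow>zs. (norm x)\<^sup>2)" for zs :: "'a list" by (auto intro!: sum_list_nonneg)
  then show ?thesis by (simp add: list_norm_def)
qed

lemma list_norm_append_le: "list_norm (xs @ ys) \<le> list_norm xs + list_norm ys"
  by (rule power2_le_imp_le) (simp_all add: list_norm_append power2_sum)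

text \<open>Each coordinate belongs to exactly one of the two factors, so a partial derivative of a
  product is again a single product and no Leibniz sum arises. Hence the simple products form a
  class closed under derivatives.\<close>

lemma schwartz_tensor:
  fixes f :: "'d::finite test_seq"
  assumes "f \<in> schwartz j" "g \<in> schwartz l"
  shows "f \<otimes>\<^sub>B g \<in> schwartz (j + l)"
proof (rule schwartz_coinduct[where C = "{f \<otimes>\<^sub>B g | f g. f \<in> schwartz j \<and> g \<in> schwartz l}"])
  fix h :: "'d test_seq" and N assume "h \<in> {f \<otimes>\<^sub>B g | f g. f \<in> schwartz j \<and> g \<in> schwartz l}"
  then obtain f g where h: "h = f \<otimes>\<^sub>B g" and fg: "f \<in> schwartz j" "g \<in> schwartz l" by auto
  obtain A where A: "A \<ge> 0" "\<And>xs. (1 + list_norm xs) ^ N * cmod (f xs) \<le> A" by (rule schwartz_decay[OF fg(1), of N]) blast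
  obtain B where B: "B \<ge> 0" "\<And>xs. (1 + list_norm xs) ^ N * cmod (g xs) \<le> B" by (rule schwartz_decay[OF fg(2), of N]) blast
  have "(1 + list_norm xs) ^ N * cmod (h xs) \<le> A * B" if "length xs = j + l" for xs
  proof -
    let ?a = "list_norm (take j xs)" and ?b = "list_norm (drop j xs)"
    have "1 + list_norm xs \<le> 1 + (?a + ?b)"
      using list_norm_append_le[of "take j xs" "drop j xs"] by simp
    also have "\<dots> \<le> (1 + ?a) * (1 + ?b)" by (simp add: algebra_simps)
    finally have "(1 + list_norm xs) ^ N \<le> ((1 + ?a) * (1 + ?b)) ^ N" by (intro power_mono) auto
    then have "(1 + list_norm xs) ^ N * cmod (h xs) \<le> ((1 + ?a) * (1 + ?b)) ^ N * (cmod (f (take j xs)) * cmod (g (drop j xs)))"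
      unfolding h tensor_schwartz_eq[OF fg] using that by (auto simp: norm_mult intro!: mult_right_mono)
    also have "\<dots> = ((1 + ?a) ^ N * cmod (f (take j xs))) * ((1 + ?b) ^ N * cmod (g (drop j xs)))"
      by (simp add: power_mult_distrib)
    also have "\<dots> \<le> A * B" using A B by (intro mult_mono) auto
    finally show ?thesis .
  qed
  then show "\<exists>B. \<forall>xs. length xs = j + l \<longrightarrow> (1 + list_norm xs) ^ N * cmod (h xs) \<le> B" by blast
  have *: "take j (map x [0..<j + l]) = map x [0..<j]" "drop j (map x [0..<j + l]) = map (\<lambda>i. x (i + j)) [0..<l]"
    for x :: "nat \<Rightarrow> 'd spacetime"
    by (rule nth_equalityI; simp add: add.commute)+
  have "continuous_on UNIV ((\<lambda>x. g (map x [0..<l])) \<circ> (\<lambda>x i. x (i + j)))"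
    by (intro continuous_on_compose continuous_on_coordinatewise_then_product
        continuous_on_product_coordinates continuous_on_subset[OF schwartz_continuous[OF fg(2)]]) auto
  then show "continuous_on UNIV (\<lambda>x. h (map x [0..<j + l]))"
    unfolding h tensor_schwartz_eq[OF fg] * o_def
    using schwartz_continuous[OF fg(1)] by (auto intro!: continuous_intros)
next
  fix h :: "'d test_seq" and i and b :: 'd assume "h \<in> {f \<otimes>\<^sub>B g | f g. f \<in> schwartz j \<and> g \<in> schwartz l}" and i: "i < j + l"
  then obtain f g where h: "h = f \<otimes>\<^sub>B g" and fg: "f \<in> schwartz j" "g \<in> schwartz l" by auto
  show "\<exists>g\<in>{f \<otimes>\<^sub>B g | f g. f \<in> schwartz j \<and> g \<in> schwartz l}. \<forall>xs. length xs = j + l \<longrightarrow>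
        ((\<lambda>t. h (shift_coord (i, b) xs t)) has_vector_derivative g xs) (at 0)"
  proof (cases "i < j")
    case True
    have "((\<lambda>t. h (shift_coord (i, b) xs t)) has_vector_derivative (partial (i, b) f \<otimes>\<^sub>B g) xs) (at 0)"
      if xs: "length xs = j + l" for xs
    proof -
      have "h (shift_coord (i, b) xs t) = f (shift_coord (i, b) (take j xs) t) * g (drop j xs)" for t
        unfolding h tensor_schwartz_eq[OF fg] using True xs by (simp add: shift_coord_def take_update_swap drop_update_cancel)
      then show ?thesis
        using xs by (auto simp: tensor_schwartz_eq[OF schwartz_partial[OF fg(1) True] fg(2)]
            intro!: has_vector_derivative_mult_left schwartz_partial_deriv0 fg True)
    qed
    then show ?thesis using fg schwartz_partial[OF fg(1) True] by blast
  next
    case False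
    then have il: "i - j < l" using i by simp
    have "((\<lambda>t. h (shift_coord (i, b) xs t)) has_vector_derivative (f \<otimes>\<^sub>B partial (i - j, b) g) xs) (at 0)"
      if xs: "length xs = j + l" for xs
    proof -
      have "h (shift_coord (i, b) xs t) = f (take j xs) * g (shift_coord (i - j, b) (drop j xs) t)" for t
        unfolding h tensor_schwartz_eq[OF fg] using False xs by (simp add: shift_coord_def take_update_cancel drop_update_swap)
      then show ?thesis
        using xs by (auto simp: tensor_schwartz_eq[OF fg(1) schwartz_partial[OF fg(2) il]]
            intro!: has_vector_derivative_mult_right schwartz_partial_deriv0 fg il)
    qed
    then show ?thesis using fg schwartz_partial[OF fg(2) il] by blast
  qed
qed (use assms in \<open>auto simp: tensor_schwartz_eq\<close>)

lemma list_norm_L2_set: "list_norm xs = L2_set (\<lambda>i. norm (xs ! i)) {..<length xs}"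
  by (simp add: list_norm_def L2_set_def sum_list_sum_nth atLeast0LessThan)

lemma list_norm_near:
  fixes xs ys :: "'a::real_normed_vector list"
  assumes len: "length xs = n" "length ys = n" and c: "c \<ge> 0"
    and near: "\<And>i. i < n \<Longrightarrow> norm (xs ! i - ys ! i) \<le> c"
  shows "1 + list_norm xs \<le> (1 + real n) * (1 + c) * (1 + list_norm ys)"
proof -
  have "list_norm xs \<le> L2_set (\<lambda>i. norm (ys ! i) + c) {..<n}"
    unfolding list_norm_L2_set len
  proof (rule L2_set_mono)
    show "norm (xs ! i) \<le> norm (ys ! i) + c" if "i \<in> {..<n}" for i
      using near[of i] that norm_triangle_sub[of "xs ! i" "ys ! i"] by simp
  qed auto
  also have "\<dots> \<le> L2_set (\<lambda>i. norm (ys ! i)) {..<n} + L2_set (\<lambda>i. c) {..<n}"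
    by (rule L2_set_triangle_ineq)
  also have "L2_set (\<lambda>i. c) {..<n} \<le> (\<Sum>i<n. c)" using c by (intro L2_set_le_sum) auto
  finally have "list_norm xs \<le> list_norm ys + real n * c" by (simp add: list_norm_L2_set len)
  also have "1 + \<dots> \<le> (1 + real n) * (1 + c) * (1 + list_norm ys)"
    using c list_norm_nonneg[of ys] mult_nonneg_nonneg[OF c list_norm_nonneg[of ys]]
    by (simp add: algebra_simps)
  finally show ?thesis by simp
qed

text \<open>Moving every point by at most c changes the weight by a factor of at most (1 + n) (1 +
  c). In this form a decay bound at ys is carried over to xs.\<close>

lemma weight_near:
  fixes xs ys :: "'a::real_normed_vector list"
  assumes "length xs = n" "length ys = n" "c \<ge> 0"
    and "\<And>i. i < n \<Longrightarrow> norm (xs ! i - ys ! i) \<le> c"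
    and B: "(1 + list_norm ys) ^ N * v \<le> B" "v \<ge> 0"
  shows "(1 + list_norm xs) ^ N * v \<le> ((1 + real n) * (1 + c)) ^ N * B"
proof -
  have "(1 + list_norm xs) ^ N * v \<le> ((1 + real n) * (1 + c) * (1 + list_norm ys)) ^ N * v"
    using list_norm_near[OF assms(1-4)] by (intro mult_right_mono power_mono B) auto
  also have "\<dots> = ((1 + real n) * (1 + c)) ^ N * ((1 + list_norm ys) ^ N * v)"
    by (simp add: power_mult_distrib)
  also have "\<dots> \<le> ((1 + real n) * (1 + c)) ^ N * B"
    using assms(3) by (intro mult_left_mono B) auto
  finally show ?thesis .
qed

subsection \<open>Translations\<close>

definition translate :: "'d::finite spacetime \<Rightarrow> 'd test_seq \<Rightarrow> 'd test_seq" where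
  "translate a f = (\<lambda>xs. f (map (\<lambda>x. x - a) xs))"

lemma poincare_translation:
  fixes a :: "'d::finite spacetime"
  shows "poincare (mat 1) a f = translate a f"
proof -
  have "matrix_inv (mat 1 :: real^'d^'d) = mat 1"
    unfolding matrix_inv_def by (rule some_equality) (simp_all add: matrix_mul_lid)
  then show ?thesis by (simp add: poincare_def translate_def)
qed

lemma translate_0 [simp]: "translate 0 f = f"
  by (simp add: translate_def)

lemma translate_continuous:
  assumes f: "f \<in> schwartz n"
  shows "continuous_on UNIV (\<lambda>a. translate a f xs)"
proof (cases "length xs = n")
  case True
  then have eq: "map (\<lambda>x. x - a) xs = map (\<lambda>i. xs ! i - a) [0..<n]" for a
    by (intro nth_equalityI) auto
  have "continuous_on UNIV ((\<lambda>x. f (map x [0..<n])) \<circ> (\<lambda>a i. xs ! i - a))"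
    by (intro continuous_on_compose continuous_on_coordinatewise_then_product continuous_intros
        continuous_on_subset[OF schwartz_continuous[OF f]]) auto
  then show ?thesis by (simp add: translate_def eq o_def)
next
  case False
  then show ?thesis by (simp add: translate_def schwartz_zero_length[OF f])
qed

lemma translate_deriv:
  assumes "f \<in> schwartz n" "i < n" "length xs = n"
  shows "((\<lambda>t. translate a f (shift_coord (i, b) xs t)) has_vector_derivative
           translate a (partial (i, b) f) (shift_coord (i, b) xs t)) (at t)"
  unfolding translate_def using schwartz_partial_deriv[of f n i "map (\<lambda>x. x - a) xs" b t] assms
  by (simp add: shift_coord_map)

lemma translate_weight:
  assumes B: "\<And>xs. (1 + list_norm xs) ^ N * cmod (f xs) \<le> B" and len: "length xs = n"
  shows "(1 + list_norm xs) ^ N * cmod (translate a f xs) \<le> ((1 + real n) * (1 + norm a)) ^ N * B"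
  unfolding translate_def
  by (rule weight_near[where ys = "map (\<lambda>x. x - a) xs"]) (auto simp: len B)

lemma schwartz_translate:
  fixes f :: "'d::finite test_seq"
  assumes "f \<in> schwartz n"
  shows "translate a f \<in> schwartz n"
proof (rule schwartz_coinduct[where C = "translate a ` schwartz n"])
  fix h :: "'d test_seq" and N assume "h \<in> translate a ` schwartz n"
  then obtain f where h: "h = translate a f" and f: "f \<in> schwartz n" by auto
  obtain B where "\<And>xs. (1 + list_norm xs) ^ N * cmod (f xs) \<le> B" by (rule schwartz_decay[OF f, of N]) blast
  from translate_weight[OF this]
  show "\<exists>B. \<forall>xs. length xs = n \<longrightarrow> (1 + list_norm xs) ^ N * cmod (h xs) \<le> B"
    unfolding h by blast
  have "continuous_on UNIV ((\<lambda>x. f (map x [0..<n])) \<circ> (\<lambda>x i. x i - a))"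
    by (intro continuous_on_compose continuous_on_coordinatewise_then_product continuous_intros
        continuous_on_product_coordinates continuous_on_subset[OF schwartz_continuous[OF f]]) auto
  then show "continuous_on UNIV (\<lambda>x. h (map x [0..<n]))"
    by (simp add: h translate_def o_def)
next
  fix h :: "'d test_seq" and i and b :: 'd assume "h \<in> translate a ` schwartz n" and i: "i < n"
  then obtain f where h: "h = translate a f" and f: "f \<in> schwartz n" by auto
  show "\<exists>g\<in>translate a ` schwartz n. \<forall>xs. length xs = n \<longrightarrow>
        ((\<lambda>t. h (shift_coord (i, b) xs t)) has_vector_derivative g xs) (at 0)"
    unfolding h using translate_deriv[OF f i, of _ a b 0] schwartz_partial[OF f i] by auto
qed (use assms in \<open>auto simp: translate_def schwartz_zero_length\<close>)

lemma partial_translate: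
  assumes "f \<in> schwartz n" "i < n"
  shows "partial (i, b) (translate a f) = translate a (partial (i, b) f)"
proof (rule partial_eq[where n = n])
  show "((\<lambda>t. translate a f (shift_coord (i, b) xs t)) has_vector_derivative translate a (partial (i, b) f) xs) (at 0)"
    if "length xs = n" for xs
    using translate_deriv[OF assms that, of a b 0] by simp
qed (use assms in \<open>auto simp: translate_def schwartz_zero_length schwartz_zero_length[OF schwartz_partial]\<close>)

lemma partials_translate:
  assumes "f \<in> schwartz n" "\<alpha> \<in> multi_indices n"
  shows "partials \<alpha> (translate a f) = translate a (partials \<alpha> f)"
  using assms(2)
  by (induction \<alpha>)
     (auto simp: partials_Cons multi_indices_Cons partial_translate[OF schwartz_partials[OF assms(1)]])

text \<open>Going from \<open>xs\<close> to the translated list one coordinate at a time.\<close>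

lemma translate_lipschitz:
  fixes f :: "'d::finite test_seq"
  assumes f: "f \<in> schwartz n"
  obtains K where "K \<ge> 0" "\<And>c xs. norm c \<le> 1 \<Longrightarrow>
    (1 + list_norm xs) ^ N * cmod (translate c f xs - f xs) \<le> K * norm c"
proof -
  define I where "I = {..<n} \<times> (UNIV :: 'd set)"
  have "\<exists>B. B \<ge> 0 \<and> (\<forall>xs. (1 + list_norm xs) ^ N * cmod (partial ib f xs) \<le> B)" if "ib \<in> I" for ib
    using that schwartz_decay[OF schwartz_partial[OF f, of "fst ib" "snd ib"], of N] unfolding I_def
    by (metis mem_Sigma_iff lessThan_iff prod.collapse)
  then obtain B where B: "\<And>ib. ib \<in> I \<Longrightarrow> B ib \<ge> 0"
    "\<And>ib xs. ib \<in> I \<Longrightarrow> (1 + list_norm xs) ^ N * cmod (partial ib f xs) \<le> B ib"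
    by metis
  \<comment> \<open>The factor from \<open>weight_near\<close> for displacements of length at most
    1.\<close>
  define K0 where "K0 = ((1 + real n) * (1 + 1)) ^ N"
  have K0: "K0 \<ge> 0" by (simp add: K0_def)
  have main: "(1 + list_norm xs) ^ N * cmod (translate c f xs - f xs) \<le> (\<Sum>ib\<in>I. K0 * B ib) * norm c"
    if c: "norm c \<le> 1" and len: "length xs = n" for c xs
  proof -
    \<comment> \<open>In \<open>y S\<close> exactly the coordinates in S have already been
      translated. On the way all points stay within distance 1 of those of xs.\<close>
    define y where "y S = map (\<lambda>i. \<chi> j. xs ! i $ j - (if (i, j) \<in> S then c $ j else 0)) [0..<n]" for S
    have near: "norm (xs ! i' - shift_coord (i, j) (y S) t ! i') \<le> 1"
      if "(i, j) \<in> I - S" "\<bar>t\<bar> \<le> \<bar>c $ j\<bar>" "i' < n" for i j S t i'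
    proof -
      have "norm (xs ! i' - shift_coord (i, j) (y S) t ! i') \<le> norm c"
      proof (rule norm_le_componentwise_cart)
        show "norm ((xs ! i' - shift_coord (i, j) (y S) t ! i') $ j') \<le> norm (c $ j')" for j'
          using that by (cases "i = i'") (auto simp: shift_coord_def y_def I_def axis_def)
      qed
      with c show ?thesis by simp
    qed
    have step: "(1 + list_norm xs) ^ N * cmod (f (y S) - f xs) \<le> (\<Sum>ib\<in>S. K0 * B ib) * norm c" if "finite S" "S \<subseteq> I" for S
      using that
    proof (induction S rule: finite_induct)
      case empty
      have "y {} = xs" by (rule nth_equalityI) (auto simp: y_def len)
      then show ?case by simp
    next
      case (insert ib S)
      obtain i j where ib: "ib = (i, j)" by (cases ib)
      then have ij: "(i, j) \<in> I - S" "(i, j) \<in> I" and i: "i < n" using insert by (auto simp: I_def)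
      have ins: "y (insert ib S) = shift_coord (i, j) (y S) (- c $ j)"
        by (rule nth_equalityI)
           (use ij i in \<open>auto simp: ib y_def shift_coord_def vec_eq_iff axis_def nth_list_update\<close>)
      have ylen: "length (y S) = n" by (simp add: y_def)
      define w where "w = (1 + list_norm xs) ^ N"
      have w: "w > 0" unfolding w_def by (simp add: add_pos_nonneg)
      \<comment> \<open>The mean value inequality along one coordinate. The weight is evaluated at
        the fixed list xs, so it may be divided out of the bound on the derivative.\<close>
      have "cmod (f (shift_coord (i, j) (y S) (- c $ j)) - f (shift_coord (i, j) (y S) 0)) \<le> (K0 * B ib / w) * \<bar>- c $ j - 0\<bar>"
      proof (rule vector_derivative_bound[OF schwartz_partial_deriv[OF f i ylen]])
        fix t assume t: "t \<in> closed_segment 0 (- c $ j)"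
        then have "\<bar>t\<bar> \<le> \<bar>c $ j\<bar>" by (auto simp: closed_segment_eq_real_ivl split: if_splits)
        then have "w * cmod (partial (i, j) f (shift_coord (i, j) (y S) t)) \<le> K0 * B ib"
          unfolding w_def K0_def ib using len ylen near[OF ij(1)] B(2)[OF ij(2)]
          by (intro weight_near[where n = n and ys = "shift_coord (i, j) (y S) t"]) auto
        with w show "cmod (partial (i, j) f (shift_coord (i, j) (y S) t)) \<le> K0 * B ib / w"
          by (simp add: field_simps)
      qed
      then have "w * cmod (f (y (insert ib S)) - f (y S)) \<le> K0 * B ib * \<bar>c $ j\<bar>"
        using w by (simp add: ins field_simps)
      also have "\<dots> \<le> K0 * B ib * norm c"
        using component_le_norm_cart[of c j] K0 B(1)[OF ij(2)] by (intro mult_left_mono) (auto simp: ib)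
      finally have 1: "w * cmod (f (y (insert ib S)) - f (y S)) \<le> K0 * B ib * norm c" .
      have "w * cmod (f (y (insert ib S)) - f xs) \<le> w * (cmod (f (y (insert ib S)) - f (y S)) + cmod (f (y S) - f xs))"
        using w norm_triangle_ineq[of "f (y (insert ib S)) - f (y S)" "f (y S) - f xs"] by simp
      also have "\<dots> \<le> K0 * B ib * norm c + (\<Sum>ib\<in>S. K0 * B ib) * norm c"
        using 1 insert unfolding w_def by (simp add: distrib_left)
      also have "\<dots> = (\<Sum>ib\<in>insert ib S. K0 * B ib) * norm c"
        using insert by (simp add: algebra_simps)
      finally show ?case unfolding w_def .
    qed
    have "y I = map (\<lambda>x. x - c) xs"
      by (rule nth_equalityI) (auto simp: y_def len I_def vec_eq_iff)
    then show ?thesis using step[of I] by (simp add: I_def translate_def)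
  qed
  show ?thesis
  proof (rule that)
    show "(\<Sum>ib\<in>I. K0 * B ib) \<ge> 0" using K0 B by (intro sum_nonneg) auto
    then show "(1 + list_norm xs) ^ N * cmod (translate c f xs - f xs) \<le> (\<Sum>ib\<in>I. K0 * B ib) * norm c"
      if "norm c \<le> 1" for c xs
      using main[OF that, of xs] schwartz_zero_length[OF f, of xs]
        schwartz_zero_length[OF schwartz_translate[OF f], of xs c]
      by (cases "length xs = n") auto
  qed
qed

subsection \<open>Convolution with rapidly decaying functions\<close>

text \<open>No smoothness is asked for: the class must survive multiplication by indicators of balls
  and their complements, which cut a smearing function into small pieces.\<close>

definition rapid :: "('d::finite spacetime \<Rightarrow> complex) \<Rightarrow> bool" where
  "rapid k \<longleftrightarrow> k \<in> borel_measurable borel \<and> (\<forall>N. integrable lborel (\<lambda>a. (1 + norm a) ^ N * cmod (k a)))"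

definition convolve :: "'d::finite test_seq \<Rightarrow> ('d spacetime \<Rightarrow> complex) \<Rightarrow> 'd test_seq" where
  "convolve f k = (\<lambda>xs. LINT a|lborel. translate a f xs * k a)"

lemma smear_translates_convolve: "smear_translates f h = convolve f (\<lambda>a. h [a])"
  by (simp add: smear_translates_def convolve_def poincare_translation)

lemma rapid_measurable [measurable_dest]: "rapid k \<Longrightarrow> k \<in> borel_measurable borel"
  and rapid_integrable: "rapid k \<Longrightarrow> integrable lborel (\<lambda>a. (1 + norm a) ^ N * cmod (k a))"
  by (auto simp: rapid_def)

lemma rapid_integrable_poly_bounded:
  assumes k: "rapid k" and F: "F \<in> borel_measurable borel" and bound: "\<And>a. cmod (F a) \<le> C * (1 + norm a) ^ N"
  shows "integrable lborel (\<lambda>a. F a * k a)"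
proof (rule Bochner_Integration.integrable_bound)
  show "integrable lborel (\<lambda>a. C * ((1 + norm a) ^ N * cmod (k a)))"
    using rapid_integrable[OF k] by simp
  show "AE a in lborel. norm (F a * k a) \<le> norm (C * ((1 + norm a) ^ N * cmod (k a)))"
  proof (rule AE_I2)
    fix a
    have "cmod (F a * k a) \<le> C * (1 + norm a) ^ N * cmod (k a)"
      using bound[of a] by (simp add: norm_mult mult_right_mono)
    then show "norm (F a * k a) \<le> norm (C * ((1 + norm a) ^ N * cmod (k a)))"
      by (simp only: real_norm_def mult.assoc[symmetric])
  qed
  show "(\<lambda>a. F a * k a) \<in> borel_measurable lborel"
    using F rapid_measurable[OF k] by measurable
qed

lemma rapid_L1: "rapid k \<Longrightarrow> integrable lborel k"
  using rapid_integrable_poly_bounded[of k "\<lambda>_. 1" 1 0] by simp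

lemma rapid_indicator:
  assumes "rapid k" "A \<in> sets borel"
  shows "rapid (\<lambda>a. indicator A a * k a)"
  unfolding rapid_def
proof (intro conjI allI)
  show "(\<lambda>a. indicator A a * k a) \<in> borel_measurable borel"
    using rapid_measurable[OF assms(1)] assms(2) by measurable
  show "integrable lborel (\<lambda>a. (1 + norm a) ^ N * cmod (indicator A a * k a))" for N
    using rapid_measurable[OF assms(1)] assms(2)
    by (intro Bochner_Integration.integrable_bound[OF rapid_integrable[OF assms(1), of N]])
       (auto simp: indicator_def norm_mult)
qed

lemma convolve_integrable:
  assumes f: "f \<in> schwartz n" and k: "rapid k"
  shows "integrable lborel (\<lambda>a. translate a f xs * k a)"
proof -
  obtain B where "\<And>xs. cmod (f xs) \<le> B" by (rule schwartz_bounded[OF f]) blast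
  then show ?thesis
    using borel_measurable_continuous_onI[OF translate_continuous[OF f, of xs]]
    by (intro rapid_integrable_poly_bounded[OF k, where C = B and N = 0]) (auto simp: translate_def)
qed

lemma convolve_weight:
  assumes f: "f \<in> schwartz n" and k: "rapid k"
    and B: "\<And>xs. (1 + list_norm xs) ^ N * cmod (f xs) \<le> B" and len: "length xs = n"
  shows "(1 + list_norm xs) ^ N * cmod (convolve f k xs) \<le>
           (1 + real n) ^ N * B * (LINT a|lborel. (1 + norm a) ^ N * cmod (k a))"
proof -
  let ?w = "(1 + list_norm xs) ^ N"
  have "?w * cmod (convolve f k xs) \<le> ?w * (LINT a|lborel. cmod (translate a f xs * k a))"
    unfolding convolve_def by (intro mult_left_mono integral_norm_bound) auto
  also have "\<dots> = (LINT a|lborel. ?w * cmod (translate a f xs * k a))" by simp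
  also have "\<dots> \<le> (LINT a|lborel. (1 + real n) ^ N * B * ((1 + norm a) ^ N * cmod (k a)))"
  proof (rule integral_mono)
    show "integrable lborel (\<lambda>a. ?w * cmod (translate a f xs * k a))"
      using convolve_integrable[OF f k] by simp
    show "integrable lborel (\<lambda>a. (1 + real n) ^ N * B * ((1 + norm a) ^ N * cmod (k a)))"
      using rapid_integrable[OF k] by simp
    fix a
    have "?w * cmod (translate a f xs) \<le> ((1 + real n) * (1 + norm a)) ^ N * B"
      by (rule translate_weight[OF B len])
    then have "?w * cmod (translate a f xs) * cmod (k a) \<le> ((1 + real n) * (1 + norm a)) ^ N * B * cmod (k a)"
      by (rule mult_right_mono) simp
    then show "?w * cmod (translate a f xs * k a) \<le> (1 + real n) ^ N * B * ((1 + norm a) ^ N * cmod (k a))"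
      by (simp add: norm_mult power_mult_distrib mult_ac)
  qed
  finally show ?thesis by simp
qed

text \<open>The derivative falls on f alone, so the smearing function may be merely
  measurable.\<close>

lemma convolve_deriv:
  assumes f: "f \<in> schwartz n" and k: "rapid k" and i: "i < n" and len: "length xs = n"
  shows "((\<lambda>t. convolve f k (shift_coord (i, b) xs t)) has_vector_derivative
           convolve (partial (i, b) f) k xs) (at 0)"
proof -
  obtain B where B: "\<And>xs. cmod (partial (i, b) f xs) \<le> B"
    by (rule schwartz_bounded[OF schwartz_partial[OF f i]]) blast
  have "((\<lambda>t. LINT a|lborel. translate a f (shift_coord (i, b) xs t) * k a) has_vector_derivative
      (LINT a|lborel. translate a (partial (i, b) f) (shift_coord (i, b) xs 0) * k a)) (at 0)"
  proof (rule has_vector_derivative_integral[where B = "\<lambda>a. B * cmod (k a)"])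
    show "((\<lambda>t. translate a f (shift_coord (i, b) xs t) * k a) has_vector_derivative
        translate a (partial (i, b) f) (shift_coord (i, b) xs t) * k a) (at t)" for a t
      by (rule has_vector_derivative_mult_left[OF translate_deriv[OF f i len]])
    show "norm (translate a (partial (i, b) f) (shift_coord (i, b) xs t) * k a) \<le> B * cmod (k a)" for a t
      using B by (simp add: norm_mult translate_def mult_right_mono)
  qed (use convolve_integrable[OF f k] rapid_L1[OF k] in auto)
  then show ?thesis by (simp add: convolve_def)
qed

lemma schwartz_convolve:
  fixes f :: "'d::finite test_seq"
  assumes "f \<in> schwartz n" and k: "rapid k"
  shows "convolve f k \<in> schwartz n"
proof (rule schwartz_coinduct[where C = "(\<lambda>f. convolve f k) ` schwartz n"])
  fix h :: "'d test_seq" and N assume "h \<in> (\<lambda>f. convolve f k) ` schwartz n"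
  then obtain f where h: "h = convolve f k" and f: "f \<in> schwartz n" by auto
  obtain B where "\<And>xs. (1 + list_norm xs) ^ N * cmod (f xs) \<le> B" by (rule schwartz_decay[OF f, of N]) blast
  from convolve_weight[OF f k this]
  show "\<exists>B. \<forall>xs. length xs = n \<longrightarrow> (1 + list_norm xs) ^ N * cmod (h xs) \<le> B"
    unfolding h by blast
  obtain B where B: "\<And>xs. cmod (f xs) \<le> B" by (rule schwartz_bounded[OF f]) blast
  show "continuous_on UNIV (\<lambda>x. h (map x [0..<n]))"
    unfolding continuous_on_sequentially
  proof (intro ballI allI impI)
    fix X :: "nat \<Rightarrow> nat \<Rightarrow> 'd spacetime" and x assume X: "(\<forall>i. X i \<in> UNIV) \<and> X \<longlonglongrightarrow> x"
    have "(\<lambda>i. LINT a|lborel. translate a f (map (X i) [0..<n]) * k a) \<longlonglongrightarrow>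
        (LINT a|lborel. translate a f (map x [0..<n]) * k a)"
    proof (rule integral_dominated_convergence[where w = "\<lambda>a. B * cmod (k a)"])
      show "AE a in lborel. (\<lambda>i. translate a f (map (X i) [0..<n]) * k a) \<longlonglongrightarrow> translate a f (map x [0..<n]) * k a"
      proof (intro AE_I2 tendsto_mult_right)
        fix a
        show "(\<lambda>i. translate a f (map (X i) [0..<n])) \<longlonglongrightarrow> translate a f (map x [0..<n])"
          using schwartz_continuous[OF schwartz_translate[OF f, of a]] X
          unfolding continuous_on_sequentially by (auto simp: o_def)
      qed
      show "AE a in lborel. norm (translate a f (map (X i) [0..<n]) * k a) \<le> B * cmod (k a)" for i
        using B by (simp add: norm_mult translate_def mult_right_mono)
    qed (use convolve_integrable[OF f k] rapid_L1[OF k] in auto)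
    then show "((\<lambda>x. h (map x [0..<n])) \<circ> X) \<longlonglongrightarrow> h (map x [0..<n])"
      by (simp add: h convolve_def o_def)
  qed
next
  fix h :: "'d test_seq" and i and b :: 'd assume "h \<in> (\<lambda>f. convolve f k) ` schwartz n" and i: "i < n"
  then obtain f where h: "h = convolve f k" and f: "f \<in> schwartz n" by auto
  show "\<exists>g\<in>(\<lambda>f. convolve f k) ` schwartz n. \<forall>xs. length xs = n \<longrightarrow>
        ((\<lambda>t. h (shift_coord (i, b) xs t)) has_vector_derivative g xs) (at 0)"
    unfolding h using convolve_deriv[OF f k i] schwartz_partial[OF f i] by auto
qed (use assms in \<open>auto simp: convolve_def translate_def schwartz_zero_length\<close>)

lemma partials_convolve:
  assumes f: "f \<in> schwartz n" and k: "rapid k" and \<alpha>: "\<alpha> \<in> multi_indices n"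
  shows "partials \<alpha> (convolve f k) = convolve (partials \<alpha> f) k"
  using \<alpha>
proof (induction \<alpha>)
  case (Cons ib \<alpha>)
  obtain i b where ib: "ib = (i, b)" by (cases ib)
  with Cons have i: "i < n" and \<alpha>: "\<alpha> \<in> multi_indices n" by (auto simp: multi_indices_Cons)
  let ?g = "partials \<alpha> f"
  have g: "?g \<in> schwartz n" by (rule schwartz_partials[OF f \<alpha>])
  have "partial (i, b) (convolve ?g k) = convolve (partial (i, b) ?g) k"
  proof (rule partial_eq[where n = n])
    show "((\<lambda>t. convolve ?g k (shift_coord (i, b) xs t)) has_vector_derivative convolve (partial (i, b) ?g) k xs) (at 0)"
      if "length xs = n" for xs
      by (rule convolve_deriv[OF g k i that])
  qed (simp_all add: schwartz_zero_length[OF schwartz_convolve[OF g k]]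
      schwartz_zero_length[OF schwartz_convolve[OF schwartz_partial[OF g i] k]])
  with Cons \<alpha> show ?case by (simp add: ib partials_Cons)
qed simp

subsection \<open>Tempered functionals\<close>

text \<open>Linear and bounded by one Schwartz seminorm. Quantifying over a common bound B avoids
  suprema, so the estimate can be used without first showing that a supremum is finite.\<close>

definition tempered :: "nat \<Rightarrow> ('d::finite test_seq \<Rightarrow> complex) \<Rightarrow> bool" where
  "tempered n T \<longleftrightarrow>
     (\<forall>f\<in>schwartz n. \<forall>g\<in>schwartz n. \<forall>c d. T (\<lambda>xs. c * f xs + d * g xs) = c * T f + d * T g) \<and>
     (\<exists>C\<ge>0. \<exists>N l. \<forall>g\<in>schwartz n. \<forall>B.
        (\<forall>\<alpha>\<in>multi_indices n. length \<alpha> \<le> l \<longrightarrow>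
           (\<forall>xs. length xs = n \<longrightarrow> (1 + list_norm xs) ^ N * cmod (partials \<alpha> g xs) \<le> B)) \<longrightarrow>
        cmod (T g) \<le> C * B)"

lemma tempered_linear:
  "tempered n T \<Longrightarrow> f \<in> schwartz n \<Longrightarrow> g \<in> schwartz n \<Longrightarrow>
     T (\<lambda>xs. c * f xs + d * g xs) = c * T f + d * T g"
  by (simp add: tempered_def)

lemma tempered_bound:
  assumes "tempered n (T :: 'd::finite test_seq \<Rightarrow> complex)"
  obtains C N l where "C \<ge> 0" "\<And>g B. g \<in> schwartz n \<Longrightarrow>
    (\<And>\<alpha> xs. \<alpha> \<in> multi_indices n \<Longrightarrow> length \<alpha> \<le> l \<Longrightarrow> length xs = n \<Longrightarrow>
      (1 + list_norm xs) ^ N * cmod (partials \<alpha> g xs) \<le> B) \<Longrightarrow> cmod (T g) \<le> C * B"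
proof -
  from assms obtain C N l where C: "C \<ge> 0" and b: "\<forall>g\<in>schwartz n. \<forall>B.
        (\<forall>\<alpha>\<in>multi_indices n. length \<alpha> \<le> l \<longrightarrow>
           (\<forall>xs. length xs = n \<longrightarrow> (1 + list_norm xs) ^ N * cmod (partials \<alpha> g xs) \<le> B)) \<longrightarrow>
        cmod (T g) \<le> C * B"
    unfolding tempered_def by blast
  show ?thesis by (rule that[OF C, of l N]) (use b in blast)
qed

lemma finite_multi_indices: "finite {\<alpha> \<in> multi_indices n. length \<alpha> \<le> l}"
proof -
  have "finite {\<alpha>. set \<alpha> \<subseteq> {..<n} \<times> (UNIV :: 'a::finite set) \<and> length \<alpha> \<le> l}"
    by (rule finite_lists_length_le) auto
  then show ?thesis by (simp add: multi_indices_def)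
qed

lemma finite_uniform_bound:
  fixes P :: "'a \<Rightarrow> real \<Rightarrow> bool"
  assumes "finite A" "\<And>x. x \<in> A \<Longrightarrow> \<exists>B. P x B" "\<And>x B B'. P x B \<Longrightarrow> B \<le> B' \<Longrightarrow> P x B'"
  obtains B where "B \<ge> 0" "\<And>x. x \<in> A \<Longrightarrow> P x B"
proof -
  from assms(2) obtain B where B: "\<And>x. x \<in> A \<Longrightarrow> P x (B x)" by metis
  show ?thesis
  proof (rule that[of "\<Sum>x\<in>A. \<bar>B x\<bar>"])
    show "P x (\<Sum>x\<in>A. \<bar>B x\<bar>)" if "x \<in> A" for x
      by (rule assms(3)[OF B[OF that]])
         (use member_le_sum[OF that, of "\<lambda>x. \<bar>B x\<bar>"] assms(1) abs_ge_self[of "B x"] in auto)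
  qed (simp add: sum_nonneg)
qed

lemma schwartz_uniform_decay:
  assumes f: "(f :: 'd::finite test_seq) \<in> schwartz n"
  obtains B where "B \<ge> 0" "\<And>\<alpha> xs. \<alpha> \<in> multi_indices n \<Longrightarrow> length \<alpha> \<le> l \<Longrightarrow>
    (1 + list_norm xs) ^ N * cmod (partials \<alpha> f xs) \<le> B"
proof (rule finite_uniform_bound[OF finite_multi_indices[of n l], where
      P = "\<lambda>\<alpha> B. \<forall>xs. (1 + list_norm xs) ^ N * cmod (partials \<alpha> f xs) \<le> B"])
  show "\<exists>B. \<forall>xs. (1 + list_norm xs) ^ N * cmod (partials \<alpha> f xs) \<le> B"
    if "\<alpha> \<in> {\<alpha> \<in> multi_indices n. length \<alpha> \<le> l}" for \<alpha>
    using that schwartz_decay[OF schwartz_partials[OF f], of \<alpha> N] by blast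
  show "\<forall>xs. (1 + list_norm xs) ^ N * cmod (partials \<alpha> f xs) \<le> B'"
    if "\<forall>xs. (1 + list_norm xs) ^ N * cmod (partials \<alpha> f xs) \<le> B" "B \<le> B'" for \<alpha> B B'
    using that order_trans by blast
qed (use that in blast)

lemma schwartz_uniform_lipschitz:
  assumes f: "(f :: 'd::finite test_seq) \<in> schwartz n"
  obtains K where "K \<ge> 0" "\<And>\<alpha> c xs. \<alpha> \<in> multi_indices n \<Longrightarrow> length \<alpha> \<le> l \<Longrightarrow> norm c \<le> 1 \<Longrightarrow>
    (1 + list_norm xs) ^ N * cmod (translate c (partials \<alpha> f) xs - partials \<alpha> f xs) \<le> K * norm c"
proof (rule finite_uniform_bound[OF finite_multi_indices[of n l], where
      P = "\<lambda>\<alpha> K. \<forall>c xs. norm c \<le> 1 \<longrightarrow>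
        (1 + list_norm xs) ^ N * cmod (translate c (partials \<alpha> f) xs - partials \<alpha> f xs) \<le> K * norm c"])
  show "\<exists>K. \<forall>c xs. norm c \<le> 1 \<longrightarrow>
      (1 + list_norm xs) ^ N * cmod (translate c (partials \<alpha> f) xs - partials \<alpha> f xs) \<le> K * norm c"
    if "\<alpha> \<in> {\<alpha> \<in> multi_indices n. length \<alpha> \<le> l}" for \<alpha>
    using that translate_lipschitz[OF schwartz_partials[OF f], of \<alpha> N] by blast
  show "\<forall>c xs. norm c \<le> 1 \<longrightarrow>
      (1 + list_norm xs) ^ N * cmod (translate c (partials \<alpha> f) xs - partials \<alpha> f xs) \<le> K' * norm c"
    if K: "\<forall>c xs. norm c \<le> 1 \<longrightarrow>
      (1 + list_norm xs) ^ N * cmod (translate c (partials \<alpha> f) xs - partials \<alpha> f xs) \<le> K * norm c" "K \<le> K'" for \<alpha> K K'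
  proof (intro allI impI)
    fix c :: "'d spacetime" and xs assume "norm c \<le> 1"
    with K(1) have "(1 + list_norm xs) ^ N * cmod (translate c (partials \<alpha> f) xs - partials \<alpha> f xs) \<le> K * norm c" by blast
    also have "\<dots> \<le> K' * norm c" using K(2) by (intro mult_right_mono) auto
    finally show "(1 + list_norm xs) ^ N * cmod (translate c (partials \<alpha> f) xs - partials \<alpha> f xs) \<le> K' * norm c" .
  qed
qed (use that in blast)

text \<open>The two sides of the last identity agree up to \<open>O(\<epsilon>)\<close> for \<open>k\<close> supported in a ball of radius \<open>\<epsilon>\<close>,
  hence also for \<open>k\<close> supported in a finite union of such balls.\<close>

lemma tempered_convolve:
  fixes T :: "'d::finite test_seq \<Rightarrow> complex"
  assumes T: "tempered n T" and f: "f \<in> schwartz n"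
  shows tempered_translate_continuous: "continuous_on UNIV (\<lambda>a. T (translate a f))"
    and tempered_translate_bound: "\<exists>K\<ge>0. \<exists>N. \<forall>a. cmod (T (translate a f)) \<le> K * (1 + norm a) ^ N"
    and tempered_convolve_eq: "\<And>k. rapid k \<Longrightarrow> T (convolve f k) = (LINT a|lborel. T (translate a f) * k a)"
proof -
  obtain C N l where C: "C \<ge> 0" and bd: "\<And>g B. g \<in> schwartz n \<Longrightarrow>
    (\<And>\<alpha> xs. \<alpha> \<in> multi_indices n \<Longrightarrow> length \<alpha> \<le> l \<Longrightarrow> length xs = n \<Longrightarrow>
      (1 + list_norm xs) ^ N * cmod (partials \<alpha> g xs) \<le> B) \<Longrightarrow> cmod (T g) \<le> C * B"
    by (rule tempered_bound[OF T]) blast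
  obtain B where B: "B \<ge> 0" "\<And>\<alpha> xs. \<alpha> \<in> multi_indices n \<Longrightarrow> length \<alpha> \<le> l \<Longrightarrow>
      (1 + list_norm xs) ^ N * cmod (partials \<alpha> f xs) \<le> B"
    by (rule schwartz_uniform_decay[OF f, where N = N and l = l]) blast
  obtain K where K: "K \<ge> 0" "\<And>\<alpha> c xs. \<alpha> \<in> multi_indices n \<Longrightarrow> length \<alpha> \<le> l \<Longrightarrow> norm c \<le> 1 \<Longrightarrow>
      (1 + list_norm xs) ^ N * cmod (translate c (partials \<alpha> f) xs - partials \<alpha> f xs) \<le> K * norm c"
    by (rule schwartz_uniform_lipschitz[OF f, where N = N and l = l]) blast
  define F where "F a = T (translate a f)" for a
  define M where "M = (1 + real n) ^ N"
  have M: "M \<ge> 0" by (simp add: M_def)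
  have F_bound: "cmod (F a) \<le> C * (M * B) * (1 + norm a) ^ N" for a
  proof -
    have "cmod (F a) \<le> C * (((1 + real n) * (1 + norm a)) ^ N * B)"
      unfolding F_def
    proof (rule bd[OF schwartz_translate[OF f]])
      fix \<alpha> :: "(nat \<times> 'd) list" and xs :: "'d spacetime list" assume \<alpha>: "\<alpha> \<in> multi_indices n" "length \<alpha> \<le> l" and len: "length xs = n"
      show "(1 + list_norm xs) ^ N * cmod (partials \<alpha> (translate a f) xs) \<le> ((1 + real n) * (1 + norm a)) ^ N * B"
        unfolding partials_translate[OF f \<alpha>(1)] using B(2)[OF \<alpha>] len by (rule translate_weight)
    qed
    then show ?thesis by (simp add: M_def power_mult_distrib mult_ac)
  qed
  \<comment> \<open>The Lipschitz bound at translation 0 is carried to translation x by translating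
    the list, at the price of a factor polynomial in x.\<close>
  have close: "(1 + list_norm xs) ^ N * cmod (translate a (partials \<alpha> f) xs - translate x (partials \<alpha> f) xs)
      \<le> M * (1 + norm x) ^ N * (K * norm (a - x))"
    if "\<alpha> \<in> multi_indices n" "length \<alpha> \<le> l" "norm (a - x) \<le> 1" "length xs = n" for a x \<alpha> xs
  proof -
    define ys where "ys = map (\<lambda>z. z - x) xs"
    have "translate a (partials \<alpha> f) xs - translate x (partials \<alpha> f) xs =
        translate (a - x) (partials \<alpha> f) ys - partials \<alpha> f ys"
      by (simp add: translate_def ys_def o_def)
    moreover have "(1 + list_norm xs) ^ N * cmod (translate (a - x) (partials \<alpha> f) ys - partials \<alpha> f ys)
        \<le> ((1 + real n) * (1 + norm x)) ^ N * (K * norm (a - x))"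
      using that by (intro weight_near[where n = n and ys = ys] K) (auto simp: ys_def)
    ultimately show ?thesis by (simp add: M_def power_mult_distrib)
  qed
  define L where "L = C * M * K"
  have L: "L \<ge> 0" using C M K by (simp add: L_def)
  have F_lip: "cmod (F a - F x) \<le> L * (1 + norm x) ^ N * norm (a - x)" if "norm (a - x) \<le> 1" for a x
  proof -
    let ?g = "\<lambda>xs. 1 * translate a f xs + (-1) * translate x f xs"
    have "F a - F x = T ?g"
      using tempered_linear[OF T schwartz_translate[OF f] schwartz_translate[OF f], of 1 a "-1" x] by (simp add: F_def)
    also have "cmod \<dots> \<le> C * (M * (1 + norm x) ^ N * (K * norm (a - x)))"
    proof (rule bd[OF schwartz_linear_combination[OF schwartz_translate[OF f] schwartz_translate[OF f]]])
      fix \<alpha> :: "(nat \<times> 'd) list" and xs :: "'d spacetime list" assume \<alpha>: "\<alpha> \<in> multi_indices n" "length \<alpha> \<le> l" and len: "length xs = n"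
      show "(1 + list_norm xs) ^ N * cmod (partials \<alpha> ?g xs) \<le> M * (1 + norm x) ^ N * (K * norm (a - x))"
        unfolding partials_linear_combination[OF schwartz_translate[OF f] schwartz_translate[OF f] \<alpha>(1)]
          partials_translate[OF f \<alpha>(1)]
        using close[OF \<alpha> that len] by simp
    qed
    finally show ?thesis by (simp add: L_def mult_ac)
  qed
  have cont: "continuous_on UNIV F"
    unfolding continuous_on_iff
  proof (intro ballI allI impI)
    fix x :: "'d spacetime" and e :: real assume e: "e > 0"
    define Q where "Q = L * (1 + norm x) ^ N"
    have Q: "Q \<ge> 0" using L by (simp add: Q_def)
    show "\<exists>d>0. \<forall>x'\<in>UNIV. dist x' x < d \<longrightarrow> dist (F x') (F x) < e"
    proof (intro exI[of _ "min 1 (e / (Q + 1))"] conjI ballI impI)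
      fix a assume "dist a x < min 1 (e / (Q + 1))"
      then have d: "norm (a - x) \<le> 1" "norm (a - x) < e / (Q + 1)" by (auto simp: dist_norm)
      have "dist (F a) (F x) \<le> Q * norm (a - x)" using F_lip[OF d(1)] by (simp add: dist_norm Q_def)
      also have "\<dots> \<le> (Q + 1) * norm (a - x)" by (intro mult_right_mono) auto
      also have "\<dots> < e" using d(2) Q by (simp add: field_simps)
      finally show "dist (F a) (F x) < e" .
    qed (use e Q in auto)
  qed
  then show "continuous_on UNIV (\<lambda>a. T (translate a f))" by (simp add: F_def)
  show "\<exists>K\<ge>0. \<exists>N. \<forall>a. cmod (T (translate a f)) \<le> K * (1 + norm a) ^ N"
    using F_bound C M B(1) unfolding F_def by (intro exI[of _ "C * (M * B)"]) auto
  have Fm: "F \<in> borel_measurable borel" by (rule borel_measurable_continuous_onI[OF cont])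
  note Fint = rapid_integrable_poly_bounded[OF _ Fm F_bound]
  \<comment> \<open>The defect of the claimed identity. It is additive in k, so k may be decomposed
    by indicators and the pieces estimated one by one.\<close>
  define D where "D k = T (convolve f k) - (LINT a|lborel. F a * k a)" for k
  have D_add: "D (\<lambda>a. k a + k' a) = D k + D k'" if k: "rapid k" and k': "rapid k'" for k k'
  proof -
    have "convolve f (\<lambda>a. k a + k' a) = (\<lambda>xs. 1 * convolve f k xs + 1 * convolve f k' xs)"
      using convolve_integrable[OF f k] convolve_integrable[OF f k']
      by (simp add: convolve_def distrib_left)
    then have "T (convolve f (\<lambda>a. k a + k' a)) = T (convolve f k) + T (convolve f k')"
      using tempered_linear[OF T schwartz_convolve[OF f k] schwartz_convolve[OF f k'], of 1 1] by simp
    then show ?thesis using Fint[OF k] Fint[OF k'] by (simp add: D_def distrib_left)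
  qed
  have D_bound: "cmod (D k) \<le> 2 * (C * (M * B)) * (LINT a|lborel. (1 + norm a) ^ N * cmod (k a))" if k: "rapid k" for k
  proof -
    have "cmod (T (convolve f k)) \<le> C * ((1 + real n) ^ N * B * (LINT a|lborel. (1 + norm a) ^ N * cmod (k a)))"
    proof (rule bd[OF schwartz_convolve[OF f k]])
      fix \<alpha> :: "(nat \<times> 'd) list" and xs :: "'d spacetime list" assume \<alpha>: "\<alpha> \<in> multi_indices n" "length \<alpha> \<le> l" and len: "length xs = n"
      show "(1 + list_norm xs) ^ N * cmod (partials \<alpha> (convolve f k) xs) \<le>
          (1 + real n) ^ N * B * (LINT a|lborel. (1 + norm a) ^ N * cmod (k a))"
        unfolding partials_convolve[OF f k \<alpha>(1)]
        by (rule convolve_weight[OF schwartz_partials[OF f \<alpha>(1)] k B(2)[OF \<alpha>] len])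
    qed
    moreover have "cmod (LINT a|lborel. F a * k a) \<le> (LINT a|lborel. C * (M * B) * ((1 + norm a) ^ N * cmod (k a)))"
    proof (rule order_trans[OF integral_norm_bound integral_mono])
      show "integrable lborel (\<lambda>a. norm (F a * k a))" using Fint[OF k] by simp
      show "integrable lborel (\<lambda>a. C * (M * B) * ((1 + norm a) ^ N * cmod (k a)))"
        using rapid_integrable[OF k] by simp
      show "norm (F a * k a) \<le> C * (M * B) * ((1 + norm a) ^ N * cmod (k a))" for a
        using mult_right_mono[OF F_bound[of a], of "cmod (k a)"] by (simp add: norm_mult mult_ac)
    qed
    ultimately show ?thesis
      unfolding D_def M_def[symmetric]
      using norm_triangle_ineq4[of "T (convolve f k)" "LINT a|lborel. F a * k a"] by (simp add: mult_ac)
  qed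
  \<comment> \<open>Both terms of the defect are compared with \<open>J * F x\<close>, where J is
    the integral of k: the first by smearing differences of translates, the second by the Lipschitz
    bound on F.\<close>
  have D_ball: "cmod (D k) \<le> 2 * (L * (1 + norm x) ^ N * \<epsilon>) * (LINT a|lborel. cmod (k a))"
    if k: "rapid k" and \<epsilon>: "0 < \<epsilon>" "\<epsilon> \<le> 1" and supp: "\<And>a. a \<notin> ball x \<epsilon> \<Longrightarrow> k a = 0" for k x \<epsilon>
  proof -
    define J where "J = (LINT a|lborel. k a)"
    let ?g = "\<lambda>xs. 1 * convolve f k xs + (- J) * translate x f xs"
    have eq1: "T ?g = T (convolve f k) - J * F x"
      using tempered_linear[OF T schwartz_convolve[OF f k] schwartz_translate[OF f], of 1 "- J" x] by (simp add: F_def)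
    have n1: "cmod (T ?g) \<le> C * (M * (1 + norm x) ^ N * (K * \<epsilon>) * (LINT a|lborel. cmod (k a)))"
    proof (rule bd[OF schwartz_linear_combination[OF schwartz_convolve[OF f k] schwartz_translate[OF f]]])
      fix \<alpha> :: "(nat \<times> 'd) list" and xs :: "'d spacetime list" assume \<alpha>: "\<alpha> \<in> multi_indices n" "length \<alpha> \<le> l" and len: "length xs = n"
      let ?G = "partials \<alpha> f" and ?w = "(1 + list_norm xs) ^ N"
      note G = schwartz_partials[OF f \<alpha>(1)]
      have int: "integrable lborel (\<lambda>a. translate a ?G xs * k a - translate x ?G xs * k a)"
        using convolve_integrable[OF G k] rapid_L1[OF k] by simp
      have "partials \<alpha> ?g xs = convolve ?G k xs - J * translate x ?G xs"
        unfolding partials_linear_combination[OF schwartz_convolve[OF f k] schwartz_translate[OF f] \<alpha>(1)]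
          partials_translate[OF f \<alpha>(1)] partials_convolve[OF f k \<alpha>(1)] by simp
      also have "\<dots> = (LINT a|lborel. translate a ?G xs * k a - translate x ?G xs * k a)"
        using convolve_integrable[OF G k] rapid_L1[OF k] by (simp add: convolve_def J_def mult.commute)
      also have "?w * cmod \<dots> \<le> ?w * (LINT a|lborel. norm (translate a ?G xs * k a - translate x ?G xs * k a))"
        by (intro mult_left_mono integral_norm_bound) auto
      also have "\<dots> = (LINT a|lborel. ?w * norm (translate a ?G xs * k a - translate x ?G xs * k a))" by simp
      also have "\<dots> \<le> (LINT a|lborel. M * (1 + norm x) ^ N * (K * \<epsilon>) * cmod (k a))"
      proof (rule integral_mono)
        fix a
        show "?w * norm (translate a ?G xs * k a - translate x ?G xs * k a) \<le> M * (1 + norm x) ^ N * (K * \<epsilon>) * cmod (k a)"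
        proof (cases "a \<in> ball x \<epsilon>")
          case True
          then have a: "norm (a - x) \<le> 1" "norm (a - x) \<le> \<epsilon>" using \<epsilon> by (auto simp: dist_norm norm_minus_commute)
          have "?w * cmod (translate a ?G xs - translate x ?G xs) \<le> M * (1 + norm x) ^ N * (K * norm (a - x))"
            by (rule close[OF \<alpha> a(1) len])
          also have "\<dots> \<le> M * (1 + norm x) ^ N * (K * \<epsilon>)"
            using M K a by (intro mult_left_mono) auto
          finally have "?w * cmod (translate a ?G xs - translate x ?G xs) * cmod (k a) \<le> M * (1 + norm x) ^ N * (K * \<epsilon>) * cmod (k a)"
            by (rule mult_right_mono) simp
          then show ?thesis unfolding left_diff_distrib[symmetric] norm_mult by (simp only: mult_ac)
        next
          case False
          then show ?thesis by (simp add: supp)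
        qed
      qed (use int rapid_L1[OF k] in auto)
      finally show "?w * cmod (partials \<alpha> ?g xs) \<le> M * (1 + norm x) ^ N * (K * \<epsilon>) * (LINT a|lborel. cmod (k a))"
        by simp
    qed
    have "J * F x - (LINT a|lborel. F a * k a) = (LINT a|lborel. F x * k a - F a * k a)"
      using Fint[OF k] rapid_L1[OF k] by (simp add: J_def mult.commute)
    also have "cmod \<dots> \<le> (LINT a|lborel. L * (1 + norm x) ^ N * \<epsilon> * cmod (k a))"
    proof (rule order_trans[OF integral_norm_bound integral_mono])
      fix a
      show "norm (F x * k a - F a * k a) \<le> L * (1 + norm x) ^ N * \<epsilon> * cmod (k a)"
      proof (cases "a \<in> ball x \<epsilon>")
        case True
        then have a: "norm (a - x) \<le> 1" "norm (a - x) \<le> \<epsilon>" using \<epsilon> by (auto simp: dist_norm norm_minus_commute)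
        have "cmod (F x - F a) \<le> L * (1 + norm x) ^ N * norm (a - x)"
          using F_lip[OF a(1)] by (simp add: norm_minus_commute)
        also have "\<dots> \<le> L * (1 + norm x) ^ N * \<epsilon>" using L a by (intro mult_left_mono) auto
        finally show ?thesis
          by (simp add: left_diff_distrib[symmetric] norm_mult mult_right_mono)
      next
        case False
        then show ?thesis by (simp add: supp)
      qed
    qed (use Fint[OF k] rapid_L1[OF k] in auto)
    finally have n2: "cmod (J * F x - (LINT a|lborel. F a * k a)) \<le> L * (1 + norm x) ^ N * \<epsilon> * (LINT a|lborel. cmod (k a))"
      by simp
    have "D k = T ?g + (J * F x - (LINT a|lborel. F a * k a))" unfolding D_def eq1 by simp
    then show ?thesis
      using n1 n2 norm_triangle_ineq[of "T ?g" "J * F x - (LINT a|lborel. F a * k a)"]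
      by (simp add: L_def mult_ac)
  qed
  have split: "D k = D (\<lambda>a. indicator A a * k a) + D (\<lambda>a. indicator (- A) a * k a)"
    if "rapid k" "A \<in> sets borel" for k A
  proof -
    have "k = (\<lambda>a. indicator A a * k a + indicator (- A) a * k a)"
      by (auto simp: indicator_def)
    then show ?thesis
      using D_add[OF rapid_indicator[OF that] rapid_indicator[OF that(1), of "- A"]] that by simp
  qed
  \<comment> \<open>Peeling off one ball at a time leaves disjoint pieces whose L1 norms add up, so
    the bound does not depend on the number of balls.\<close>
  have D_balls: "cmod (D k) \<le> 2 * (L * (1 + R) ^ N * \<epsilon>) * (LINT a|lborel. cmod (k a))"
    if "finite X" "rapid k" "0 < \<epsilon>" "\<epsilon> \<le> 1" "X \<subseteq> cball 0 R" "\<And>a. a \<notin> (\<Union>x\<in>X. ball x \<epsilon>) \<Longrightarrow> k a = 0"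
    for X k \<epsilon> R
    using that
  proof (induction X arbitrary: k rule: finite_induct)
    case empty
    then have "k = (\<lambda>_. 0)" by auto
    then show ?case
      using D_bound[OF empty(1)] by simp
  next
    case (insert x X)
    let ?k1 = "\<lambda>a. indicator (ball x \<epsilon>) a * k a" and ?k2 = "\<lambda>a. indicator (- ball x \<epsilon>) a * k a"
    have k: "rapid ?k1" "rapid ?k2" using rapid_indicator[OF insert.prems(1)] by auto
    have "cmod (D ?k1) \<le> 2 * (L * (1 + norm x) ^ N * \<epsilon>) * (LINT a|lborel. cmod (?k1 a))"
      using k insert.prems by (intro D_ball) auto
    also have "\<dots> \<le> 2 * (L * (1 + R) ^ N * \<epsilon>) * (LINT a|lborel. cmod (?k1 a))"
      using insert.prems L by (intro mult_right_mono mult_left_mono power_mono integral_nonneg_AE) auto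
    finally have 1: "cmod (D ?k1) \<le> 2 * (L * (1 + R) ^ N * \<epsilon>) * (LINT a|lborel. cmod (?k1 a))" .
    have 2: "cmod (D ?k2) \<le> 2 * (L * (1 + R) ^ N * \<epsilon>) * (LINT a|lborel. cmod (?k2 a))"
      using insert.prems k by (intro insert.IH) (auto simp: indicator_def)
    have "(LINT a|lborel. cmod (k a)) = (LINT a|lborel. cmod (?k1 a) + cmod (?k2 a))"
      by (intro Bochner_Integration.integral_cong) (auto simp: indicator_def)
    also have "\<dots> = (LINT a|lborel. cmod (?k1 a)) + (LINT a|lborel. cmod (?k2 a))"
      using rapid_L1[OF k(1)] rapid_L1[OF k(2)] by simp
    finally have I: "(LINT a|lborel. cmod (k a)) = (LINT a|lborel. cmod (?k1 a)) + (LINT a|lborel. cmod (?k2 a))" .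
    have "cmod (D k) \<le> cmod (D ?k1) + cmod (D ?k2)"
      using split[OF insert.prems(1), of "ball x \<epsilon>"] norm_triangle_ineq by simp
    with 1 2 show ?case unfolding I distrib_left by linarith
  qed
  show "T (convolve f k) = (LINT a|lborel. T (translate a f) * k a)" if k: "rapid k" for k
  proof -
    have compact0: "D (\<lambda>a. indicator (cball 0 R) a * k a) = 0" if R: "R \<ge> 0" for R
    proof -
      let ?k = "\<lambda>a. indicator (cball 0 R) a * k a"
      have rk: "rapid ?k" by (rule rapid_indicator[OF k]) auto
      \<comment> \<open>Q is independent of \<epsilon>, hence finite covers by ever smaller balls
        force the defect to vanish.\<close>
      define Q where "Q = 2 * (L * (1 + R) ^ N) * (LINT a|lborel. cmod (?k a))"
      have le: "cmod (D ?k) \<le> Q * \<epsilon>" if \<epsilon>: "0 < \<epsilon>" "\<epsilon> \<le> 1" for \<epsilon>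
      proof -
        have cover: "cball 0 R \<subseteq> (\<Union>x\<in>cball (0::'d spacetime) R. ball x \<epsilon>)" using \<epsilon> by auto
        obtain X :: "'d spacetime set" where X: "X \<subseteq> cball 0 R" "finite X" "cball 0 R \<subseteq> (\<Union>x\<in>X. ball x \<epsilon>)"
          by (rule compactE_image[OF compact_cball _ cover]) auto
        have "cmod (D ?k) \<le> 2 * (L * (1 + R) ^ N * \<epsilon>) * (LINT a|lborel. cmod (?k a))"
          using X by (intro D_balls[OF X(2) rk \<epsilon> X(1)]) (auto simp: indicator_def)
        then show ?thesis by (simp add: Q_def mult_ac)
      qed
      have "cmod (D ?k) \<le> 0"
      proof (rule tendsto_lowerbound)
        show "((\<lambda>\<epsilon>. Q * \<epsilon>) \<longlongrightarrow> 0) (at_right 0)" by (auto intro!: tendsto_eq_intros)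
        show "\<forall>\<^sub>F \<epsilon> in at_right 0. cmod (D ?k) \<le> Q * \<epsilon>"
          using le eventually_at_right[of 0 "1::real"] by (auto intro!: exI[of _ 1])
      qed simp
      then show ?thesis by simp
    qed
    \<comment> \<open>Outside a large ball only the crude bound \<open>D_bound\<close> is available;
      it tends to 0 because k decays rapidly.\<close>
    have lim: "(\<lambda>i. LINT a|lborel. (1 + norm a) ^ N * cmod (indicator (- cball 0 (real i)) a * k a)) \<longlonglongrightarrow>
        (LINT a|(lborel :: 'd spacetime measure). (0::real))"
    proof (rule integral_dominated_convergence[where w = "\<lambda>a. (1 + norm a) ^ N * cmod (k a)"])
      show "(\<lambda>a. (1 + norm a) ^ N * cmod (indicator (- cball 0 (real i)) a * k a)) \<in> borel_measurable lborel" for i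
        using rapid_measurable[OF k] by measurable
      show "AE a in lborel. (\<lambda>i. (1 + norm a) ^ N * cmod (indicator (- cball 0 (real i)) a * k a)) \<longlonglongrightarrow> 0"
      proof (intro AE_I2 tendsto_eventually)
        fix a :: "'d spacetime"
        obtain j where "norm a \<le> real j" using real_arch_simple by blast
        then show "\<forall>\<^sub>F i in sequentially. (1 + norm a) ^ N * cmod (indicator (- cball 0 (real i)) a * k a) = 0"
          by (intro eventually_sequentiallyI[of j]) (auto simp: indicator_def)
      qed
    qed (use rapid_integrable[OF k] in \<open>auto simp: indicator_def\<close>)
    have "(\<lambda>i. 2 * (C * (M * B)) * (LINT a|lborel. (1 + norm a) ^ N * cmod (indicator (- cball 0 (real i)) a * k a))) \<longlonglongrightarrow> 0"
      using tendsto_mult_left[OF lim, of "2 * (C * (M * B))"] by simp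
    moreover have "cmod (D k) \<le> 2 * (C * (M * B)) * (LINT a|lborel. (1 + norm a) ^ N * cmod (indicator (- cball 0 (real i)) a * k a))" for i
      using split[OF k, of "cball 0 (real i)"] compact0[of "real i"]
        D_bound[OF rapid_indicator[OF k, of "- cball 0 (real i)"]] by simp
    ultimately have "cmod (D k) \<le> 0" by (intro LIMSEQ_le_const) auto
    then show ?thesis by (simp add: D_def F_def)
  qed
qed

section \<open>Band-limited Schwartz functions of one variable\<close>

text \<open>Continuous differentiability of order n, with derivatives asserted to exist rather than
  computed. Closure under products, inverses and affine substitutions then follows by induction on n
  without formulas for higher derivatives.\<close>

primrec C_n :: "nat \<Rightarrow> (real \<Rightarrow> real) \<Rightarrow> bool" where
  "C_n 0 f \<longleftrightarrow> continuous_on UNIV f"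
| "C_n (Suc n) f \<longleftrightarrow> (\<exists>f'. (\<forall>x. (f has_real_derivative f' x) (at x)) \<and> C_n n f')"

lemma C_n_SucI: "(\<And>x. (f has_real_derivative f' x) (at x)) \<Longrightarrow> C_n n f' \<Longrightarrow> C_n (Suc n) f"
  by auto

lemma C_n_Suc_imp: "C_n (Suc n) f \<Longrightarrow> C_n n f"
proof (induction n arbitrary: f)
  case 0
  then obtain f' where "\<forall>x. (f has_real_derivative f' x) (at x)" by auto
  then show ?case by (auto intro!: continuous_at_imp_continuous_on DERIV_isCont)
next
  case (Suc n)
  then obtain f' where "\<forall>x. (f has_real_derivative f' x) (at x)" "C_n (Suc n) f'" by auto
  with Suc.IH[of f'] show ?case by auto
qed

lemma C_n_const: "C_n n (\<lambda>x. c)"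
  by (induction n arbitrary: c) (auto intro!: exI[of _ "\<lambda>x. 0"])

lemma C_n_add: "C_n n f \<Longrightarrow> C_n n g \<Longrightarrow> C_n n (\<lambda>x. f x + g x)"
proof (induction n arbitrary: f g)
  case 0
  then show ?case by (auto intro!: continuous_intros)
next
  case (Suc n)
  then obtain f' g' where fg: "\<And>x. (f has_real_derivative f' x) (at x)" "\<And>x. (g has_real_derivative g' x) (at x)"
    "C_n n f'" "C_n n g'" by auto
  then show ?case using Suc.IH[OF fg(3,4)]
    by (auto intro!: exI[of _ "\<lambda>x. f' x + g' x"] derivative_intros)
qed

lemma C_n_mult: "C_n n f \<Longrightarrow> C_n n g \<Longrightarrow> C_n n (\<lambda>x. f x * g x)"
proof (induction n arbitrary: f g)
  case 0
  then show ?case by (auto intro!: continuous_intros)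
next
  case (Suc n)
  then obtain f' g' where fg: "\<And>x. (f has_real_derivative f' x) (at x)" "\<And>x. (g has_real_derivative g' x) (at x)"
    "C_n n f'" "C_n n g'" by auto
  have "C_n n (\<lambda>x. f' x * g x + f x * g' x)"
    using Suc fg C_n_Suc_imp by (intro C_n_add Suc.IH) auto
  moreover have "((\<lambda>x. f x * g x) has_real_derivative f' x * g x + f x * g' x) (at x)" for x
    using DERIV_mult[OF fg(1,2), of x] by (simp add: mult.commute)
  ultimately show ?case by (rule C_n_SucI[rotated])
qed

lemma C_n_ident: "C_n n (\<lambda>x. x)"
  by (cases n) (auto intro!: exI[of _ "\<lambda>x. 1"] C_n_const)

lemma C_n_affine: "C_n n f \<Longrightarrow> C_n n (\<lambda>x. f (a * x + b))"
proof (induction n arbitrary: f)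
  case 0
  then show ?case by (auto intro!: continuous_intros continuous_on_compose2[of UNIV f])
next
  case (Suc n)
  then obtain f' where f: "\<And>x. (f has_real_derivative f' x) (at x)" "C_n n f'" by auto
  have "((\<lambda>x. f (a * x + b)) has_real_derivative f' (a * x + b) * a) (at x)" for x
    by (rule DERIV_chain'[where g = f, OF _ f(1)]) (auto intro!: derivative_eq_intros)
  then show ?case using C_n_mult[OF Suc.IH[OF f(2)] C_n_const[of n a]] by (rule C_n_SucI)
qed

lemma C_n_inverse:
  assumes "\<And>x. f x \<noteq> 0"
  shows "C_n n f \<Longrightarrow> C_n n (\<lambda>x. inverse (f x))"
proof (induction n)
  case 0
  then show ?case using assms by (auto intro!: continuous_intros)
next
  case (Suc n)
  then obtain f' where f: "\<And>x. (f has_real_derivative f' x) (at x)" "C_n n f'" by auto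
  have "((\<lambda>x. inverse (f x)) has_real_derivative - 1 * (f' x * (inverse (f x) * inverse (f x)))) (at x)" for x
    using DERIV_inverse'[OF f(1) assms, of x] by (simp add: mult_ac)
  moreover have "C_n n (\<lambda>x. - 1 * (f' x * (inverse (f x) * inverse (f x))))"
    using Suc C_n_Suc_imp[OF Suc.prems] by (intro C_n_mult C_n_const f) auto
  ultimately show ?case by (rule C_n_SucI)
qed

text \<open>The flat function exp (-1/x) times polynomials in 1/x, a family that is closed under
  differentiation.\<close>

definition flat_fun :: "real poly \<Rightarrow> real \<Rightarrow> real" where
  "flat_fun p x = (if x > 0 then poly p (1 / x) * exp (- (1 / x)) else 0)"

lemma poly_div_exp_tendsto_0: "((\<lambda>y. poly p y * exp (- y)) \<longlongrightarrow> (0::real)) at_top"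
proof -
  have "((\<lambda>y. \<Sum>i\<le>degree p. coeff p i * (y ^ i / exp y)) \<longlongrightarrow> (\<Sum>i\<le>degree p. coeff p i * 0)) at_top"
    by (intro tendsto_intros tendsto_power_div_exp_0)
  then show ?thesis by (simp add: poly_altdef exp_minus divide_inverse sum_distrib_left mult_ac)
qed

text \<open>In the variable y = 1/x, differentiation replaces p by y^2 (p - p').\<close>

lemma flat_fun_deriv:
  "(flat_fun p has_real_derivative flat_fun (monom 1 2 * (p - pderiv p)) x) (at x)"
proof -
  consider "x < 0" | "x > 0" | "x = 0" by linarith
  then show ?thesis
  proof cases
    case 1
    have "((\<lambda>x. 0) has_real_derivative 0) (at x)" by simp
    then have "(flat_fun p has_real_derivative 0) (at x)"
      by (rule has_field_derivative_transform_within_open[where S = "{..<0}"]) (use 1 in \<open>auto simp: flat_fun_def\<close>)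
    then show ?thesis using 1 by (simp add: flat_fun_def)
  next
    case 2
    have "((\<lambda>x. poly p (1 / x) * exp (- (1 / x))) has_real_derivative
       poly (pderiv p) (1 / x) * (- (1 / x\<^sup>2)) * exp (- (1 / x)) + poly p (1 / x) * (exp (- (1 / x)) * (1 / x\<^sup>2))) (at x)"
      using 2 by (auto intro!: derivative_eq_intros DERIV_chain'[where g = "poly p"] poly_DERIV simp: power2_eq_square field_simps)
    then have "(flat_fun p has_real_derivative
       poly (pderiv p) (1 / x) * (- (1 / x\<^sup>2)) * exp (- (1 / x)) + poly p (1 / x) * (exp (- (1 / x)) * (1 / x\<^sup>2))) (at x)"
      by (rule has_field_derivative_transform_within_open[where S = "{0<..}"]) (use 2 in \<open>auto simp: flat_fun_def\<close>)
    then show ?thesis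
      using 2 by (simp add: flat_fun_def poly_monom algebra_simps power_divide)
  next
    case 3
    have "((\<lambda>h. flat_fun p h / h) \<longlongrightarrow> 0) (at_right 0)"
    proof (rule Lim_transform_eventually)
      \<comment> \<open>Dividing by h multiplies the polynomial by y = 1/h, which is
        \<open>pCons 0 p\<close>; the exponential still dominates.\<close>
      show "((\<lambda>h. poly (pCons 0 p) (inverse h) * exp (- (inverse h))) \<longlongrightarrow> 0) (at_right (0::real))"
        by (rule filterlim_compose[OF poly_div_exp_tendsto_0 filterlim_inverse_at_top_right])
      show "\<forall>\<^sub>F h in at_right 0. poly (pCons 0 p) (inverse h) * exp (- (inverse h)) = flat_fun p h / h"
        by (auto simp: eventually_at_filter flat_fun_def divide_inverse)
    qed
    moreover have "((\<lambda>h. flat_fun p h / h) \<longlongrightarrow> 0) (at_left 0)"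
      by (rule tendsto_eventually) (auto simp: eventually_at_filter flat_fun_def)
    ultimately have "((\<lambda>h. flat_fun p h / h) \<longlongrightarrow> 0) (at 0)" by (rule filterlim_split_at[OF _ _, rotated])
    then show ?thesis using 3 by (simp add: DERIV_def flat_fun_def)
  qed
qed

lemma C_n_flat_fun: "C_n n (flat_fun p)"
proof (induction n arbitrary: p)
  case 0
  then show ?case using flat_fun_deriv by (auto intro!: continuous_at_imp_continuous_on DERIV_isCont)
next
  case (Suc n)
  then show ?case using flat_fun_deriv by auto
qed

text \<open>A transition from 0 to 1 over the unit interval. The denominator never vanishes because
  x and 1 - x are not both nonpositive.\<close>

definition smooth_step :: "real \<Rightarrow> real" where
  "smooth_step x = flat_fun 1 x * inverse (flat_fun 1 x + flat_fun 1 (1 - x))"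

lemma C_n_smooth_step: "C_n n smooth_step"
proof -
  have "C_n n (\<lambda>x. flat_fun 1 ((-1) * x + 1))" by (rule C_n_affine[OF C_n_flat_fun])
  then have "C_n n (\<lambda>x. flat_fun 1 x + flat_fun 1 (1 - x))" by (intro C_n_add C_n_flat_fun) simp
  moreover have "flat_fun 1 x + flat_fun 1 (1 - x) \<noteq> 0" for x
  proof -
    have "flat_fun 1 y \<ge> 0" "y > 0 \<Longrightarrow> flat_fun 1 y > 0" for y by (auto simp: flat_fun_def)
    then show ?thesis by (cases "x > 0") (smt (verit))+
  qed
  ultimately have "C_n n (\<lambda>x. flat_fun 1 x * inverse (flat_fun 1 x + flat_fun 1 (1 - x)))"
    by (intro C_n_mult C_n_flat_fun C_n_inverse)
  then show ?thesis by (simp add: smooth_step_def[abs_def])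
qed

lemma smooth_step_0: "x \<le> 0 \<Longrightarrow> smooth_step x = 0"
  and smooth_step_1: "x \<ge> 1 \<Longrightarrow> smooth_step x = 1"
  by (auto simp: smooth_step_def flat_fun_def)

text \<open>Equal to 1 on [-1, 1] and to 0 outside [-2, 2]; the ratio 2 of these radii reappears in
  all momentum thresholds below.\<close>

definition plateau :: "real \<Rightarrow> real" where
  "plateau x = smooth_step (x + 2) * smooth_step (2 - x)"

lemma C_n_plateau: "C_n n (\<lambda>x. plateau (a * x))"
proof -
  have "C_n n (\<lambda>x. smooth_step (a * x + 2))" "C_n n (\<lambda>x. smooth_step ((- a) * x + 2))"
    by (rule C_n_affine[OF C_n_smooth_step])+
  then have "C_n n (\<lambda>x. smooth_step (a * x + 2) * smooth_step ((- a) * x + 2))" by (rule C_n_mult)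
  then show ?thesis by (simp add: plateau_def)
qed

lemma plateau_1: "\<bar>x\<bar> \<le> 1 \<Longrightarrow> plateau x = 1"
  and plateau_0: "\<bar>x\<bar> \<ge> 2 \<Longrightarrow> plateau x = 0"
  by (auto simp: plateau_def smooth_step_1 abs_le_iff abs_if smooth_step_0 split: if_splits)

section \<open>Fourier transforms of smooth compactly supported functions\<close>

definition bump :: "real \<Rightarrow> (real \<Rightarrow> real) \<Rightarrow> bool" where
  "bump R \<psi> \<longleftrightarrow> (\<forall>n. C_n n \<psi>) \<and> (\<forall>x. \<bar>x\<bar> > R \<longrightarrow> \<psi> x = 0)"

lemma bump_deriv:
  assumes "bump R \<psi>"
  obtains \<psi>' where "\<And>x. (\<psi> has_real_derivative \<psi>' x) (at x)" "bump R \<psi>'"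
proof -
  from assms have C: "\<And>n. C_n n \<psi>" and supp: "\<And>x. \<bar>x\<bar> > R \<Longrightarrow> \<psi> x = 0" by (auto simp: bump_def)
  from C[of 1] obtain \<psi>' where d: "\<And>x. (\<psi> has_real_derivative \<psi>' x) (at x)" by auto
  have "C_n n \<psi>'" for n
  proof -
    from C[of "Suc n"] obtain g where "\<And>x. (\<psi> has_real_derivative g x) (at x)" "C_n n g" by auto
    moreover from this d have "g = \<psi>'" using DERIV_unique by blast
    ultimately show ?thesis by simp
  qed
  moreover have "\<psi>' x = 0" if "\<bar>x\<bar> > R" for x
  proof -
    have "((\<lambda>x. 0) has_real_derivative 0) (at x)" by simp
    then have "(\<psi> has_real_derivative 0) (at x)"
      by (rule has_field_derivative_transform_within_open[where S = "{x. R < \<bar>x\<bar>}"])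
         (use that supp in \<open>auto intro!: open_Collect_less continuous_intros\<close>)
    then show ?thesis using d DERIV_unique by blast
  qed
  ultimately show ?thesis using d that by (auto simp: bump_def)
qed

lemma bump_times: "bump R \<psi> \<Longrightarrow> bump R (\<lambda>x. x * \<psi> x)"
  by (auto simp: bump_def intro: C_n_mult C_n_ident)

lemma bump_continuous: "bump R \<psi> \<Longrightarrow> continuous_on UNIV \<psi>"
  by (metis C_n.simps(1) bump_def)

lemma bump_integrable:
  fixes g :: "real \<Rightarrow> complex"
  assumes \<psi>: "bump R \<psi>" and g: "continuous_on UNIV g"
  shows "integrable lborel (\<lambda>x. complex_of_real (\<psi> x) * g x)"
proof -
  have "integrable lborel (\<lambda>x. indicator {-R..R} x *\<^sub>R (complex_of_real (\<psi> x) * g x))"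
    using bump_continuous[OF \<psi>] g
    by (intro borel_integrable_compact continuous_intros) (auto intro: continuous_on_subset)
  moreover have "indicator {-R..R} x *\<^sub>R (complex_of_real (\<psi> x) * g x) = complex_of_real (\<psi> x) * g x" for x
    using \<psi> by (cases "x \<in> {-R..R}") (auto simp: bump_def)
  ultimately show ?thesis by simp
qed

text \<open>The sign in the exponent is opposite to that of \<open>fourier1\<close>, and the factor
  1 / (2 pi) is missing, so this is 2 pi times the inverse Fourier transform.\<close>

definition fourier_bump :: "(real \<Rightarrow> real) \<Rightarrow> real \<Rightarrow> complex" where
  "fourier_bump \<psi> s = (LINT \<kappa>|lborel. complex_of_real (\<psi> \<kappa>) * iexp (- (\<kappa> * s)))"

lemma iexp_linear_deriv:
  "((\<lambda>t. iexp (- (c * t))) has_vector_derivative (- c) *\<^sub>R (\<i> * iexp (- (c * t)))) (at t)"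
proof -
  have "((\<lambda>t. - (c * t)) has_vector_derivative - c) (at t)"
    by (auto intro!: derivative_eq_intros)
  from vector_diff_chain_at[OF this has_vector_derivative_iexp] show ?thesis
    by (simp only: o_def)
qed

lemma norm_iexp [simp]: "cmod (iexp x) = 1"
  using norm_exp_i_times[of x] by simp

lemma fourier_bump_integrable: "bump R \<psi> \<Longrightarrow> integrable lborel (\<lambda>\<kappa>. complex_of_real (\<psi> \<kappa>) * iexp (- (\<kappa> * s)))"
  by (rule bump_integrable) (auto intro!: continuous_intros)

lemma fourier_bump_bounded:
  assumes "bump R \<psi>"
  shows "cmod (fourier_bump \<psi> s) \<le> (LINT \<kappa>|lborel. \<bar>\<psi> \<kappa>\<bar>)"
  using integral_norm_bound[of lborel "\<lambda>\<kappa>. complex_of_real (\<psi> \<kappa>) * iexp (- (\<kappa> * s))"]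
  by (simp add: fourier_bump_def norm_mult)

lemma fourier_bump_parts:
  assumes \<psi>: "bump R \<psi>" and d: "\<And>x. (\<psi> has_real_derivative \<psi>' x) (at x)" and \<psi>': "bump R \<psi>'"
  shows "fourier_bump \<psi>' s = \<i> * complex_of_real s * fourier_bump \<psi> s"
proof -
  let ?e = "\<lambda>\<kappa>. iexp (- (\<kappa> * s))"
  let ?f = "\<lambda>\<kappa>. complex_of_real (\<psi>' \<kappa>) * ?e \<kappa> - \<i> * complex_of_real s * (complex_of_real (\<psi> \<kappa>) * ?e \<kappa>)"
  \<comment> \<open>An end point strictly beyond the support, so that the boundary terms of the
    integration by parts vanish.\<close>
  define R' where "R' = \<bar>R\<bar> + 1"
  have cont: "continuous_on S ?f" for S
    using bump_continuous[OF \<psi>] bump_continuous[OF \<psi>']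
    by (intro continuous_intros) (auto intro: continuous_on_subset)
  have "(LINT x|lborel. indicator {-R'..R'} x *\<^sub>R ?f x) =
      complex_of_real (\<psi> R') * ?e R' - complex_of_real (\<psi> (- R')) * ?e (- R')"
  proof (rule integral_FTC_Icc)
    show "((\<lambda>\<kappa>. complex_of_real (\<psi> \<kappa>) * ?e \<kappa>) has_vector_derivative ?f x) (at x within {-R'..R'})" for x
    proof (rule has_vector_derivative_at_within)
      have "((\<lambda>\<kappa>. ?e \<kappa>) has_vector_derivative (- s) *\<^sub>R (\<i> * ?e x)) (at x)"
        using iexp_linear_deriv[of s x] unfolding mult.commute[of s] .
      moreover have "((\<lambda>\<kappa>. complex_of_real (\<psi> \<kappa>)) has_vector_derivative complex_of_real (\<psi>' x)) (at x)"
        using d[of x] by (auto simp: has_real_derivative_iff_has_vector_derivative intro: has_vector_derivative_of_real)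
      ultimately have "((\<lambda>\<kappa>. complex_of_real (\<psi> \<kappa>) * ?e \<kappa>) has_vector_derivative
          complex_of_real (\<psi> x) * ((- s) *\<^sub>R (\<i> * ?e x)) + complex_of_real (\<psi>' x) * ?e x) (at x)"
        by (intro has_vector_derivative_mult)
      then show "((\<lambda>\<kappa>. complex_of_real (\<psi> \<kappa>) * ?e \<kappa>) has_vector_derivative ?f x) (at x)"
        by (simp add: scaleR_conv_of_real algebra_simps)
    qed
  qed (use cont in \<open>auto simp: R'_def\<close>)
  also have "\<dots> = 0" using \<psi> by (simp add: bump_def R'_def)
  also have "(\<lambda>x. indicator {-R'..R'} x *\<^sub>R ?f x) = ?f"
  proof
    fix x show "indicator {-R'..R'} x *\<^sub>R ?f x = ?f x"
      using \<psi> \<psi>' by (cases "x \<in> {-R'..R'}") (auto simp: bump_def R'_def)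
  qed
  finally show ?thesis
    using fourier_bump_integrable[OF \<psi>, of s] fourier_bump_integrable[OF \<psi>', of s]
    by (simp add: fourier_bump_def)
qed

text \<open>D is the sequence of all derivatives of u; giving it explicitly makes every closure
  property a matter of writing down a new sequence.\<close>

definition schwartz1 :: "(real \<Rightarrow> complex) \<Rightarrow> bool" where
  "schwartz1 u \<longleftrightarrow> (\<exists>D. D 0 = u \<and> (\<forall>n.
     (\<forall>s. (D n has_vector_derivative D (Suc n) s) (at s)) \<and>
     (\<forall>N. \<exists>C. \<forall>s. (1 + \<bar>s\<bar>) ^ N * cmod (D n s) \<le> C)))"

lemma schwartz1_deriv:
  assumes "schwartz1 u"
  obtains u' where "\<And>s. (u has_vector_derivative u' s) (at s)" "schwartz1 u'"
proof -
  from assms obtain D where D: "D 0 = u" "\<And>n s. (D n has_vector_derivative D (Suc n) s) (at s)"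
    "\<And>n N. \<exists>C. \<forall>s. (1 + \<bar>s\<bar>) ^ N * cmod (D n s) \<le> C" unfolding schwartz1_def by blast
  have "schwartz1 (D 1)"
    unfolding schwartz1_def by (rule exI[of _ "\<lambda>n. D (Suc n)"]) (use D in auto)
  then show ?thesis using D(1) D(2)[of 0] that by auto
qed

lemma schwartz1_decay:
  assumes "schwartz1 u"
  obtains C where "C \<ge> 0" "\<And>s. (1 + \<bar>s\<bar>) ^ N * cmod (u s) \<le> C"
proof -
  from assms obtain C where C: "\<And>s. (1 + \<bar>s\<bar>) ^ N * cmod (u s) \<le> C" unfolding schwartz1_def by metis
  have "0 \<le> (1 + \<bar>0::real\<bar>) ^ N * cmod (u 0)" by simp
  with C[of 0] have "C \<ge> 0" by linarith
  with C show ?thesis using that by blast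
qed

lemma schwartz1_continuous: "schwartz1 u \<Longrightarrow> continuous_on UNIV u"
  by (metis schwartz1_deriv has_vector_derivative_continuous continuous_at_imp_continuous_on)

lemma schwartz1_measurable: "schwartz1 u \<Longrightarrow> u \<in> borel_measurable borel"
  by (intro borel_measurable_continuous_onI schwartz1_continuous)

text \<open>Integration by parts trades each factor 1 + |s| for one derivative of \<psi>, and the
  derivatives of a bump are bumps with the same support bound.\<close>

lemma fourier_bump_decay:
  "bump R \<psi> \<Longrightarrow> \<exists>C. \<forall>s. (1 + \<bar>s\<bar>) ^ N * cmod (fourier_bump \<psi> s) \<le> C"
proof (induction N arbitrary: \<psi>)
  case 0
  then show ?case using fourier_bump_bounded by auto
next
  case (Suc N)
  obtain \<psi>' where d: "\<And>x. (\<psi> has_real_derivative \<psi>' x) (at x)" and \<psi>': "bump R \<psi>'"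
    using bump_deriv[OF Suc.prems] by blast
  from Suc.IH[OF Suc.prems] Suc.IH[OF \<psi>'] obtain C C' where C:
    "\<And>s. (1 + \<bar>s\<bar>) ^ N * cmod (fourier_bump \<psi> s) \<le> C" "\<And>s. (1 + \<bar>s\<bar>) ^ N * cmod (fourier_bump \<psi>' s) \<le> C'" by blast
  have "(1 + \<bar>s\<bar>) ^ Suc N * cmod (fourier_bump \<psi> s) \<le> C + C'" for s
  proof -
    have "(1 + \<bar>s\<bar>) * cmod (fourier_bump \<psi> s) = cmod (fourier_bump \<psi> s) + cmod (fourier_bump \<psi>' s)"
      unfolding fourier_bump_parts[OF Suc.prems d \<psi>'] by (simp add: norm_mult algebra_simps)
    then have "(1 + \<bar>s\<bar>) ^ Suc N * cmod (fourier_bump \<psi> s) =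
        (1 + \<bar>s\<bar>) ^ N * cmod (fourier_bump \<psi> s) + (1 + \<bar>s\<bar>) ^ N * cmod (fourier_bump \<psi>' s)"
      unfolding power_Suc2 mult.assoc by (simp add: distrib_left)
    then show ?thesis using C[of s] by simp
  qed
  then show ?case by blast
qed

text \<open>Differentiation under the integral brings down the factor -i \<kappa>, so the n-th
  derivative is the transform of \<kappa>^n \<psi>, which is again a bump.\<close>

lemma schwartz1_fourier_bump:
  assumes \<psi>: "bump R \<psi>"
  shows "schwartz1 (\<lambda>s. c * fourier_bump \<psi> s)"
  unfolding schwartz1_def
proof (rule exI, intro conjI allI)
  let ?D = "\<lambda>n s. c * ((- \<i>) ^ n * fourier_bump (\<lambda>\<kappa>. \<kappa> ^ n * \<psi> \<kappa>) s)"
  have b: "bump R (\<lambda>\<kappa>. \<kappa> ^ n * \<psi> \<kappa>)" for n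
    by (induction n) (auto simp: \<psi> mult.assoc dest: bump_times)
  show "?D 0 = (\<lambda>s. c * fourier_bump \<psi> s)" by simp
  have deriv: "(fourier_bump \<psi> has_vector_derivative - \<i> * fourier_bump (\<lambda>\<kappa>. \<kappa> * \<psi> \<kappa>) s) (at s)" if \<psi>: "bump R \<psi>" for \<psi> s
  proof -
    have "((\<lambda>s. LINT \<kappa>|lborel. complex_of_real (\<psi> \<kappa>) * iexp (- (\<kappa> * s))) has_vector_derivative
        (LINT \<kappa>|lborel. complex_of_real (\<psi> \<kappa>) * ((- \<kappa>) *\<^sub>R (\<i> * iexp (- (\<kappa> * s)))))) (at s)"
    proof (rule has_vector_derivative_integral[where B = "\<lambda>\<kappa>. cmod (complex_of_real (\<kappa> * \<psi> \<kappa>) * 1)"])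
      fix a t
      show "((\<lambda>t. complex_of_real (\<psi> a) * iexp (- (a * t))) has_vector_derivative
          complex_of_real (\<psi> a) * ((- a) *\<^sub>R (\<i> * iexp (- (a * t))))) (at t)"
        by (rule has_vector_derivative_mult_right[OF iexp_linear_deriv])
      show "norm (complex_of_real (\<psi> a) * ((- a) *\<^sub>R (\<i> * iexp (- (a * t))))) \<le> cmod (complex_of_real (a * \<psi> a) * 1)"
        by (simp add: norm_mult)
    next
      show "integrable lborel (\<lambda>\<kappa>. cmod (complex_of_real (\<kappa> * \<psi> \<kappa>) * 1))"
        by (intro integrable_norm bump_integrable[OF bump_times[OF \<psi>]] continuous_intros)
    qed (rule fourier_bump_integrable[OF \<psi>])
    also have "(LINT \<kappa>|lborel. complex_of_real (\<psi> \<kappa>) * ((- \<kappa>) *\<^sub>R (\<i> * iexp (- (\<kappa> * s))))) =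
        (LINT \<kappa>|lborel. - \<i> * (complex_of_real (\<kappa> * \<psi> \<kappa>) * iexp (- (\<kappa> * s))))"
      by (intro Bochner_Integration.integral_cong) (auto simp: scaleR_conv_of_real)
    also have "\<dots> = - \<i> * fourier_bump (\<lambda>\<kappa>. \<kappa> * \<psi> \<kappa>) s"
      unfolding fourier_bump_def by (rule integral_mult_right_zero)
    finally show ?thesis by (simp add: fourier_bump_def[abs_def])
  qed
  show "(?D n has_vector_derivative ?D (Suc n) s) (at s)" for n s
  proof -
    have "((\<lambda>s. c * ((- \<i>) ^ n * fourier_bump (\<lambda>\<kappa>. \<kappa> ^ n * \<psi> \<kappa>) s)) has_vector_derivative
        c * ((- \<i>) ^ n * (- \<i> * fourier_bump (\<lambda>\<kappa>. \<kappa> * (\<kappa> ^ n * \<psi> \<kappa>)) s))) (at s)"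
      by (intro has_vector_derivative_mult_right deriv b)
    then show ?thesis by (simp add: mult_ac)
  qed
  show "\<exists>C. \<forall>s. (1 + \<bar>s\<bar>) ^ N * cmod (?D n s) \<le> C" for n N
  proof -
    obtain C where "\<And>s. (1 + \<bar>s\<bar>) ^ N * cmod (fourier_bump (\<lambda>\<kappa>. \<kappa> ^ n * \<psi> \<kappa>) s) \<le> C"
      using fourier_bump_decay[OF b] by blast
    then show ?thesis
      by (intro exI[of _ "cmod c * C"]) (simp add: norm_mult norm_power mult.left_commute mult_left_mono)
  qed
qed

section \<open>Integrability and Fourier inversion\<close>

definition fourier1 :: "(real \<Rightarrow> complex) \<Rightarrow> real \<Rightarrow> complex" where
  "fourier1 u \<kappa> = (LINT s|lborel. iexp (\<kappa> * s) * u s)"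

lemma integrable_inverse_1_plus_square_lborel: "integrable lborel (\<lambda>s::real. inverse (1 + s\<^sup>2))"
  using integrable_inverse_1_plus_square by (simp add: set_integrable_def einterval_def)

lemma schwartz1_integrable:
  assumes u: "schwartz1 u"
  shows "integrable lborel (\<lambda>s. (1 + \<bar>s\<bar>) ^ N * cmod (u s))"
proof -
  \<comment> \<open>The two surplus powers of the weight leave the integrable majorant 1 / (1 +
    s^2).\<close>
  obtain C where C: "C \<ge> 0" "\<And>s. (1 + \<bar>s\<bar>) ^ (N + 2) * cmod (u s) \<le> C"
    by (rule schwartz1_decay[OF u, of "N + 2"]) blast
  show ?thesis
  proof (rule Bochner_Integration.integrable_bound)
    show "integrable lborel (\<lambda>s. C * inverse (1 + s\<^sup>2))"
      using integrable_inverse_1_plus_square_lborel by simp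
    show "(\<lambda>s. (1 + \<bar>s\<bar>) ^ N * cmod (u s)) \<in> borel_measurable lborel"
      using schwartz1_measurable[OF u] by measurable
    show "AE s in lborel. norm ((1 + \<bar>s\<bar>) ^ N * cmod (u s)) \<le> norm (C * inverse (1 + s\<^sup>2))"
    proof (rule AE_I2)
      fix s :: real
      have "(1 + s\<^sup>2) * ((1 + \<bar>s\<bar>) ^ N * cmod (u s)) \<le> (1 + \<bar>s\<bar>)\<^sup>2 * ((1 + \<bar>s\<bar>) ^ N * cmod (u s))"
        by (intro mult_right_mono) (auto simp: power2_sum)
      also have "\<dots> = (1 + \<bar>s\<bar>) ^ (N + 2) * cmod (u s)" by (simp add: power_add power2_eq_square mult_ac)
      also have "\<dots> \<le> C" by (rule C)
      finally have "(1 + \<bar>s\<bar>) ^ N * cmod (u s) \<le> C / (1 + s\<^sup>2)"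
        by (simp add: pos_le_divide_eq add_pos_nonneg mult.commute)
      then show "norm ((1 + \<bar>s\<bar>) ^ N * cmod (u s)) \<le> norm (C * inverse (1 + s\<^sup>2))"
        using C(1) by (simp add: divide_inverse)
    qed
  qed
qed

lemma schwartz1_L1: "schwartz1 u \<Longrightarrow> integrable lborel u"
  using schwartz1_integrable[of u 0] schwartz1_measurable[of u]
  by (intro integrable_norm_cancel[of _ u]) auto

lemma fourier1_integrable:
  assumes "integrable lborel u"
  shows "integrable lborel (\<lambda>s. iexp (\<kappa> * s) * u s)"
  using assms by (intro Bochner_Integration.integrable_bound[OF assms]) (auto simp: norm_mult)

lemma gaussian_fourier:
  "(LINT x|lborel. complex_of_real (std_normal_density x) * iexp (t * x)) = complex_of_real (exp (- (t\<^sup>2) / 2))"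
proof -
  have "char std_normal_distribution t = (LINT x|lborel. std_normal_density x *\<^sub>R iexp (t * x))"
    unfolding char_def by (intro integral_density) auto
  then show ?thesis by (simp add: char_std_normal_distribution scaleR_conv_of_real)
qed

text \<open>Insert the Gaussian factor \<open>exp (- (\<epsilon> s)\<^sup>2 / 2)\<close> and let \<open>\<epsilon> \<rightarrow> 0\<close>.\<close>

lemma fourier_inversion:
  assumes \<psi>: "bump R \<psi>"
  shows "fourier1 (fourier_bump \<psi>) \<kappa> = 2 * complex_of_real pi * complex_of_real (\<psi> \<kappa>)"
proof -
  define n where "n x = complex_of_real (std_normal_density x)" for x
  have n_meas [measurable]: "n \<in> borel_measurable borel" unfolding n_def by measurable
  have n_int: "integrable lborel n"
    using integrable_normal_moment_abs[of 1 0 0] integrable_normal_density[of 1 0]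
    unfolding n_def by (intro integrable_of_real) simp
  have \<psi>_meas [measurable]: "\<psi> \<in> borel_measurable borel"
    by (rule borel_measurable_continuous_onI[OF bump_continuous[OF \<psi>]])
  have u: "schwartz1 (fourier_bump \<psi>)" using schwartz1_fourier_bump[OF \<psi>, of 1] by simp
  have u_meas [measurable]: "fourier_bump \<psi> \<in> borel_measurable borel" by (rule schwartz1_measurable[OF u])
  have \<psi>_int: "integrable lborel (\<lambda>\<kappa>. complex_of_real (\<psi> \<kappa>))"
    using bump_integrable[OF \<psi>, of "\<lambda>_. 1"] by simp
  obtain B where B: "\<And>x. \<bar>\<psi> x\<bar> \<le> B"
  proof -
    have "bounded (\<psi> ` {-R..R})"
      by (intro compact_imp_bounded compact_continuous_image continuous_on_subset[OF bump_continuous[OF \<psi>]]) auto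
    then obtain B where B: "\<forall>x\<in>{-R..R}. \<bar>\<psi> x\<bar> \<le> B" by (auto simp: bounded_iff)
    have "\<bar>\<psi> x\<bar> \<le> max B 0" for x
    proof (cases "x \<in> {-R..R}")
      case True
      then show ?thesis using B by (auto simp: le_max_iff_disj)
    next
      case False
      then have "\<psi> x = 0" using \<psi> unfolding bump_def by auto
      then show ?thesis by simp
    qed
    then show ?thesis by (rule that)
  qed
  \<comment> \<open>Chosen so that \<open>c * n x\<close> is exp (-x^2 / 2): this is 1 at 0 and at
    most 1 everywhere. Its square produces the factor 2 pi.\<close>
  define c where "c = complex_of_real (sqrt (2 * pi))"
  have cc: "c * c = 2 * complex_of_real pi"
    unfolding c_def of_real_mult[symmetric] by (simp add: real_sqrt_mult_self)
  have n_max: "cmod (c * n x) \<le> 1" for x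
  proof -
    have "c * n x = complex_of_real (exp (- (x\<^sup>2) / 2))"
      unfolding n_def c_def of_real_mult[symmetric] by (simp add: std_normal_density_def)
    also have "cmod \<dots> \<le> 1" by simp
    finally show ?thesis .
  qed
  have n0: "c * n 0 = 1"
    unfolding n_def c_def of_real_mult[symmetric] by (simp add: std_normal_density_def)
  have n_cont: "isCont n x" for x unfolding n_def std_normal_density_def by (intro continuous_intros) auto
  \<comment> \<open>Fubini and the Gaussian transform turn the regularized integral into an average
    of \<psi> around \<kappa> with Gaussian weight of width \<epsilon>. As \<epsilon> tends to 0,
    the left side tends to the Fourier transform and the average to \<psi> \<kappa>.\<close>
  have key: "(LINT s|lborel. c * n (\<epsilon> * s) * (iexp (\<kappa> * s) * fourier_bump \<psi> s)) =
      2 * complex_of_real pi * (LINT x|lborel. complex_of_real (\<psi> (\<kappa> + \<epsilon> * x)) * n x)" if \<epsilon>: "\<epsilon> > 0" for \<epsilon>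
  proof -
    let ?g = "\<lambda>s \<kappa>'. c * n (\<epsilon> * s) * iexp ((\<kappa> - \<kappa>') * s) * complex_of_real (\<psi> \<kappa>')"
    have int_n: "integrable lborel (\<lambda>s. n (\<epsilon> * s))"
      using lborel_integrable_real_affine[of n \<epsilon> 0] n_int \<epsilon> by simp
    have joint: "integrable (lborel \<Otimes>\<^sub>M lborel) (case_prod ?g)"
    proof (rule lborel_pair.Fubini_integrable)
      show "case_prod ?g \<in> borel_measurable (lborel \<Otimes>\<^sub>M lborel)" by measurable
      have "integrable lborel (\<lambda>s. cmod (c * n (\<epsilon> * s)) * (LINT y|lborel. \<bar>\<psi> y\<bar>))"
        by (rule integrable_mult_left) (use int_n in auto)
      then show "integrable lborel (\<lambda>s. LINT y|lborel. norm (case_prod ?g (s, y)))"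
        by (simp add: norm_mult)
      show "AE s in lborel. integrable lborel (\<lambda>y. case_prod ?g (s, y))"
      proof (rule AE_I2)
        fix s
        have "integrable lborel (\<lambda>y. complex_of_real (\<psi> y) * (c * n (\<epsilon> * s) * iexp ((\<kappa> - y) * s)))"
          by (rule bump_integrable[OF \<psi>]) (intro continuous_intros)
        then show "integrable lborel (\<lambda>y. case_prod ?g (s, y))" by (simp add: mult_ac)
      qed
    qed
    have "(LINT s|lborel. c * n (\<epsilon> * s) * (iexp (\<kappa> * s) * fourier_bump \<psi> s)) = (LINT s|lborel. LINT \<kappa>'|lborel. ?g s \<kappa>')"
    proof (rule Bochner_Integration.integral_cong[OF refl])
      fix s
      have "c * n (\<epsilon> * s) * (iexp (\<kappa> * s) * fourier_bump \<psi> s) =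
          (LINT \<kappa>'|lborel. c * n (\<epsilon> * s) * iexp (\<kappa> * s) * (complex_of_real (\<psi> \<kappa>') * iexp (- (\<kappa>' * s))))"
        unfolding fourier_bump_def by (simp add: mult.assoc)
      also have "\<dots> = (LINT \<kappa>'|lborel. ?g s \<kappa>')"
        by (intro Bochner_Integration.integral_cong)
           (auto simp: exp_add[symmetric] algebra_simps simp flip: exp_diff)
      finally show "c * n (\<epsilon> * s) * (iexp (\<kappa> * s) * fourier_bump \<psi> s) = (LINT \<kappa>'|lborel. ?g s \<kappa>')" .
    qed
    also have "\<dots> = (LINT \<kappa>'|lborel. LINT s|lborel. ?g s \<kappa>')"
      by (rule lborel_pair.Fubini_integral[OF joint, symmetric])
    also have "\<dots> = (LINT \<kappa>'|lborel. complex_of_real (\<psi> \<kappa>') * (2 * complex_of_real pi / \<epsilon> * n ((\<kappa> - \<kappa>') / \<epsilon>)))"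
    proof (rule Bochner_Integration.integral_cong[OF refl])
      fix \<kappa>'
      have "(LINT s|lborel. n (\<epsilon> * s) * iexp ((\<kappa> - \<kappa>') * s)) =
          (1 / \<epsilon>) *\<^sub>R (LINT x|lborel. n (\<epsilon> * (0 + 1 / \<epsilon> * x)) * iexp ((\<kappa> - \<kappa>') * (0 + 1 / \<epsilon> * x)))"
        using \<epsilon> by (subst lborel_integral_real_affine[where c = "1 / \<epsilon>" and t = 0]) auto
      also have "\<dots> = (1 / \<epsilon>) *\<^sub>R (LINT x|lborel. n x * iexp ((\<kappa> - \<kappa>') / \<epsilon> * x))"
        using \<epsilon> by simp
      also have "\<dots> = (1 / \<epsilon>) *\<^sub>R complex_of_real (exp (- (((\<kappa> - \<kappa>') / \<epsilon>)\<^sup>2) / 2))"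
        unfolding n_def gaussian_fourier ..
      also have "complex_of_real (exp (- (((\<kappa> - \<kappa>') / \<epsilon>)\<^sup>2) / 2)) = c * n ((\<kappa> - \<kappa>') / \<epsilon>)"
        unfolding n_def c_def of_real_mult[symmetric] by (simp add: std_normal_density_def)
      finally have "(LINT s|lborel. n (\<epsilon> * s) * iexp ((\<kappa> - \<kappa>') * s)) = c * n ((\<kappa> - \<kappa>') / \<epsilon>) / \<epsilon>"
        by (simp add: scaleR_conv_of_real divide_inverse mult_ac)
      moreover have "(LINT s|lborel. ?g s \<kappa>') = (LINT s|lborel. (c * complex_of_real (\<psi> \<kappa>')) * (n (\<epsilon> * s) * iexp ((\<kappa> - \<kappa>') * s)))"
        by (intro Bochner_Integration.integral_cong) (auto simp: mult_ac)
      moreover have "c * x * (c * y / z) = x * (2 * complex_of_real pi / z * y)" for x y z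
        unfolding cc[symmetric] by (simp add: mult_ac)
      ultimately show "(LINT s|lborel. ?g s \<kappa>') = complex_of_real (\<psi> \<kappa>') * (2 * complex_of_real pi / \<epsilon> * n ((\<kappa> - \<kappa>') / \<epsilon>))"
        by (simp add: cc)
    qed
    also have "\<dots> = \<epsilon> *\<^sub>R (LINT x|lborel. complex_of_real (\<psi> (\<kappa> + \<epsilon> * x)) * (2 * complex_of_real pi / \<epsilon> * n ((\<kappa> - (\<kappa> + \<epsilon> * x)) / \<epsilon>)))"
      using \<epsilon> by (subst lborel_integral_real_affine[where c = \<epsilon> and t = \<kappa>]) auto
    also have "(\<lambda>x. complex_of_real (\<psi> (\<kappa> + \<epsilon> * x)) * (2 * complex_of_real pi / \<epsilon> * n ((\<kappa> - (\<kappa> + \<epsilon> * x)) / \<epsilon>))) =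
        (\<lambda>x. (2 * complex_of_real pi / \<epsilon>) * (complex_of_real (\<psi> (\<kappa> + \<epsilon> * x)) * n x))"
    proof
      fix x
      have "n ((\<kappa> - (\<kappa> + \<epsilon> * x)) / \<epsilon>) = n x"
        using \<epsilon> by (simp add: n_def std_normal_density_def)
      then show "complex_of_real (\<psi> (\<kappa> + \<epsilon> * x)) * (2 * complex_of_real pi / \<epsilon> * n ((\<kappa> - (\<kappa> + \<epsilon> * x)) / \<epsilon>)) =
          (2 * complex_of_real pi / \<epsilon>) * (complex_of_real (\<psi> (\<kappa> + \<epsilon> * x)) * n x)" by (simp add: mult_ac)
    qed
    finally show ?thesis using \<epsilon> by (simp add: scaleR_conv_of_real)
  qed
  define e where "e i = 1 / real (Suc i)" for i
  have e: "e i > 0" for i by (simp add: e_def)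
  have e0: "e \<longlonglongrightarrow> 0" unfolding e_def by (rule LIMSEQ_Suc[OF lim_1_over_n])
  have "(\<lambda>i. LINT s|lborel. c * n (e i * s) * (iexp (\<kappa> * s) * fourier_bump \<psi> s)) \<longlonglongrightarrow>
      (LINT s|lborel. iexp (\<kappa> * s) * fourier_bump \<psi> s)"
  proof (rule integral_dominated_convergence[where w = "\<lambda>s. cmod (fourier_bump \<psi> s)"])
    show "AE s in lborel. (\<lambda>i. c * n (e i * s) * (iexp (\<kappa> * s) * fourier_bump \<psi> s)) \<longlonglongrightarrow> iexp (\<kappa> * s) * fourier_bump \<psi> s"
    proof (rule AE_I2)
      fix s :: real
      have "(\<lambda>i. n (e i * s)) \<longlonglongrightarrow> n (0 * s)"
        by (intro isCont_tendsto_compose[OF n_cont] tendsto_intros e0)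
      then have "(\<lambda>i. c * n (e i * s) * (iexp (\<kappa> * s) * fourier_bump \<psi> s)) \<longlonglongrightarrow> c * n (0 * s) * (iexp (\<kappa> * s) * fourier_bump \<psi> s)"
        by (intro tendsto_intros)
      then show "(\<lambda>i. c * n (e i * s) * (iexp (\<kappa> * s) * fourier_bump \<psi> s)) \<longlonglongrightarrow> iexp (\<kappa> * s) * fourier_bump \<psi> s"
        by (simp add: n0)
    qed
    show "AE s in lborel. norm (c * n (e i * s) * (iexp (\<kappa> * s) * fourier_bump \<psi> s)) \<le> cmod (fourier_bump \<psi> s)" for i
    proof (rule AE_I2)
      fix s
      show "norm (c * n (e i * s) * (iexp (\<kappa> * s) * fourier_bump \<psi> s)) \<le> cmod (fourier_bump \<psi> s)"
        using mult_right_mono[OF n_max[of "e i * s"], of "cmod (fourier_bump \<psi> s)"]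
        unfolding norm_mult[of "c * n (e i * s)"] norm_mult[of "iexp (\<kappa> * s)"] norm_iexp by simp
    qed
    show "integrable lborel (\<lambda>s. cmod (fourier_bump \<psi> s))" using schwartz1_L1[OF u] by simp
  qed measurable
  then have lim1: "(\<lambda>i. LINT s|lborel. c * n (e i * s) * (iexp (\<kappa> * s) * fourier_bump \<psi> s)) \<longlonglongrightarrow> fourier1 (fourier_bump \<psi>) \<kappa>"
    by (simp add: fourier1_def)
  have lim2: "(\<lambda>i. LINT x|lborel. complex_of_real (\<psi> (\<kappa> + e i * x)) * n x) \<longlonglongrightarrow> (LINT x|lborel. complex_of_real (\<psi> \<kappa>) * n x)"
  proof (rule integral_dominated_convergence[where w = "\<lambda>x. B * cmod (n x)"])
    show "AE x in lborel. (\<lambda>i. complex_of_real (\<psi> (\<kappa> + e i * x)) * n x) \<longlonglongrightarrow> complex_of_real (\<psi> \<kappa>) * n x"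
    proof (rule AE_I2)
      fix x
      have "(\<lambda>i. \<kappa> + e i * x) \<longlonglongrightarrow> \<kappa> + 0 * x" by (intro tendsto_intros e0)
      then have "(\<lambda>i. \<psi> (\<kappa> + e i * x)) \<longlonglongrightarrow> \<psi> \<kappa>"
        using bump_continuous[OF \<psi>] by (intro isCont_tendsto_compose[of \<kappa> \<psi>]) (auto simp: continuous_on_eq_continuous_at)
      then show "(\<lambda>i. complex_of_real (\<psi> (\<kappa> + e i * x)) * n x) \<longlonglongrightarrow> complex_of_real (\<psi> \<kappa>) * n x"
        by (intro tendsto_intros)
    qed
    show "AE x in lborel. norm (complex_of_real (\<psi> (\<kappa> + e i * x)) * n x) \<le> B * cmod (n x)" for i
      using B by (intro AE_I2) (simp add: norm_mult mult_right_mono)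
  qed (use n_int in auto)
  have "(LINT x|lborel. n x) = 1"
    using gaussian_fourier[of 0] by (simp add: n_def)
  then have J: "(LINT x|lborel. complex_of_real (\<psi> \<kappa>) * n x) = complex_of_real (\<psi> \<kappa>)" by simp
  have "(\<lambda>i. LINT s|lborel. c * n (e i * s) * (iexp (\<kappa> * s) * fourier_bump \<psi> s)) \<longlonglongrightarrow> 2 * complex_of_real pi * complex_of_real (\<psi> \<kappa>)"
    unfolding key[OF e] using tendsto_mult_left[OF lim2, of "2 * complex_of_real pi"] unfolding J .
  with lim1 show ?thesis by (rule LIMSEQ_unique)
qed

text \<open>The source of all smearing functions: their Fourier transforms are prescribed, and 1 /
  (2 pi) cancels the constant of the inversion formula.\<close>

lemma schwartz1_with_fourier1:
  assumes "bump R \<psi>"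
  obtains u where "schwartz1 u" "\<And>\<kappa>. fourier1 u \<kappa> = complex_of_real (\<psi> \<kappa>)"
proof (rule that)
  let ?c = "1 / (2 * complex_of_real pi)"
  show "schwartz1 (\<lambda>s. ?c * fourier_bump \<psi> s)" by (rule schwartz1_fourier_bump[OF assms])
  fix \<kappa>
  have "fourier1 (\<lambda>s. ?c * fourier_bump \<psi> s) \<kappa> = (LINT s|lborel. ?c * (iexp (\<kappa> * s) * fourier_bump \<psi> s))"
    unfolding fourier1_def by (intro Bochner_Integration.integral_cong) auto
  also have "\<dots> = ?c * fourier1 (fourier_bump \<psi>) \<kappa>"
    unfolding fourier1_def by (rule integral_mult_right_zero)
  finally show "fourier1 (\<lambda>s. ?c * fourier_bump \<psi> s) \<kappa> = complex_of_real (\<psi> \<kappa>)"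
    by (simp add: fourier_inversion[OF assms])
qed

section \<open>Operations on Schwartz functions of one variable and their Fourier transforms\<close>

lemma schwartz1I:
  assumes "D 0 = u" "\<And>n s. (D n has_vector_derivative D (Suc n) s) (at s)"
    "\<And>n N. \<exists>C. \<forall>s. (1 + \<bar>s\<bar>) ^ N * cmod (D n s) \<le> C"
  shows "schwartz1 u"
  unfolding schwartz1_def using assms by blast

lemma schwartz1E:
  assumes "schwartz1 u"
  obtains D where "D 0 = u" "\<And>n s. (D n has_vector_derivative D (Suc n) s) (at s)"
    "\<And>n. schwartz1 (D n)"
proof -
  from assms obtain D where D: "D 0 = u" "\<And>n s. (D n has_vector_derivative D (Suc n) s) (at s)"
    "\<And>n N. \<exists>C. \<forall>s. (1 + \<bar>s\<bar>) ^ N * cmod (D n s) \<le> C" unfolding schwartz1_def by blast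
  have "schwartz1 (D n)" for n
    by (rule schwartz1I[of "\<lambda>k. D (n + k)"]) (use D in auto)
  with D show ?thesis using that by blast
qed

lemma schwartz1_linear_combination:
  assumes "schwartz1 u" "schwartz1 v"
  shows "schwartz1 (\<lambda>s. c * u s + d * v s)"
proof -
  obtain D where D: "D 0 = u" "\<And>n s. (D n has_vector_derivative D (Suc n) s) (at s)" "\<And>n. schwartz1 (D n)"
    by (rule schwartz1E[OF assms(1)]) blast
  obtain E where E: "E 0 = v" "\<And>n s. (E n has_vector_derivative E (Suc n) s) (at s)" "\<And>n. schwartz1 (E n)"
    by (rule schwartz1E[OF assms(2)]) blast
  show ?thesis
  proof (rule schwartz1I[of "\<lambda>n s. c * D n s + d * E n s"])
    fix n N
    obtain A where A: "\<And>s. (1 + \<bar>s\<bar>) ^ N * cmod (D n s) \<le> A" by (rule schwartz1_decay[OF D(3), of N n]) blast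
    obtain B where B: "\<And>s. (1 + \<bar>s\<bar>) ^ N * cmod (E n s) \<le> B" by (rule schwartz1_decay[OF E(3), of N n]) blast
    have "(1 + \<bar>s\<bar>) ^ N * cmod (c * D n s + d * E n s) \<le> cmod c * A + cmod d * B" for s
    proof -
      have "(1 + \<bar>s\<bar>) ^ N * cmod (c * D n s + d * E n s) \<le> (1 + \<bar>s\<bar>) ^ N * (cmod c * cmod (D n s) + cmod d * cmod (E n s))"
        by (intro mult_left_mono norm_triangle_le) (auto simp: norm_mult)
      also have "\<dots> = cmod c * ((1 + \<bar>s\<bar>) ^ N * cmod (D n s)) + cmod d * ((1 + \<bar>s\<bar>) ^ N * cmod (E n s))"
        by (simp add: algebra_simps)
      also have "\<dots> \<le> cmod c * A + cmod d * B" using A B by (intro add_mono mult_left_mono) auto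
      finally show ?thesis .
    qed
    then show "\<exists>C. \<forall>s. (1 + \<bar>s\<bar>) ^ N * cmod (c * D n s + d * E n s) \<le> C" by blast
  qed (auto simp: D E intro!: derivative_intros)
qed

lemma affine_weight:
  fixes a b s :: real
  assumes "a \<noteq> 0"
  shows "1 + \<bar>s\<bar> \<le> (1 + (1 + \<bar>b\<bar>) / \<bar>a\<bar>) * (1 + \<bar>a * s + b\<bar>)"
proof -
  have "\<bar>a\<bar> * \<bar>s\<bar> \<le> \<bar>a * s + b\<bar> + \<bar>b\<bar>" by (simp add: abs_mult[symmetric])
  also have "\<dots> \<le> (1 + \<bar>b\<bar>) * (1 + \<bar>a * s + b\<bar>)"
    using mult_nonneg_nonneg[of "\<bar>b\<bar>" "\<bar>a * s + b\<bar>"] by (simp add: algebra_simps)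
  finally have "\<bar>s\<bar> \<le> (1 + \<bar>b\<bar>) / \<bar>a\<bar> * (1 + \<bar>a * s + b\<bar>)"
    using assms by (simp add: field_simps)
  then show ?thesis unfolding distrib_right by simp
qed

lemma schwartz1_affine:
  assumes u: "schwartz1 u" and a: "a \<noteq> 0"
  shows "schwartz1 (\<lambda>s. u (a * s + b))"
proof -
  obtain D where D: "D 0 = u" "\<And>n s. (D n has_vector_derivative D (Suc n) s) (at s)" "\<And>n. schwartz1 (D n)"
    by (rule schwartz1E[OF u]) blast
  show ?thesis
  proof (rule schwartz1I[of "\<lambda>n s. complex_of_real (a ^ n) * D n (a * s + b)"])
    fix n s
    have "((\<lambda>s. a * s + b) has_vector_derivative a) (at s)" by (auto intro!: derivative_eq_intros)
    from vector_diff_chain_at[OF this D(2)[of n "a * s + b"]]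
    have "((\<lambda>s. D n (a * s + b)) has_vector_derivative a *\<^sub>R D (Suc n) (a * s + b)) (at s)" by (simp add: o_def)
    from has_vector_derivative_mult_right[OF this, of "complex_of_real (a ^ n)"]
    show "((\<lambda>s. complex_of_real (a ^ n) * D n (a * s + b)) has_vector_derivative
        complex_of_real (a ^ Suc n) * D (Suc n) (a * s + b)) (at s)"
      by (simp add: scaleR_conv_of_real mult_ac)
  next
    fix n N
    let ?K = "1 + (1 + \<bar>b\<bar>) / \<bar>a\<bar>"
    obtain A where A: "\<And>s. (1 + \<bar>s\<bar>) ^ N * cmod (D n s) \<le> A" by (rule schwartz1_decay[OF D(3), of N n]) blast
    have "(1 + \<bar>s\<bar>) ^ N * cmod (complex_of_real (a ^ n) * D n (a * s + b)) \<le> \<bar>a ^ n\<bar> * (?K ^ N * A)" for s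
    proof -
      have "(1 + \<bar>s\<bar>) ^ N * cmod (D n (a * s + b)) \<le> (?K * (1 + \<bar>a * s + b\<bar>)) ^ N * cmod (D n (a * s + b))"
        using affine_weight[OF a, of s b] by (intro mult_right_mono power_mono) auto
      also have "\<dots> = ?K ^ N * ((1 + \<bar>a * s + b\<bar>) ^ N * cmod (D n (a * s + b)))"
        unfolding power_mult_distrib by (simp only: mult.assoc)
      also have "\<dots> \<le> ?K ^ N * A" by (intro mult_left_mono A) auto
      finally have "\<bar>a ^ n\<bar> * ((1 + \<bar>s\<bar>) ^ N * cmod (D n (a * s + b))) \<le> \<bar>a ^ n\<bar> * (?K ^ N * A)"
        by (rule mult_left_mono) simp
      then show ?thesis unfolding norm_mult norm_of_real by (simp only: mult_ac)
    qed
    then show "\<exists>C. \<forall>s. (1 + \<bar>s\<bar>) ^ N * cmod (complex_of_real (a ^ n) * D n (a * s + b)) \<le> C" by blast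
  qed (simp add: D)
qed

lemma schwartz1_cnj:
  assumes u: "schwartz1 u"
  shows "schwartz1 (\<lambda>s. cnj (u s))"
proof -
  obtain D where D: "D 0 = u" "\<And>n s. (D n has_vector_derivative D (Suc n) s) (at s)" "\<And>n. schwartz1 (D n)"
    by (rule schwartz1E[OF u]) blast
  show ?thesis
  proof (rule schwartz1I[of "\<lambda>n s. cnj (D n s)"])
    show "\<exists>C. \<forall>s. (1 + \<bar>s\<bar>) ^ N * cmod (cnj (D n s)) \<le> C" for n N
      using schwartz1_decay[OF D(3), of N n] by auto
  qed (auto simp: D intro!: has_vector_derivative_cnj)
qed

lemma schwartz1_shift: "schwartz1 u \<Longrightarrow> schwartz1 (\<lambda>s. u (s - b))"
  using schwartz1_affine[of u 1 "- b"] by simp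

lemma fourier1_shift: "fourier1 (\<lambda>s. u (s - b)) \<kappa> = iexp (\<kappa> * b) * fourier1 u \<kappa>"
proof -
  have "fourier1 (\<lambda>s. u (s - b)) \<kappa> = (LINT s|lborel. iexp (\<kappa> * (b + s)) * u s)"
    unfolding fourier1_def by (subst lborel_integral_real_affine[where c = 1 and t = b]) auto
  also have "\<dots> = (LINT s|lborel. iexp (\<kappa> * b) * (iexp (\<kappa> * s) * u s))"
    by (intro Bochner_Integration.integral_cong) (auto simp: exp_add[symmetric] algebra_simps)
  also have "\<dots> = iexp (\<kappa> * b) * fourier1 u \<kappa>" unfolding fourier1_def by (rule integral_mult_right_zero)
  finally show ?thesis .
qed

text \<open>The normalization keeps the value of the transform at 0. Large c gives an approximate
  identity, small c concentrates the transform near 0.\<close>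

lemma fourier1_scale:
  assumes "c > 0"
  shows "fourier1 (\<lambda>s. complex_of_real c * u (c * s)) \<kappa> = fourier1 u (\<kappa> / c)"
proof -
  have "fourier1 u (\<kappa> / c) = \<bar>c\<bar> *\<^sub>R (LINT s|lborel. iexp (\<kappa> / c * (0 + c * s)) * u (0 + c * s))"
    unfolding fourier1_def using assms by (subst lborel_integral_real_affine[where c = c and t = 0]) auto
  also have "\<dots> = complex_of_real c * (LINT s|lborel. iexp (\<kappa> * s) * u (c * s))"
    using assms by (simp add: scaleR_conv_of_real)
  also have "\<dots> = (LINT s|lborel. complex_of_real c * (iexp (\<kappa> * s) * u (c * s)))"
    by (rule integral_mult_right_zero[symmetric])
  also have "\<dots> = fourier1 (\<lambda>s. complex_of_real c * u (c * s)) \<kappa>"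
    unfolding fourier1_def by (intro Bochner_Integration.integral_cong) auto
  finally show ?thesis by simp
qed

lemma fourier1_diff:
  assumes "schwartz1 u" "schwartz1 v"
  shows "fourier1 (\<lambda>s. u s - v s) \<kappa> = fourier1 u \<kappa> - fourier1 v \<kappa>"
  unfolding fourier1_def
  using fourier1_integrable[OF schwartz1_L1[OF assms(1)]] fourier1_integrable[OF schwartz1_L1[OF assms(2)]]
  by (simp add: right_diff_distrib)

text \<open>Conjugation reflects frequencies. This is how passing to the adjoint exchanges positive
  and negative energies in the commutant argument.\<close>

lemma fourier1_cnj: "fourier1 (\<lambda>s. cnj (u s)) \<kappa> = cnj (fourier1 u (- \<kappa>))"
proof -
  have "cnj (fourier1 u (- \<kappa>)) = (LINT s|lborel. cnj (iexp (- \<kappa> * s) * u s))"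
    unfolding fourier1_def by (rule Bochner_Integration.integral_bounded_linear'[OF bounded_linear_cnj bounded_linear_cnj, symmetric]) simp
  also have "\<dots> = fourier1 (\<lambda>s. cnj (u s)) \<kappa>"
    unfolding fourier1_def by (intro Bochner_Integration.integral_cong) (auto simp: exp_cnj)
  finally show ?thesis by simp
qed

section \<open>Product functions on space-time\<close>

text \<open>Lebesgue measure on vectors is the image of a product measure indexed by
  \<open>Basis\<close>. The coordinates are matched with the basis vectors through the injective map
  \<open>axis\<close>.\<close>

lemma
  fixes f :: "'d::finite \<Rightarrow> real \<Rightarrow> 'b::{real_normed_field,banach,second_countable_topology}"
  assumes f: "\<And>j. integrable lborel (f j)"
  shows integrable_prod_vec: "integrable lborel (\<lambda>a::real^'d. \<Prod>j\<in>UNIV. f j (a $ j))"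
    and integral_prod_vec: "(LINT a|lborel. (\<Prod>j\<in>UNIV. f j ((a::real^'d) $ j))) = (\<Prod>j\<in>UNIV. integral\<^sup>L lborel (f j))"
proof -
  let ?ax = "\<lambda>j. axis j 1 :: real^'d"
  define g where "g b = f (inv ?ax b)" for b
  interpret product_sigma_finite "\<lambda>b::real^'d. lborel :: real measure" by standard
  have inj: "inj ?ax" by (auto simp: inj_on_def axis_eq_axis)
  have B: "range ?ax = Basis" by (auto simp: Basis_vec_def)
  define T where "T x = (\<Sum>b\<in>Basis. x b *\<^sub>R b)" for x :: "real^'d \<Rightarrow> real"
  have T: "T x $ j = x (?ax j)" for x j
    unfolding T_def cart_eq_inner_axis by (rule inner_sum_left_Basis) (use B in auto)
  have eq: "(\<Prod>j\<in>UNIV. f j (T x $ j)) = (\<Prod>b\<in>Basis. g b (x b))" for x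
    unfolding T B[symmetric] prod.reindex[OF inj] g_def by (simp add: inv_f_f[OF inj])
  have lb: "(lborel :: (real^'d) measure) = distr (\<Pi>\<^sub>M b\<in>Basis. lborel) borel T"
    unfolding T_def by (rule lborel_eq)
  have fm: "f j \<in> borel_measurable borel" for j using borel_measurable_integrable[OF f[of j]] by simp
  have m1: "(\<lambda>a::real^'d. \<Prod>j\<in>UNIV. f j (a $ j)) \<in> borel_measurable borel"
    using fm by measurable
  have m2: "T \<in> measurable (\<Pi>\<^sub>M b\<in>Basis. lborel) borel" unfolding T_def by measurable
  have gi: "integrable lborel (g b)" for b unfolding g_def by (rule f)
  show "integrable lborel (\<lambda>a::real^'d. \<Prod>j\<in>UNIV. f j (a $ j))"
    unfolding lb by (subst integrable_distr_eq[OF m2 m1]) (simp add: eq product_integrable_prod gi)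
  have "(LINT a|lborel. (\<Prod>j\<in>UNIV. f j ((a::real^'d) $ j))) = (LINT x|(\<Pi>\<^sub>M b\<in>Basis. lborel). (\<Prod>b\<in>Basis. g b (x b)))"
    unfolding lb by (subst integral_distr[OF m2 m1]) (simp add: eq)
  also have "\<dots> = (\<Prod>b\<in>Basis. integral\<^sup>L lborel (g b))" by (rule product_integral_prod) (auto simp: gi)
  also have "\<dots> = (\<Prod>j\<in>UNIV. integral\<^sup>L lborel (f j))"
    unfolding B[symmetric] prod.reindex[OF inj] g_def by (simp add: inv_f_f[OF inj])
  finally show "(LINT a|lborel. (\<Prod>j\<in>UNIV. f j ((a::real^'d) $ j))) = (\<Prod>j\<in>UNIV. integral\<^sup>L lborel (f j))" .
qed

lemma one_plus_sum_le_prod: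
  fixes x :: "'a \<Rightarrow> real"
  assumes "finite A" "\<And>j. j \<in> A \<Longrightarrow> 0 \<le> x j"
  shows "1 + (\<Sum>j\<in>A. x j) \<le> (\<Prod>j\<in>A. 1 + x j)"
  using assms
proof (induction A rule: finite_induct)
  case (insert i A)
  have "1 + (\<Sum>j\<in>insert i A. x j) = (1 + (\<Sum>j\<in>A. x j)) + x i" using insert by simp
  also have "\<dots> \<le> (1 + x i) * (1 + (\<Sum>j\<in>A. x j))"
    using mult_nonneg_nonneg[of "x i" "\<Sum>j\<in>A. x j"] insert.prems by (simp add: algebra_simps sum_nonneg)
  also have "\<dots> \<le> (1 + x i) * (\<Prod>j\<in>A. 1 + x j)" using insert by (intro mult_left_mono) auto
  finally show ?case using insert by simp
qed simp

text \<open>Lets the weight 1 + |a| be distributed over the coordinates, so that decay of a product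
  reduces to decay of its factors.\<close>

lemma one_plus_norm_le_prod: "1 + norm (a::real^'d) \<le> (\<Prod>j\<in>UNIV. 1 + \<bar>a $ j\<bar>)"
  using norm_le_l1_cart[of a] one_plus_sum_le_prod[of UNIV "\<lambda>j. \<bar>a $ j\<bar>"] by simp

text \<open>Products suffice as smearing functions: decay, integrals and Fourier transforms reduce
  to one variable, and the factor in a single direction can be exchanged while the others stay
  fixed.\<close>

definition prod_fun :: "('d::finite \<Rightarrow> real \<Rightarrow> complex) \<Rightarrow> real^'d \<Rightarrow> complex" where
  "prod_fun \<phi> a = (\<Prod>j\<in>UNIV. \<phi> j (a $ j))"

lemma prod_fun_measurable:
  "(\<And>j. \<phi> j \<in> borel_measurable borel) \<Longrightarrow> prod_fun \<phi> \<in> borel_measurable borel"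
proof -
  assume "\<And>j. \<phi> j \<in> borel_measurable borel"
  then have [measurable]: "(\<lambda>a. \<phi> j (a $ j)) \<in> borel_measurable borel" for j
    by (rule measurable_compose[rotated]) measurable
  show ?thesis unfolding prod_fun_def[abs_def] by measurable
qed

lemma prod_fun_weight:
  "(1 + norm a) ^ N * cmod (prod_fun \<phi> a) \<le> (\<Prod>j\<in>UNIV. (1 + \<bar>a $ j\<bar>) ^ N * cmod (\<phi> j (a $ j)))"
proof -
  have "(1 + norm a) ^ N \<le> (\<Prod>j\<in>UNIV. 1 + \<bar>a $ j\<bar>) ^ N"
    by (intro power_mono one_plus_norm_le_prod) auto
  then show ?thesis
    unfolding prod_fun_def prod.distrib prod_power_distrib[symmetric] prod_norm[symmetric]
    by (intro mult_right_mono) (auto intro!: prod_nonneg)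
qed

lemma rapid_prod_fun:
  assumes meas: "\<And>j. \<phi> j \<in> borel_measurable borel"
    and int: "\<And>j N. integrable lborel (\<lambda>s. (1 + \<bar>s\<bar>) ^ N * cmod (\<phi> j s))"
  shows "rapid (prod_fun \<phi>)"
  unfolding rapid_def
proof (intro conjI allI)
  note [measurable] = prod_fun_measurable[OF meas]
  show "prod_fun \<phi> \<in> borel_measurable borel" by measurable
  fix N
  show "integrable lborel (\<lambda>a. (1 + norm a) ^ N * cmod (prod_fun \<phi> a))"
  proof (rule Bochner_Integration.integrable_bound)
    show "integrable lborel (\<lambda>a::real^'a. \<Prod>j\<in>UNIV. (1 + \<bar>a $ j\<bar>) ^ N * cmod (\<phi> j (a $ j)))"
      by (rule integrable_prod_vec[OF int])
    show "AE a in lborel. norm ((1 + norm a) ^ N * cmod (prod_fun \<phi> a)) \<le>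
        norm (\<Prod>j\<in>UNIV. (1 + \<bar>a $ j\<bar>) ^ N * cmod (\<phi> j (a $ j)))"
      using prod_fun_weight[of _ N \<phi>] by (intro AE_I2) (auto intro!: order_trans[OF _ abs_ge_self])
  qed measurable
qed

lemma rapid_prod_fun_schwartz1: "(\<And>j. schwartz1 (\<phi> j)) \<Longrightarrow> rapid (prod_fun \<phi>)"
  by (intro rapid_prod_fun schwartz1_measurable schwartz1_integrable)

lemma integral_prod_fun:
  assumes "\<And>j. schwartz1 (\<phi> j)"
  shows "(LINT a|lborel. prod_fun \<phi> a) = (\<Prod>j\<in>UNIV. fourier1 (\<phi> j) 0)"
  unfolding prod_fun_def fourier1_def using integral_prod_vec[of \<phi>] schwartz1_L1[OF assms] by simp

lemma prod_fun_linear: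
  assumes "\<And>s. u s = c * v s + d * w s"
  shows "prod_fun (\<phi>(b := u)) a = c * prod_fun (\<phi>(b := v)) a + d * prod_fun (\<phi>(b := w)) a"
proof -
  have *: "prod_fun (\<phi>(b := x)) a = x (a $ b) * (\<Prod>j\<in>UNIV - {b}. \<phi> j (a $ j))" for x
    unfolding prod_fun_def by (subst prod.remove[of _ b]) (auto intro!: prod.cong)
  show ?thesis unfolding * assms by (simp add: algebra_simps)
qed

text \<open>The same function in the encoding by lists, as required of the smearing functions that
  generate the spectral ideal.\<close>

definition prod_seq :: "('d::finite \<Rightarrow> real \<Rightarrow> complex) \<Rightarrow> 'd test_seq" where
  "prod_seq \<phi> xs = (if length xs = 1 then prod_fun \<phi> (hd xs) else 0)"

lemma prod_seq_1 [simp]: "prod_seq \<phi> [a] = prod_fun \<phi> a"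
  by (simp add: prod_seq_def)

lemma list_norm_singleton: "list_norm [a] = norm a"
  by (simp add: list_norm_def)

text \<open>A partial derivative replaces one factor by its derivative, so the products of Schwartz
  functions form a class closed under derivatives.\<close>

lemma schwartz_prod_seq:
  fixes \<phi> :: "'d::finite \<Rightarrow> real \<Rightarrow> complex"
  assumes "\<And>j. schwartz1 (\<phi> j)"
  shows "prod_seq \<phi> \<in> schwartz 1"
proof (rule schwartz_coinduct[where C = "prod_seq ` {\<phi>. \<forall>j. schwartz1 (\<phi> j)}"])
  fix h :: "'d test_seq" and N assume "h \<in> prod_seq ` {\<phi>. \<forall>j. schwartz1 (\<phi> j)}"
  then obtain \<phi> where h: "h = prod_seq \<phi>" and \<phi>: "\<And>j. schwartz1 (\<phi> j)" by auto
  have "\<exists>C. \<forall>s. (1 + \<bar>s\<bar>) ^ N * cmod (\<phi> j s) \<le> C" for j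
    using schwartz1_decay[OF \<phi>, of N j] by blast
  then obtain C where C: "\<And>j s. (1 + \<bar>s\<bar>) ^ N * cmod (\<phi> j s) \<le> C j" by metis
  have "(1 + list_norm xs) ^ N * cmod (h xs) \<le> (\<Prod>j\<in>UNIV. C j)" if "length xs = 1" for xs
  proof -
    obtain a where xs: "xs = [a]" using \<open>length xs = 1\<close> by (cases xs) auto
    have "(1 + norm a) ^ N * cmod (prod_fun \<phi> a) \<le> (\<Prod>j\<in>UNIV. (1 + \<bar>a $ j\<bar>) ^ N * cmod (\<phi> j (a $ j)))"
      by (rule prod_fun_weight)
    also have "\<dots> \<le> (\<Prod>j\<in>UNIV. C j)" by (intro prod_mono) (auto simp: C)
    finally show ?thesis by (simp add: h xs list_norm_singleton)
  qed
  then show "\<exists>B. \<forall>xs. length xs = 1 \<longrightarrow> (1 + list_norm xs) ^ N * cmod (h xs) \<le> B" by blast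
  have "continuous_on UNIV (\<lambda>x :: nat \<Rightarrow> 'd spacetime. \<phi> j (x 0 $ j))" for j
    by (rule continuous_on_compose2[OF schwartz1_continuous[OF \<phi>]])
       (auto intro!: continuous_intros continuous_on_product_coordinates)
  then show "continuous_on UNIV (\<lambda>x. h (map x [0..<1]))"
    unfolding h prod_seq_def prod_fun_def by (auto intro!: continuous_on_prod)
next
  fix h :: "'d test_seq" and i :: nat and b :: 'd
  assume "h \<in> prod_seq ` {\<phi>. \<forall>j. schwartz1 (\<phi> j)}" and i: "i < 1"
  then obtain \<phi> where h: "h = prod_seq \<phi>" and \<phi>: "\<And>j. schwartz1 (\<phi> j)" by auto
  obtain u' where u': "\<And>s. (\<phi> b has_vector_derivative u' s) (at s)" "schwartz1 u'"
    using schwartz1_deriv[OF \<phi>] by blast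
  have "((\<lambda>t. h (shift_coord (i, b) xs t)) has_vector_derivative prod_seq (\<phi>(b := u')) xs) (at 0)"
    if "length xs = 1" for xs
  proof -
    obtain a where xs: "xs = [a]" using \<open>length xs = 1\<close> by (cases xs) auto
    have 1: "prod_fun (\<phi>(b := u')) a = u' (a $ b) * (\<Prod>j\<in>UNIV - {b}. \<phi> j (a $ j))"
      unfolding prod_fun_def by (subst prod.remove[of _ b]) (auto intro!: prod.cong)
    have 2: "prod_fun \<phi> (a + t *\<^sub>R axis b 1) = \<phi> b (a $ b + t) * (\<Prod>j\<in>UNIV - {b}. \<phi> j (a $ j))" for t
      unfolding prod_fun_def by (subst prod.remove[of _ b]) (auto intro!: prod.cong simp: axis_def)
    have "((\<lambda>t. a $ b + t) has_vector_derivative 1) (at 0)" by (auto intro!: derivative_eq_intros)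
    from vector_diff_chain_at[OF this, of "\<phi> b" "u' (a $ b)"] u'(1)[of "a $ b"]
    have "((\<lambda>t. \<phi> b (a $ b + t)) has_vector_derivative u' (a $ b)) (at 0)" by (simp add: o_def)
    then show ?thesis
      using i by (auto simp: h xs shift_coord_def 1 2 intro!: has_vector_derivative_mult_left)
  qed
  then show "\<exists>g\<in>prod_seq ` {\<phi>. \<forall>j. schwartz1 (\<phi> j)}. \<forall>xs. length xs = 1 \<longrightarrow>
        ((\<lambda>t. h (shift_coord (i, b) xs t)) has_vector_derivative g xs) (at 0)"
    using \<phi> u'(2) by (intro bexI[of _ "prod_seq (\<phi>(b := u'))"]) auto
qed (use assms in \<open>auto simp: prod_seq_def\<close>)

section \<open>Fourier transforms of product functions for the Minkowski product, approximate
  identities\<close>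

definition mink_sign :: "'d::zero \<Rightarrow> real" where
  "mink_sign j = (if j = 0 then 1 else -1)"

lemma mink_eq_sum: "k \<cdot>\<^sub>M a = (\<Sum>j\<in>UNIV. mink_sign j * k $ j * a $ j)"
proof -
  have "(\<Sum>j\<in>UNIV. mink_sign j * k $ j * a $ j) = k $ 0 * a $ 0 + (\<Sum>j\<in>UNIV - {0}. mink_sign j * k $ j * a $ j)"
    by (subst sum.remove[of _ 0]) (auto simp: mink_sign_def)
  also have "(\<Sum>j\<in>UNIV - {0}. mink_sign j * k $ j * a $ j) = - (\<Sum>j\<in>UNIV - {0}. k $ j * a $ j)"
    unfolding sum_negf[symmetric] by (rule sum.cong) (auto simp: mink_sign_def)
  finally show ?thesis by (simp add: mink_def)
qed

lemma fourier_prod_seq: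
  assumes "\<And>j. schwartz1 (\<phi> j)"
  shows "fourier (prod_seq \<phi>) k = (\<Prod>j\<in>UNIV. fourier1 (\<phi> j) (mink_sign j * k $ j))"
proof -
  have "exp (\<i> * complex_of_real (k \<cdot>\<^sub>M a)) * prod_fun \<phi> a =
      (\<Prod>j\<in>UNIV. iexp (mink_sign j * k $ j * a $ j) * \<phi> j (a $ j))" for a
  proof -
    have "exp (\<i> * complex_of_real (k \<cdot>\<^sub>M a)) = (\<Prod>j\<in>UNIV. iexp (mink_sign j * k $ j * a $ j))"
      unfolding mink_eq_sum of_real_sum sum_distrib_left by (rule exp_sum) simp
    then show ?thesis by (simp add: prod_fun_def prod.distrib)
  qed
  then have "fourier (prod_seq \<phi>) k = (LINT a|lborel. (\<Prod>j\<in>UNIV. iexp (mink_sign j * k $ j * a $ j) * \<phi> j (a $ j)))"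
    by (simp add: fourier_def)
  also have "\<dots> = (\<Prod>j\<in>UNIV. fourier1 (\<phi> j) (mink_sign j * k $ j))"
    unfolding fourier1_def
    by (rule integral_prod_vec[of "\<lambda>j s. iexp (mink_sign j * k $ j * s) * \<phi> j s"])
       (rule fourier1_integrable[OF schwartz1_L1[OF assms]])
  finally show ?thesis .
qed

lemma integral_scaleR_vec:
  fixes f :: "real^'d \<Rightarrow> complex"
  assumes c: "c > 0" and f: "f \<in> borel_measurable borel"
  shows "(LINT a|lborel. f a) = complex_of_real c ^ CARD('d) * (LINT a|lborel. f (c *\<^sub>R a))"
proof -
  have "(LINT a|lborel. f a) = (LINT a|density (distr lborel borel (\<lambda>x. 0 + c *\<^sub>R x)) (\<lambda>_. \<bar>c\<bar> ^ DIM(real^'d)). f a)"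
    using lborel_affine[of c "0::real^'d"] c by simp
  also have "\<dots> = (LINT a|distr lborel borel (\<lambda>x. 0 + c *\<^sub>R x). (\<bar>c\<bar> ^ DIM(real^'d)) *\<^sub>R f a)"
    using f by (intro integral_density) auto
  also have "\<dots> = (LINT a|lborel. (\<bar>c\<bar> ^ DIM(real^'d)) *\<^sub>R f (0 + c *\<^sub>R a))"
    using f by (intro integral_distr) auto
  also have "\<dots> = complex_of_real c ^ CARD('d) * (LINT a|lborel. f (c *\<^sub>R a))"
    using c by (simp add: scaleR_conv_of_real)
  finally show ?thesis .
qed

text \<open>Rescaling the integration variable moves the parameter from the kernel into F, where
  continuity at 0 gives the pointwise limit. Polynomial growth of F is absorbed by the rapid decay
  of the fixed kernel.\<close>

lemma approximate_identity:
  fixes F :: "real^'d \<Rightarrow> complex"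
  assumes F: "continuous_on UNIV F" and bound: "\<And>a. cmod (F a) \<le> K * (1 + norm a) ^ N" and K: "K \<ge> 0"
    and u: "schwartz1 u" and u0: "fourier1 u 0 = 1"
  shows "(\<lambda>i. LINT a|lborel. F a * prod_fun (\<lambda>_ s. complex_of_real (real (Suc i)) * u (real (Suc i) * s)) a) \<longlonglongrightarrow> F 0"
proof -
  have Fm [measurable]: "F \<in> borel_measurable borel" by (rule borel_measurable_continuous_onI[OF F])
  have um [measurable]: "u \<in> borel_measurable borel" by (rule schwartz1_measurable[OF u])
  have pm [measurable]: "prod_fun (\<lambda>_::'d. u) \<in> borel_measurable borel" by (rule prod_fun_measurable) (rule um)
  have r: "rapid (prod_fun (\<lambda>_::'d. u))" by (rule rapid_prod_fun_schwartz1) (rule u)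
  have eq: "(LINT a|lborel. F a * prod_fun (\<lambda>_ s. complex_of_real c * u (c * s)) a) =
      (LINT a|lborel. F ((1 / c) *\<^sub>R a) * prod_fun (\<lambda>_. u) a)" if c: "c > 0" for c
  proof -
    have p: "prod_fun (\<lambda>_::'d. \<lambda>s. complex_of_real c * u (c * s)) a = complex_of_real c ^ CARD('d) * prod_fun (\<lambda>_. u) (c *\<^sub>R a)" for a
      by (simp add: prod_fun_def prod.distrib)
    have "(LINT a|lborel. F ((1 / c) *\<^sub>R a) * prod_fun (\<lambda>_. u) a) =
        complex_of_real c ^ CARD('d) * (LINT a|lborel. F ((1 / c) *\<^sub>R (c *\<^sub>R a)) * prod_fun (\<lambda>_. u) (c *\<^sub>R a))"
      by (rule integral_scaleR_vec[OF c]) measurable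
    also have "\<dots> = (LINT a|lborel. complex_of_real c ^ CARD('d) * (F a * prod_fun (\<lambda>_. u) (c *\<^sub>R a)))"
      using c by simp
    also have "\<dots> = (LINT a|lborel. F a * prod_fun (\<lambda>_ s. complex_of_real c * u (c * s)) a)"
      unfolding p by (intro Bochner_Integration.integral_cong) (auto simp: mult_ac)
    finally show ?thesis by simp
  qed
  have "(\<lambda>i. LINT a|lborel. F ((1 / real (Suc i)) *\<^sub>R a) * prod_fun (\<lambda>_. u) a) \<longlonglongrightarrow> (LINT a|lborel. F 0 * prod_fun (\<lambda>_::'d. u) a)"
  proof (rule integral_dominated_convergence[where w = "\<lambda>a::real^'d. K * ((1 + norm a) ^ N * cmod (prod_fun (\<lambda>_. u) a))"])
    show "AE a in lborel. (\<lambda>i. F ((1 / real (Suc i)) *\<^sub>R a) * prod_fun (\<lambda>_. u) a) \<longlonglongrightarrow> F 0 * prod_fun (\<lambda>_. u) a"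
    proof (rule AE_I2)
      fix a :: "real^'d"
      have "(\<lambda>i. (1 / real (Suc i)) *\<^sub>R a) \<longlonglongrightarrow> 0 *\<^sub>R a" by (intro tendsto_intros LIMSEQ_Suc[OF lim_1_over_n])
      then have "(\<lambda>i. (1 / real (Suc i)) *\<^sub>R a) \<longlonglongrightarrow> 0" by simp
      then have "(\<lambda>i. F ((1 / real (Suc i)) *\<^sub>R a)) \<longlonglongrightarrow> F 0"
        using F by (intro isCont_tendsto_compose[of 0 F]) (auto simp: continuous_on_eq_continuous_at)
      then show "(\<lambda>i. F ((1 / real (Suc i)) *\<^sub>R a) * prod_fun (\<lambda>_. u) a) \<longlonglongrightarrow> F 0 * prod_fun (\<lambda>_. u) a"
        by (intro tendsto_intros)
    qed
    show "AE a in lborel. norm (F ((1 / real (Suc i)) *\<^sub>R a) * prod_fun (\<lambda>_. u) a) \<le>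
        K * ((1 + norm a) ^ N * cmod (prod_fun (\<lambda>_. u) a))" for i
    proof (rule AE_I2)
      fix a :: "real^'d"
      have "norm ((1 / real (Suc i)) *\<^sub>R a) \<le> norm a"
        using mult_right_mono[of "1 / real (Suc i)" 1 "norm a"] by simp
      then have "K * (1 + norm ((1 / real (Suc i)) *\<^sub>R a)) ^ N \<le> K * (1 + norm a) ^ N"
        using K by (intro mult_left_mono power_mono) auto
      with bound[of "(1 / real (Suc i)) *\<^sub>R a"] have "cmod (F ((1 / real (Suc i)) *\<^sub>R a)) \<le> K * (1 + norm a) ^ N" by linarith
      then show "norm (F ((1 / real (Suc i)) *\<^sub>R a) * prod_fun (\<lambda>_. u) a) \<le>
          K * ((1 + norm a) ^ N * cmod (prod_fun (\<lambda>_. u) a))"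
        unfolding norm_mult mult.assoc[symmetric] by (rule mult_right_mono) simp
    qed
    show "integrable lborel (\<lambda>a. K * ((1 + norm a) ^ N * cmod (prod_fun (\<lambda>_::'d. u) a)))"
      using rapid_integrable[OF r] by simp
  qed measurable
  moreover have "(LINT a|lborel. F 0 * prod_fun (\<lambda>_::'d. u) a) = F 0"
    using integral_prod_fun[of "\<lambda>_::'d. u"] u u0 by simp
  ultimately show ?thesis by (simp only: eq of_nat_0_less_iff zero_less_Suc)
qed

subsection \<open>Iterated differences\<close>

text \<open>On the Fourier side this is multiplication by exp (i \<kappa>) - 1, which vanishes at 0;
  powers of the operator therefore detect polynomials.\<close>

definition diff_op :: "(real \<Rightarrow> complex) \<Rightarrow> real \<Rightarrow> complex" where
  "diff_op v s = v (s - 1) - v s"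

lemma schwartz1_diff_op: "schwartz1 v \<Longrightarrow> schwartz1 (diff_op v)"
  using schwartz1_linear_combination[OF schwartz1_shift[of v 1], of v 1 "-1"]
  by (simp add: diff_op_def[abs_def])

lemma schwartz1_diff_op_power: "schwartz1 v \<Longrightarrow> schwartz1 ((diff_op ^^ n) v)"
  by (induction n) (auto intro: schwartz1_diff_op)

text \<open>Each difference costs one derivative by the mean value inequality, and a factor 2^K
  because the weight 1 + |s| at most doubles over a unit step.\<close>

lemma diff_op_power_bound:
  assumes "\<And>n s. (V n has_vector_derivative V (Suc n) s) (at s)"
    and "\<And>s. (1 + \<bar>s\<bar>) ^ K * cmod (V N s) \<le> B"
  shows "(1 + \<bar>s\<bar>) ^ K * cmod ((diff_op ^^ N) (V 0) s) \<le> (2 ^ K) ^ N * B"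
  using assms
proof (induction N arbitrary: V B s)
  case (Suc N)
  let ?V = "\<lambda>n. diff_op (V n)"
  have "((\<lambda>s. V n (s - 1) - V n s) has_vector_derivative V (Suc n) (s - 1) - V (Suc n) s) (at s)" for n s
  proof -
    have "((\<lambda>s. s - 1) has_vector_derivative 1) (at s)" by (auto intro!: derivative_eq_intros)
    from vector_diff_chain_at[OF this Suc.prems(1)[of n "s - 1"]] show ?thesis
      by (auto simp: o_def intro!: has_vector_derivative_diff Suc.prems(1))
  qed
  then have V: "(?V n has_vector_derivative ?V (Suc n) s) (at s)" for n s by (simp add: diff_op_def[abs_def])
  have "(1 + \<bar>s\<bar>) ^ K * cmod (?V N s) \<le> 2 ^ K * B" for s
  proof -
    have w: "(1 + \<bar>s\<bar>) ^ K > 0" by (simp add: add_pos_nonneg)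
    have "cmod (V N (s - 1) - V N s) \<le> (2 ^ K * B / (1 + \<bar>s\<bar>) ^ K) * \<bar>(s - 1) - s\<bar>"
    proof (rule vector_derivative_bound[OF Suc.prems(1)])
      fix t assume "t \<in> closed_segment s (s - 1)"
      then have "1 + \<bar>s\<bar> \<le> 2 * (1 + \<bar>t\<bar>)" by (auto simp: closed_segment_eq_real_ivl)
      then have "(1 + \<bar>s\<bar>) ^ K * cmod (V (Suc N) t) \<le> (2 * (1 + \<bar>t\<bar>)) ^ K * cmod (V (Suc N) t)"
        by (intro mult_right_mono power_mono) auto
      also have "\<dots> = 2 ^ K * ((1 + \<bar>t\<bar>) ^ K * cmod (V (Suc N) t))"
        unfolding power_mult_distrib by simp
      also have "\<dots> \<le> 2 ^ K * B" by (intro mult_left_mono Suc.prems(2)) auto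
      finally show "cmod (V (Suc N) t) \<le> 2 ^ K * B / (1 + \<bar>s\<bar>) ^ K"
        using w by (simp add: field_simps)
    qed
    then show ?thesis using w by (simp add: diff_op_def field_simps)
  qed
  from Suc.IH[OF V this, of s] show ?case by (simp add: funpow_swap1 mult_ac)
qed simp

text \<open>The K-th derivative of the spread function gains \<Lambda>^(-K-1), while comparing the
  weight of order K at s and at s / \<Lambda> costs \<Lambda>^K. The remaining factor 1 / \<Lambda>
  makes the differences disappear in the limit.\<close>

lemma spread_diff_op_bound:
  assumes u: "schwartz1 u"
  obtains C where "\<And>\<Lambda> s. \<Lambda> \<ge> 1 \<Longrightarrow>
    (1 + \<bar>s\<bar>) ^ K * cmod ((diff_op ^^ K) (\<lambda>s. complex_of_real (1 / \<Lambda>) * u (1 / \<Lambda> * s)) s) \<le> C / \<Lambda>"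
proof -
  obtain U where U: "U 0 = u" "\<And>n s. (U n has_vector_derivative U (Suc n) s) (at s)" "\<And>n. schwartz1 (U n)"
    by (rule schwartz1E[OF u]) blast
  obtain C where C: "\<And>s. (1 + \<bar>s\<bar>) ^ K * cmod (U K s) \<le> C" by (rule schwartz1_decay[OF U(3), of K K]) blast
  show ?thesis
  proof (rule that)
    fix \<Lambda> s :: real assume \<Lambda>: "\<Lambda> \<ge> 1"
    define V where "V n s = complex_of_real ((1 / \<Lambda>) ^ Suc n) * U n (1 / \<Lambda> * s)" for n s
    have "(V n has_vector_derivative V (Suc n) s) (at s)" for n s
    proof -
      have "((\<lambda>s. 1 / \<Lambda> * s) has_vector_derivative 1 / \<Lambda>) (at s)" by (auto intro!: derivative_eq_intros)
      from vector_diff_chain_at[OF this U(2)[of n "1 / \<Lambda> * s"]]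
      have "((\<lambda>s. U n (1 / \<Lambda> * s)) has_vector_derivative (1 / \<Lambda>) *\<^sub>R U (Suc n) (1 / \<Lambda> * s)) (at s)" by (simp add: o_def)
      from has_vector_derivative_mult_right[OF this, of "complex_of_real ((1 / \<Lambda>) ^ Suc n)"]
      show ?thesis by (simp add: V_def[abs_def] scaleR_conv_of_real mult_ac)
    qed
    moreover have "(1 + \<bar>s\<bar>) ^ K * cmod (V K s) \<le> C / \<Lambda>" for s
    proof -
      have "1 + \<bar>s\<bar> \<le> \<Lambda> * (1 + \<bar>1 / \<Lambda> * s\<bar>)" using \<Lambda> by (simp add: abs_mult algebra_simps)
      then have "(1 + \<bar>s\<bar>) ^ K * cmod (U K (1 / \<Lambda> * s)) \<le> (\<Lambda> * (1 + \<bar>1 / \<Lambda> * s\<bar>)) ^ K * cmod (U K (1 / \<Lambda> * s))"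
        by (intro mult_right_mono power_mono) auto
      also have "\<dots> = \<Lambda> ^ K * ((1 + \<bar>1 / \<Lambda> * s\<bar>) ^ K * cmod (U K (1 / \<Lambda> * s)))"
        unfolding power_mult_distrib by (simp only: mult.assoc)
      also have "\<dots> \<le> \<Lambda> ^ K * C" using \<Lambda> by (intro mult_left_mono C) auto
      finally have "(1 / \<Lambda>) ^ Suc K * ((1 + \<bar>s\<bar>) ^ K * cmod (U K (1 / \<Lambda> * s))) \<le> (1 / \<Lambda>) ^ Suc K * (\<Lambda> ^ K * C)"
        using \<Lambda> by (intro mult_left_mono) auto
      also have "\<dots> = C / \<Lambda>" using \<Lambda> by (simp add: power_divide)
      also have "(1 / \<Lambda>) ^ Suc K * ((1 + \<bar>s\<bar>) ^ K * cmod (U K (1 / \<Lambda> * s))) = (1 + \<bar>s\<bar>) ^ K * cmod (V K s)"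
        using \<Lambda> unfolding V_def norm_mult norm_of_real by simp
      finally show ?thesis .
    qed
    ultimately have "(1 + \<bar>s\<bar>) ^ K * cmod ((diff_op ^^ K) (V 0) s) \<le> (2 ^ K) ^ K * (C / \<Lambda>)"
      by (rule diff_op_power_bound)
    then show "(1 + \<bar>s\<bar>) ^ K * cmod ((diff_op ^^ K) (\<lambda>s. complex_of_real (1 / \<Lambda>) * u (1 / \<Lambda> * s)) s) \<le> ((2 ^ K) ^ K * C) / \<Lambda>"
      by (simp add: V_def[abs_def] U(1))
  qed
qed

section \<open>The Borchers algebra\<close>

lemma component_borchers: "f \<in> borchers \<Longrightarrow> component n f \<in> schwartz n"
  by (simp add: borchers_def)

lemma borchersE:
  assumes "f \<in> borchers"
  obtains N where "\<And>xs. length xs > N \<Longrightarrow> f xs = 0"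
  using assms unfolding borchers_def by blast

lemma borchersI:
  "(\<And>n. component n f \<in> schwartz n) \<Longrightarrow> (\<And>xs. length xs > N \<Longrightarrow> f xs = 0) \<Longrightarrow> f \<in> borchers"
  by (auto simp: borchers_def)

lemma component_schwartz: "f \<in> schwartz n \<Longrightarrow> component k f = (if k = n then f else (\<lambda>_. 0))"
  by (auto simp: component_def fun_eq_iff schwartz_zero_length)

lemma schwartz_borchers: "f \<in> schwartz n \<Longrightarrow> f \<in> borchers"
  by (rule borchersI[where N = n]) (auto simp: component_schwartz schwartz_zero schwartz_zero_length)

lemma borchers_linear_combination:
  assumes "f \<in> borchers" "g \<in> borchers"
  shows "(\<lambda>xs. c * f xs + d * g xs) \<in> borchers"
proof -
  obtain M where M: "\<And>xs. length xs > M \<Longrightarrow> f xs = 0" by (rule borchersE[OF assms(1)]) blast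
  obtain N where N: "\<And>xs. length xs > N \<Longrightarrow> g xs = 0" by (rule borchersE[OF assms(2)]) blast
  show ?thesis
  proof (rule borchersI)
    have "component n (\<lambda>xs. c * f xs + d * g xs) = (\<lambda>xs. c * component n f xs + d * component n g xs)" for n
      by (auto simp: component_def)
    then show "component n (\<lambda>xs. c * f xs + d * g xs) \<in> schwartz n" for n
      using assms by (simp add: schwartz_linear_combination component_borchers)
    show "c * f xs + d * g xs = 0" if "length xs > max M N" for xs
      using that M N by simp
  qed
qed

lemma borchers_scale: "f \<in> borchers \<Longrightarrow> (\<lambda>xs. c * f xs) \<in> borchers"
  using borchers_linear_combination[of f f c 0] by simp

lemma borchers_zero: "(\<lambda>_. 0) \<in> borchers"
  using schwartz_borchers[OF schwartz_zero] .

lemma borchers_diff: "f \<in> borchers \<Longrightarrow> g \<in> borchers \<Longrightarrow> (\<lambda>xs. f xs - g xs) \<in> borchers"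
  using borchers_linear_combination[of f g 1 "-1"] by simp

text \<open>Splits off the component of highest degree. Temperedness is a statement about one n at a
  time, so results on whole sequences are assembled in this way.\<close>

lemma borchers_component_induct:
  assumes f: "f \<in> borchers"
    and schw: "\<And>n f. f \<in> schwartz n \<Longrightarrow> P f"
    and add: "\<And>f g. f \<in> borchers \<Longrightarrow> g \<in> borchers \<Longrightarrow> P f \<Longrightarrow> P g \<Longrightarrow> P (\<lambda>xs. f xs + g xs)"
  shows "P f"
proof -
  have "P f" if "f \<in> borchers" "\<And>xs. length xs > N \<Longrightarrow> f xs = 0" for N f
    using that
  proof (induction N arbitrary: f)
    case 0
    have "f = component 0 f" using 0(2) by (auto simp: component_def fun_eq_iff)
    then show ?case using schw component_borchers[OF 0(1)] by metis
  next
    case (Suc N)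
    define g where "g xs = f xs - component (Suc N) f xs" for xs
    have c: "component (Suc N) f \<in> borchers" by (rule schwartz_borchers[OF component_borchers[OF Suc.prems(1)]])
    have g: "g \<in> borchers" unfolding g_def[abs_def] by (rule borchers_diff[OF Suc.prems(1) c])
    have "P g"
    proof (rule Suc.IH[OF g])
      fix xs :: "'a spacetime list" assume "N < length xs"
      then show "g xs = 0" using Suc.prems(2)[of xs] by (auto simp: g_def component_def)
    qed
    moreover have "P (component (Suc N) f)" by (rule schw[OF component_borchers[OF Suc.prems(1)]])
    ultimately have "P (\<lambda>xs. g xs + component (Suc N) f xs)" by (rule add[OF g c])
    then show ?case by (simp add: g_def)
  qed
  moreover obtain N where "\<And>xs. length xs > N \<Longrightarrow> f xs = 0" by (rule borchersE[OF f]) blast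
  ultimately show ?thesis using f by blast
qed

lemma borchers_star:
  assumes "f \<in> borchers"
  shows "star f \<in> borchers"
proof -
  obtain N where N: "\<And>xs. length xs > N \<Longrightarrow> f xs = 0" by (rule borchersE[OF assms]) blast
  have "component n (star f) = star (component n f)" for n
    by (auto simp: component_def star_def)
  then show ?thesis
    using assms N by (intro borchersI[where N = N]) (auto simp: schwartz_star component_borchers, simp add: star_def)
qed

lemma borchers_translate:
  assumes "f \<in> borchers"
  shows "translate a f \<in> borchers"
proof -
  obtain N where N: "\<And>xs. length xs > N \<Longrightarrow> f xs = 0" by (rule borchersE[OF assms]) blast
  have "component n (translate a f) = translate a (component n f)" for n
    by (auto simp: component_def translate_def)
  then show ?thesis
    using assms N by (intro borchersI[where N = N]) (auto simp: schwartz_translate component_borchers, simp add: translate_def)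
qed

lemma schwartz_sum: "finite A \<Longrightarrow> (\<And>i. i \<in> A \<Longrightarrow> f i \<in> schwartz n) \<Longrightarrow> (\<lambda>xs. \<Sum>i\<in>A. f i xs) \<in> schwartz n"
  by (induction A rule: finite_induct) (auto simp: schwartz_zero schwartz_add)

lemma borchers_tensor:
  assumes "f \<in> borchers" "g \<in> borchers"
  shows "f \<otimes>\<^sub>B g \<in> borchers"
proof -
  obtain M where M: "\<And>xs. length xs > M \<Longrightarrow> f xs = 0" by (rule borchersE[OF assms(1)]) blast
  obtain N where N: "\<And>xs. length xs > N \<Longrightarrow> g xs = 0" by (rule borchersE[OF assms(2)]) blast
  show ?thesis
  proof (rule borchersI)
    fix n
    have "component n (f \<otimes>\<^sub>B g) = (\<lambda>xs. \<Sum>j\<in>{..n}. (component j f \<otimes>\<^sub>B component (n - j) g) xs)"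
    proof
      fix xs
      show "component n (f \<otimes>\<^sub>B g) xs = (\<Sum>j\<in>{..n}. (component j f \<otimes>\<^sub>B component (n - j) g) xs)"
        unfolding tensor_schwartz_eq[OF component_borchers[OF assms(1)] component_borchers[OF assms(2)]]
        by (auto simp: component_def tensor_def intro!: sum.cong)
    qed
    moreover have "component j f \<otimes>\<^sub>B component (n - j) g \<in> schwartz n" if "j \<in> {..n}" for j
      using schwartz_tensor[OF component_borchers[OF assms(1), of j] component_borchers[OF assms(2), of "n - j"]] that by simp
    ultimately show "component n (f \<otimes>\<^sub>B g) \<in> schwartz n" by (simp only: schwartz_sum finite_atMost)
  next
    fix xs :: "'a spacetime list" assume len: "length xs > M + N"
    have "f (take j xs) * g (drop j xs) = 0" if "j \<le> length xs" for j
    proof (cases "j > M")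
      case True
      then show ?thesis using M[of "take j xs"] that by simp
    next
      case False
      then show ?thesis using N[of "drop j xs"] len by simp
    qed
    then show "(f \<otimes>\<^sub>B g) xs = 0" unfolding tensor_def by (intro sum.neutral) auto
  qed
qed

lemma borchers_unit: "unit_seq \<in> borchers"
proof (rule schwartz_borchers)
  show "unit_seq \<in> schwartz 0"
    by (rule schwartz_coinduct[where C = "{unit_seq}"]) (auto simp: unit_seq_def)
qed

text \<open>Both sides sum over all ways of cutting a list into three consecutive pieces,
  parametrized by the lengths i and k of the first two.\<close>

lemma tensor_assoc: "(f \<otimes>\<^sub>B g) \<otimes>\<^sub>B h = f \<otimes>\<^sub>B (g \<otimes>\<^sub>B h)"
proof
  fix xs :: "'a spacetime list"
  let ?n = "length xs"
  define t where "t i k = f (take i xs) * g (take k (drop i xs)) * h (drop (i + k) xs)" for i k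
  have "((f \<otimes>\<^sub>B g) \<otimes>\<^sub>B h) xs = (\<Sum>j\<le>?n. \<Sum>i\<le>j. t i (j - i))"
    unfolding tensor_def t_def
    by (intro sum.cong refl) (auto simp: sum_distrib_right min_def drop_take intro!: sum.cong)
  also have "\<dots> = (\<Sum>(i, k)\<in>{(i, k). i + k \<le> ?n}. t i k)"
    by (rule sum.triangle_reindex_eq[symmetric])
  also have "{(i, k). i + k \<le> ?n} = Sigma {..?n} (\<lambda>i. {..?n - i})" by auto
  also have "(\<Sum>(i, k)\<in>Sigma {..?n} (\<lambda>i. {..?n - i}). t i k) = (\<Sum>i\<le>?n. \<Sum>k\<le>?n - i. t i k)"
    by (rule sum.Sigma[symmetric]) auto
  also have "\<dots> = (f \<otimes>\<^sub>B (g \<otimes>\<^sub>B h)) xs"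
    unfolding tensor_def t_def by (simp add: sum_distrib_left mult.assoc add.commute)
  finally show "((f \<otimes>\<^sub>B g) \<otimes>\<^sub>B h) xs = (f \<otimes>\<^sub>B (g \<otimes>\<^sub>B h)) xs" .
qed

lemma star_tensor: "star (f \<otimes>\<^sub>B g) = star g \<otimes>\<^sub>B star f"
proof
  fix xs :: "'a spacetime list"
  let ?n = "length xs"
  have "star (f \<otimes>\<^sub>B g) xs = (\<Sum>j\<le>?n. cnj (f (rev (drop (?n - j) xs))) * cnj (g (rev (take (?n - j) xs))))"
    by (simp add: star_def tensor_def take_rev drop_rev)
  also have "\<dots> = (\<Sum>j\<le>?n. cnj (f (rev (drop j xs))) * cnj (g (rev (take j xs))))"
    by (rule sum.reindex_bij_witness[of _ "\<lambda>j. ?n - j" "\<lambda>j. ?n - j"]) auto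
  also have "\<dots> = (star g \<otimes>\<^sub>B star f) xs" by (simp add: star_def tensor_def mult.commute)
  finally show "star (f \<otimes>\<^sub>B g) xs = (star g \<otimes>\<^sub>B star f) xs" .
qed

lemma star_star [simp]: "star (star f) = f"
  by (simp add: star_def)

lemma tensor_unit_right [simp]: "f \<otimes>\<^sub>B unit_seq = f"
proof
  fix xs :: "'a spacetime list"
  have "(f \<otimes>\<^sub>B unit_seq) xs = (\<Sum>j\<le>length xs. if j = length xs then f xs else 0)"
    unfolding tensor_def by (rule sum.cong) (auto simp: unit_seq_def)
  then show "(f \<otimes>\<^sub>B unit_seq) xs = f xs" by simp
qed

lemma tensor_unit_left [simp]: "unit_seq \<otimes>\<^sub>B f = f"
proof
  fix xs :: "'a spacetime list"
  have "(unit_seq \<otimes>\<^sub>B f) xs = (\<Sum>j\<le>length xs. if j = 0 then f xs else 0)"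
    unfolding tensor_def by (rule sum.cong) (auto simp: unit_seq_def)
  then show "(unit_seq \<otimes>\<^sub>B f) xs = f xs" by simp
qed

lemma star_unit [simp]: "star unit_seq = unit_seq"
  by (auto simp: star_def unit_seq_def)

subsection \<open>Bounds by Schwartz seminorms\<close>

text \<open>The hypothesis of the estimate in \<open>tempered\<close>. An upper bound B instead of
  the supremum makes sums, multiples and changes of N and l immediate.\<close>

definition derivs_bounded :: "nat \<Rightarrow> nat \<Rightarrow> nat \<Rightarrow> 'd::finite test_seq \<Rightarrow> real \<Rightarrow> bool" where
  "derivs_bounded n N l g B \<longleftrightarrow> (\<forall>\<alpha>\<in>multi_indices n. length \<alpha> \<le> l \<longrightarrow>
     (\<forall>xs. length xs = n \<longrightarrow> (1 + list_norm xs) ^ N * cmod (partials \<alpha> g xs) \<le> B))"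

lemma derivs_boundedD:
  "derivs_bounded n N l g B \<Longrightarrow> \<alpha> \<in> multi_indices n \<Longrightarrow> length \<alpha> \<le> l \<Longrightarrow> length xs = n \<Longrightarrow>
     (1 + list_norm xs) ^ N * cmod (partials \<alpha> g xs) \<le> B"
  by (simp add: derivs_bounded_def)

lemma derivs_bounded_nonneg:
  assumes "derivs_bounded n N l (g :: 'd::finite test_seq) B"
  shows "B \<ge> 0"
proof -
  have "(1 + list_norm (replicate n (0::'d spacetime))) ^ N * cmod (partials [] g (replicate n 0)) \<le> B"
    by (rule derivs_boundedD[OF assms]) auto
  then show ?thesis by (rule order_trans[rotated]) simp
qed

lemma derivs_bounded_mono:
  assumes "derivs_bounded n N l g B" "N' \<le> N" "l' \<le> l" "B \<le> B'"
  shows "derivs_bounded n N' l' g B'"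
  unfolding derivs_bounded_def
proof (intro ballI impI allI)
  fix \<alpha> :: "(nat \<times> 'a) list" and xs :: "'a spacetime list"
  assume *: "\<alpha> \<in> multi_indices n" "length \<alpha> \<le> l'" "length xs = n"
  have "(1 + list_norm xs) ^ N' * cmod (partials \<alpha> g xs) \<le> (1 + list_norm xs) ^ N * cmod (partials \<alpha> g xs)"
    using assms(2) by (intro mult_right_mono power_increasing) auto
  also have "\<dots> \<le> B" using * assms(3) by (intro derivs_boundedD[OF assms(1)]) auto
  also note assms(4)
  finally show "(1 + list_norm xs) ^ N' * cmod (partials \<alpha> g xs) \<le> B'" .
qed

lemma derivs_bounded_scale:
  assumes "g \<in> schwartz n" "derivs_bounded n N l g B"
  shows "derivs_bounded n N l (\<lambda>xs. c * g xs) (cmod c * B)"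
  unfolding derivs_bounded_def
proof (intro ballI impI allI)
  fix \<alpha> :: "(nat \<times> 'a) list" and xs :: "'a spacetime list"
  assume *: "\<alpha> \<in> multi_indices n" "length \<alpha> \<le> l" "length xs = n"
  have "partials \<alpha> (\<lambda>xs. c * g xs) xs = c * partials \<alpha> g xs"
    using partials_linear_combination[OF assms(1) assms(1) *(1), of c 0] by simp
  then show "(1 + list_norm xs) ^ N * cmod (partials \<alpha> (\<lambda>xs. c * g xs) xs) \<le> cmod c * B"
    using mult_left_mono[OF derivs_boundedD[OF assms(2) *], of "cmod c"] by (simp add: norm_mult mult_ac)
qed

lemma schwartz_seminorm_upper:
  assumes f: "f \<in> schwartz n"
  shows "derivs_bounded n N l f (schwartz_seminorm n N l f)"
  unfolding derivs_bounded_def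
proof (intro ballI impI allI)
  fix \<alpha> :: "(nat \<times> 'a) list" and xs :: "'a spacetime list"
  assume *: "\<alpha> \<in> multi_indices n" "length \<alpha> \<le> l" "length xs = n"
  obtain B where "\<And>\<alpha> xs. \<alpha> \<in> multi_indices n \<Longrightarrow> length \<alpha> \<le> l \<Longrightarrow>
    (1 + list_norm xs) ^ N * cmod (partials \<alpha> f xs) \<le> B"
    by (rule schwartz_uniform_decay[OF f, of l N]) blast
  then have "bdd_above ((\<lambda>(\<alpha>, xs). (1 + list_norm xs) ^ N * cmod (partials \<alpha> f xs)) `
      ({\<alpha> \<in> multi_indices n. length \<alpha> \<le> l} \<times> {xs. length xs = n}))"
    by (intro bdd_aboveI[where M = B]) auto
  then show "(1 + list_norm xs) ^ N * cmod (partials \<alpha> f xs) \<le> schwartz_seminorm n N l f"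
    unfolding schwartz_seminorm_def
    by (rule cSUP_upper2[where x = "(\<alpha>, xs)"]) (use * in auto)
qed

lemma schwartz_seminorm_least:
  assumes "derivs_bounded n N l (f :: 'd::finite test_seq) B"
  shows "schwartz_seminorm n N l f \<le> B"
  unfolding schwartz_seminorm_def
proof (rule cSUP_least)
  have "([], replicate n 0) \<in> {\<alpha> \<in> multi_indices n. length \<alpha> \<le> l} \<times> {xs :: 'd spacetime list. length xs = n}" by simp
  then show "{\<alpha> \<in> multi_indices n. length \<alpha> \<le> l} \<times> {xs :: 'd spacetime list. length xs = n} \<noteq> {}" by blast
qed (use derivs_boundedD[OF assms] in auto)

lemma derivs_bounded_add:
  assumes "g \<in> schwartz n" "h \<in> schwartz n" "derivs_bounded n N l g B" "derivs_bounded n N l h B'"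
  shows "derivs_bounded n N l (\<lambda>xs. g xs + h xs) (B + B')"
  unfolding derivs_bounded_def
proof (intro ballI impI allI)
  fix \<alpha> :: "(nat \<times> 'a) list" and xs :: "'a spacetime list"
  assume *: "\<alpha> \<in> multi_indices n" "length \<alpha> \<le> l" "length xs = n"
  have "partials \<alpha> (\<lambda>xs. g xs + h xs) xs = partials \<alpha> g xs + partials \<alpha> h xs"
    using partials_linear_combination[OF assms(1,2) *(1), of 1 1] by simp
  then have "(1 + list_norm xs) ^ N * cmod (partials \<alpha> (\<lambda>xs. g xs + h xs) xs) \<le>
      (1 + list_norm xs) ^ N * (cmod (partials \<alpha> g xs) + cmod (partials \<alpha> h xs))"
    by (simp add: mult_left_mono norm_triangle_ineq)
  then show "(1 + list_norm xs) ^ N * cmod (partials \<alpha> (\<lambda>xs. g xs + h xs) xs) \<le> B + B'"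
    using derivs_boundedD[OF assms(3) *] derivs_boundedD[OF assms(4) *] by (simp add: distrib_left)
qed

text \<open>Since the topology is given by a subbase with arbitrary centres, induction over the
  generation of open sets is needed to find a single seminorm ball around 0 in each neighbourhood of
  0. Finite intersections are handled by enlarging N and l.\<close>

lemma schwartz_neighbourhood:
  assumes "generate_topology_on {{g \<in> schwartz n. schwartz_seminorm n N l (\<lambda>xs. g xs - f xs) < r} | f N l r.
        f \<in> schwartz n \<and> r > 0} U" "(\<lambda>_. 0) \<in> U"
  shows "\<exists>N l. \<exists>r>0. \<forall>g\<in>schwartz n. derivs_bounded n N l g r \<longrightarrow> g \<in> (U :: 'd::finite test_seq set)"
  using assms
proof (induction rule: generate_topology_on.induct)
  case Empty
  then show ?case by simp
next
  case (Int a b)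
  then have z: "(\<lambda>_. 0) \<in> a" "(\<lambda>_. 0) \<in> b" by auto
  from Int.IH(1)[OF z(1)] obtain N l r where
    a: "r > 0" "\<And>g. g \<in> schwartz n \<Longrightarrow> derivs_bounded n N l g r \<Longrightarrow> g \<in> a" by blast
  from Int.IH(2)[OF z(2)] obtain N' l' r' where
    b: "r' > 0" "\<And>g. g \<in> schwartz n \<Longrightarrow> derivs_bounded n N' l' g r' \<Longrightarrow> g \<in> b" by blast
  show ?case
  proof (rule exI[of _ "max N N'"], rule exI[of _ "max l l'"], rule exI[of _ "min r r'"], intro conjI ballI impI)
    fix g :: "'d test_seq" assume g: "g \<in> schwartz n" "derivs_bounded n (max N N') (max l l') g (min r r')"
    show "g \<in> a \<inter> b"
      using a(2)[OF g(1) derivs_bounded_mono[OF g(2)]] b(2)[OF g(1) derivs_bounded_mono[OF g(2)]] by auto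
  qed (use a b in auto)
next
  case (UN K)
  then obtain k where k: "k \<in> K" "(\<lambda>_. 0) \<in> k" by auto
  from UN.IH[OF k] k(1) show ?case by (meson UnionI)
next
  case (Basis s)
  then obtain f N l r where s: "s = {g \<in> schwartz n. schwartz_seminorm n N l (\<lambda>xs. g xs - f xs) < r}"
    and f: "f \<in> schwartz n" and r: "r > 0" by auto
  define m where "m xs = - f xs" for xs
  have m: "m \<in> schwartz n" using schwartz_scale[OF f, of "-1"] by (simp add: m_def[abs_def])
  \<comment> \<open>Half of the positive gap: the triangle inequality only yields a non-strict bound
    on the supremum, whereas membership in s is strict.\<close>
  define \<delta> where "\<delta> = (r - schwartz_seminorm n N l m) / 2"
  have \<delta>: "\<delta> > 0" using Basis.prems by (simp add: s \<delta>_def m_def[abs_def])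
  show ?case
  proof (rule exI[of _ N], rule exI[of _ l], rule exI[of _ \<delta>], intro conjI ballI impI)
    fix g :: "'d test_seq" assume g: "g \<in> schwartz n" "derivs_bounded n N l g \<delta>"
    have "schwartz_seminorm n N l (\<lambda>xs. g xs + m xs) \<le> \<delta> + schwartz_seminorm n N l m"
      by (rule schwartz_seminorm_least[OF derivs_bounded_add[OF g(1) m g(2) schwartz_seminorm_upper[OF m]]])
    also have "\<dots> < r" using \<delta> by (simp add: \<delta>_def field_simps)
    finally show "g \<in> s" using g by (simp add: s m_def)
  qed (rule \<delta>)
qed

section \<open>Seminorms and neighbourhoods of 0 on the direct sum\<close>

lemma seminorm_borchers_add:
  "seminorm_on_borchers q \<Longrightarrow> f \<in> borchers \<Longrightarrow> g \<in> borchers \<Longrightarrow> q (\<lambda>xs. f xs + g xs) \<le> q f + q g"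
  by (simp add: seminorm_on_borchers_def)

lemma seminorm_borchers_scale:
  "seminorm_on_borchers q \<Longrightarrow> f \<in> borchers \<Longrightarrow> q (\<lambda>xs. c * f xs) = cmod c * q f"
  by (simp add: seminorm_on_borchers_def)

lemma seminorm_borchers_zero: "seminorm_on_borchers q \<Longrightarrow> q (\<lambda>_. 0) = 0"
  using seminorm_borchers_scale[OF _ borchers_zero, of q 0] by simp

lemma seminorm_borchers_nonneg:
  assumes q: "seminorm_on_borchers q" and f: "f \<in> borchers"
  shows "0 \<le> q f"
  using seminorm_borchers_add[OF q f borchers_scale[OF f, of "-1"]]
    seminorm_borchers_scale[OF q f, of "-1"] seminorm_borchers_zero[OF q] by simp

text \<open>The same induction as for a single summand. Finite intersections are now handled by
  adding the two seminorms, whose restrictions to the summands stay continuous.\<close>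

lemma borchers_neighbourhood:
  assumes "generate_topology_on {{g \<in> borchers. q (\<lambda>xs. g xs - f xs) < r} | f q r.
        f \<in> borchers \<and> r > 0 \<and> seminorm_on_borchers q \<and>
        (\<forall>n. continuous_map (schwartz_topology n) euclideanreal q)} U" "(\<lambda>_. 0) \<in> U"
  shows "\<exists>q. \<exists>r>0. seminorm_on_borchers q \<and> (\<forall>n. continuous_map (schwartz_topology n) euclideanreal q) \<and>
    {g \<in> borchers. q g < r} \<subseteq> (U :: 'd::finite test_seq set)"
  using assms
proof (induction rule: generate_topology_on.induct)
  case Empty
  then show ?case by simp
next
  case (Int a b)
  then have z: "(\<lambda>_. 0) \<in> a" "(\<lambda>_. 0) \<in> b" by auto
  from Int.IH(1)[OF z(1)] obtain q r where
    a: "r > 0" "seminorm_on_borchers q" "\<And>n. continuous_map (schwartz_topology n) euclideanreal q" "{g \<in> borchers. q g < r} \<subseteq> a" by blast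
  from Int.IH(2)[OF z(2)] obtain q' r' where
    b: "r' > 0" "seminorm_on_borchers q'" "\<And>n. continuous_map (schwartz_topology n) euclideanreal q'" "{g \<in> borchers. q' g < r'} \<subseteq> b" by blast
  show ?case
  proof (intro exI[of _ "\<lambda>f. q f + q' f"] exI[of _ "min r r'"] conjI allI)
    show "seminorm_on_borchers (\<lambda>f. q f + q' f)"
      unfolding seminorm_on_borchers_def
    proof (intro conjI ballI allI)
      fix f g :: "'d test_seq" assume fg: "f \<in> borchers" "g \<in> borchers"
      show "q (\<lambda>xs. f xs + g xs) + q' (\<lambda>xs. f xs + g xs) \<le> (q f + q' f) + (q g + q' g)"
        using seminorm_borchers_add[OF a(2) fg] seminorm_borchers_add[OF b(2) fg] by simp
    qed (simp add: seminorm_borchers_scale[OF a(2)] seminorm_borchers_scale[OF b(2)] distrib_left)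
    show "continuous_map (schwartz_topology n) euclideanreal (\<lambda>f. q f + q' f)" for n
      by (intro continuous_map_add a b)
    show "{g \<in> borchers. q g + q' g < min r r'} \<subseteq> a \<inter> b"
    proof
      fix g :: "'d test_seq" assume "g \<in> {g \<in> borchers. q g + q' g < min r r'}"
      moreover from this have "0 \<le> q g" "0 \<le> q' g"
        using seminorm_borchers_nonneg[OF a(2)] seminorm_borchers_nonneg[OF b(2)] by auto
      ultimately show "g \<in> a \<inter> b" using a(4) b(4) by auto
    qed
  qed (use a b in auto)
next
  case (UN K)
  then obtain k where k: "k \<in> K" "(\<lambda>_. 0) \<in> k" by auto
  from UN.IH[OF k] k(1) show ?case by (meson Union_upper order_trans)
next
  case (Basis s)
  then obtain f q r where s: "s = {g \<in> borchers. q (\<lambda>xs. g xs - f xs) < r}" and f: "f \<in> borchers"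
    and q: "seminorm_on_borchers q" "\<forall>n. continuous_map (schwartz_topology n) euclideanreal q" by blast
  define m where "m xs = - f xs" for xs
  have m: "m \<in> borchers" using borchers_scale[OF f, of "-1"] by (simp add: m_def[abs_def])
  show ?case
  proof (intro exI[of _ q] exI[of _ "r - q m"] conjI q subsetI)
    show "0 < r - q m" using Basis.prems by (simp add: s m_def[abs_def])
    fix g :: "'d test_seq" assume g: "g \<in> {g \<in> borchers. q g < r - q m}"
    then have "q (\<lambda>xs. g xs + m xs) \<le> q g + q m" using q(1) m by (intro seminorm_borchers_add) auto
    then show "g \<in> s" using g by (simp add: s m_def)
  qed
qed

lemma hilbert_seminorm_scale:
  assumes p: "hilbert_seminorm p" and f: "f \<in> borchers"
  shows "p (\<lambda>xs. c * f xs) = cmod c * p f" and "0 \<le> p f"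
proof -
  from p obtain B :: "'a test_seq \<Rightarrow> 'a test_seq \<Rightarrow> complex" where B: "\<And>f. f \<in> borchers \<Longrightarrow> linear_on_borchers (B f)"
    "\<And>f. f \<in> borchers \<Longrightarrow> linear_on_borchers (\<lambda>g. cnj (B g f))"
    "\<And>f. f \<in> borchers \<Longrightarrow> 0 \<le> Re (B f f)" "\<And>f. f \<in> borchers \<Longrightarrow> p f = sqrt (Re (B f f))"
    unfolding hilbert_seminorm_def by blast
  let ?g = "\<lambda>xs. c * f xs"
  have g: "?g \<in> borchers" by (rule borchers_scale[OF f])
  have "B ?g ?g = c * B ?g f"
    using B(1)[OF g] f by (simp add: linear_on_borchers_def scaleC_complex_def)
  moreover have "cnj (B ?g f) = c * cnj (B f f)"
    using B(2)[OF f] f by (simp add: linear_on_borchers_def scaleC_complex_def)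
  then have "B ?g f = cnj c * B f f" by (metis complex_cnj_cnj complex_cnj_mult)
  ultimately have "B ?g ?g = complex_of_real ((cmod c)\<^sup>2) * B f f" by (simp only: complex_norm_square mult.assoc)
  then have "Re (B ?g ?g) = (cmod c)\<^sup>2 * Re (B f f)" by simp
  then show "p ?g = cmod c * p f" by (simp add: B(4)[OF g] B(4)[OF f] real_sqrt_mult)
  show "0 \<le> p f" using B(3)[OF f] by (simp add: B(4)[OF f])
qed

text \<open>Continuity of p at 0 gives a ball of some admissible seminorm q inside {p < 1}.
  Continuity of q on the n-th summand gives a Schwartz ball inside that one, and homogeneity of p
  turns the inclusion into a linear bound.\<close>

lemma sobolev_dominated_bound:
  fixes p :: "'d::finite test_seq \<Rightarrow> real"
  assumes dom: "sobolev_dominated p" and p: "hilbert_seminorm p"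
  obtains C N l where "C \<ge> 0" "\<And>g B. g \<in> schwartz n \<Longrightarrow> derivs_bounded n N l g B \<Longrightarrow> p g \<le> C * B"
proof -
  have z: "p (\<lambda>_. 0) = 0" using hilbert_seminorm_scale(1)[OF p borchers_zero, of 0] by simp
  let ?zero = "(\<lambda>_. 0) :: 'd test_seq"
  have top: "topspace borchers_topology = (borchers :: 'd test_seq set)"
  proof
    show "borchers \<subseteq> topspace (borchers_topology :: 'd test_seq topology)"
    proof
      fix f :: "'d test_seq" assume f: "f \<in> borchers"
      have "{g \<in> borchers. (\<lambda>_. 0) (\<lambda>xs. g xs - f xs) < (1::real)} \<subseteq> topspace (borchers_topology :: 'd test_seq topology)"
        unfolding borchers_topology_def topology_generated_by_topspace
        by (rule Union_upper, rule CollectI, rule exI[of _ f], rule exI[of _ "\<lambda>_. 0"], rule exI[of _ 1])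
           (use f in \<open>auto simp: seminorm_on_borchers_def\<close>)
      with f show "f \<in> topspace borchers_topology" by auto
    qed
  qed (auto simp: borchers_topology_def)
  have topS: "topspace (schwartz_topology n) = (schwartz n :: 'd test_seq set)"
  proof
    show "schwartz n \<subseteq> topspace (schwartz_topology n :: 'd test_seq topology)"
    proof
      fix f :: "'d test_seq" assume f: "f \<in> schwartz n"
      have "schwartz_seminorm n 0 0 ?zero \<le> 0"
        using derivs_bounded_scale[OF schwartz_zero schwartz_seminorm_upper[OF schwartz_zero], of n 0 0 0]
        by (intro schwartz_seminorm_least) simp
      then have "f \<in> {g \<in> schwartz n. schwartz_seminorm n 0 0 (\<lambda>xs. g xs - f xs) < 1}" using f by simp
      moreover have "\<dots> \<subseteq> topspace (schwartz_topology n :: 'd test_seq topology)"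
        unfolding schwartz_topology_def topology_generated_by_topspace
        by (rule Union_upper, rule CollectI, rule exI[of _ f], rule exI[of _ 0], rule exI[of _ 0], rule exI[of _ 1])
           (use f in auto)
      ultimately show "f \<in> topspace (schwartz_topology n)" by blast
    qed
  qed (auto simp: schwartz_topology_def)
  have "openin borchers_topology {f \<in> topspace borchers_topology. p f \<in> {..<1}}"
    using dom unfolding sobolev_dominated_def by (rule openin_continuous_map_preimage) simp
  then have "generate_topology_on {{g \<in> borchers. q (\<lambda>xs. g xs - f xs) < r} | f q r.
        f \<in> borchers \<and> r > 0 \<and> seminorm_on_borchers q \<and>
        (\<forall>n. continuous_map (schwartz_topology n) euclideanreal q)} {f \<in> (borchers :: 'd test_seq set). p f < 1}"
    unfolding top unfolding borchers_topology_def openin_topology_generated_by_iff by simp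
  moreover have "?zero \<in> {f \<in> borchers. p f < 1}" using borchers_zero z by simp
  ultimately obtain q r where q: "r > 0" "seminorm_on_borchers q"
    "\<And>n. continuous_map (schwartz_topology n) euclideanreal q" "{g \<in> borchers. q g < r} \<subseteq> {f \<in> borchers. p f < 1}"
    using borchers_neighbourhood by blast
  have "openin (schwartz_topology n) {f \<in> topspace (schwartz_topology n). q f \<in> {..<r}}"
    using q(3) by (rule openin_continuous_map_preimage) simp
  then have "generate_topology_on {{g \<in> schwartz n. schwartz_seminorm n N l (\<lambda>xs. g xs - f xs) < r} | f N l r.
        f \<in> schwartz n \<and> r > 0} {f \<in> (schwartz n :: 'd test_seq set). q f < r}"
    unfolding topS unfolding schwartz_topology_def openin_topology_generated_by_iff by simp
  moreover have "?zero \<in> {f \<in> schwartz n. q f < r}"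
    using schwartz_zero q(1) seminorm_borchers_zero[OF q(2)] by simp
  ultimately have "\<exists>N l. \<exists>r'>0. \<forall>g\<in>schwartz n. derivs_bounded n N l g r' \<longrightarrow> g \<in> {f \<in> schwartz n. q f < r}"
    by (rule schwartz_neighbourhood)
  then obtain N l r' where r': "r' > 0"
    "\<And>g. g \<in> schwartz n \<Longrightarrow> derivs_bounded n N l g r' \<Longrightarrow> q g < r" by blast
  have small: "p g < 1" if "g \<in> schwartz n" "derivs_bounded n N l g r'" for g
    using r'(2)[OF that] q(4) schwartz_borchers[OF that(1)] by blast
  show ?thesis
  proof (rule that[of "1 / r'" N l])
    show "1 / r' \<ge> 0" using r'(1) by simp
    fix g :: "'d test_seq" and B assume g: "g \<in> schwartz n" and B: "derivs_bounded n N l g B"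
    \<comment> \<open>The bound B may be 0, so g is rescaled by means of B + \<delta> and \<delta>
      is removed at the end.\<close>
    have le: "p g \<le> (B + \<delta>) / r'" if \<delta>: "\<delta> > 0" for \<delta>
    proof -
      define c where "c = r' / (B + \<delta>)"
      have B0: "B + \<delta> > 0" using derivs_bounded_nonneg[OF B] \<delta> by simp
      then have c: "c > 0" using r' by (simp add: c_def)
      have "derivs_bounded n N l (\<lambda>xs. complex_of_real c * g xs) (cmod (complex_of_real c) * B)"
        by (rule derivs_bounded_scale[OF g B])
      moreover have "cmod (complex_of_real c) * B \<le> r'"
      proof -
        have "c * B \<le> r'" using B0 r'(1) \<delta> by (simp add: c_def field_simps)
        then show ?thesis using c by simp
      qed
      ultimately have "derivs_bounded n N l (\<lambda>xs. complex_of_real c * g xs) r'"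
        using derivs_bounded_mono by blast
      then have "p (\<lambda>xs. complex_of_real c * g xs) < 1" by (rule small[OF schwartz_scale[OF g]])
      then have "c * p g < 1" using c by (simp add: hilbert_seminorm_scale(1)[OF p schwartz_borchers[OF g]])
      then show ?thesis using c B0 r'(1) by (simp add: c_def field_simps)
    qed
    show "p g \<le> 1 / r' * B"
    proof (rule field_le_epsilon)
      fix e :: real assume "e > 0"
      then show "p g \<le> 1 / r' * B + e" using le[of "e * r'"] r'(1) by (simp add: field_simps)
    qed
  qed
qed

text \<open>Passing from a supremum to an L2 norm requires an integrable weight: the product of 1 /
  (1 + t^2) over all n d coordinates t. Its reciprocal is at most (1 + |x|^2)^(n d), which accounts
  for the n d additional powers in \<open>N + n * c\<close>.\<close>

lemma sobolev_norm_bound: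
  obtains C N' where "C \<ge> 0" "\<And>(g :: 'd::finite test_seq) B. derivs_bounded n N' l g B \<Longrightarrow> sobolev_norm n N l g \<le> C * B"
proof -
  define \<omega> where "\<omega> (y :: 'd spacetime) = (\<Prod>j\<in>UNIV. inverse (1 + (y $ j)\<^sup>2))" for y
  define M where "M = PiM {..<n} (\<lambda>_. lborel :: 'd spacetime measure)"
  interpret product_sigma_finite "\<lambda>_::nat. lborel :: 'd spacetime measure" by standard
  have \<omega>_int: "integrable lborel \<omega>"
    unfolding \<omega>_def by (rule integrable_prod_vec) (rule integrable_inverse_1_plus_square_lborel)
  have w_int: "integrable M (\<lambda>x. \<Prod>i<n. \<omega> (x i))"
    unfolding M_def by (rule product_integrable_prod) (auto simp: \<omega>_int)
  define I where "I = (LINT x|M. (\<Prod>i<n. \<omega> (x i)))"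
  define A where "A = {\<alpha> \<in> multi_indices n :: (nat \<times> 'd) list set. length \<alpha> \<le> l}"
  define c where "c = CARD('d)"
  have \<omega>_nonneg: "0 \<le> \<omega> y" for y unfolding \<omega>_def by (intro prod_nonneg) auto
  have I0: "I \<ge> 0" unfolding I_def by (intro integral_nonneg_AE) (auto intro!: prod_nonneg \<omega>_nonneg)
  show ?thesis
  proof (rule that[of "sqrt (real (card A) * I)" "N + n * c"])
    fix g :: "'d test_seq" and B assume B: "derivs_bounded n (N + n * c) l g B"
    note B0 = derivs_bounded_nonneg[OF B]
    have pw: "(1 + (list_norm xs)\<^sup>2) ^ N * (cmod (partials \<alpha> g xs))\<^sup>2 \<le> B\<^sup>2 * (\<Prod>i<n. \<omega> (xs ! i))"
      if \<alpha>: "\<alpha> \<in> A" and len: "length xs = n" for \<alpha> xs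
    proof -
      let ?r = "list_norm xs" and ?v = "cmod (partials \<alpha> g xs)"
      have comp: "(xs ! i $ j)\<^sup>2 \<le> ?r\<^sup>2" if "i < n" for i j
      proof -
        have "\<bar>xs ! i $ j\<bar> \<le> norm (xs ! i)" by (rule component_le_norm_cart)
        also have "\<dots> \<le> ?r"
          unfolding list_norm_L2_set using that len by (intro member_le_L2_set[where f = "\<lambda>i. norm (xs ! i)"]) auto
        finally show ?thesis by (metis abs_le_square_iff abs_of_nonneg list_norm_nonneg)
      qed
      have "(\<Prod>i<n. \<Prod>j\<in>(UNIV::'d set). 1 + (xs ! i $ j)\<^sup>2) \<le> (\<Prod>i<n. \<Prod>j\<in>(UNIV::'d set). 1 + ?r\<^sup>2)"
        using comp by (intro prod_mono conjI prod_nonneg) (auto intro!: prod_nonneg)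
      also have "\<dots> = (1 + ?r\<^sup>2) ^ (n * c)" by (simp add: c_def power_mult[symmetric] mult.commute)
      finally have P: "(\<Prod>i<n. \<Prod>j\<in>(UNIV::'d set). 1 + (xs ! i $ j)\<^sup>2) \<le> (1 + ?r\<^sup>2) ^ (n * c)" .
      define P where "P = (\<Prod>i<n. \<Prod>j\<in>(UNIV::'d set). 1 + (xs ! i $ j)\<^sup>2)"
      have P0: "P > 0" unfolding P_def by (intro prod_pos) (auto simp: add_pos_nonneg)
      have inv: "(\<Prod>i<n. \<omega> (xs ! i)) = inverse P"
        unfolding P_def \<omega>_def by (simp add: prod_inversef[symmetric])
      have "P * ((1 + ?r\<^sup>2) ^ N * ?v\<^sup>2) \<le> (1 + ?r\<^sup>2) ^ (n * c) * ((1 + ?r\<^sup>2) ^ N * ?v\<^sup>2)"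
        using P unfolding P_def by (intro mult_right_mono) auto
      also have "\<dots> = (1 + ?r\<^sup>2) ^ (N + n * c) * ?v\<^sup>2" by (simp add: power_add)
      also have "\<dots> \<le> ((1 + ?r)\<^sup>2) ^ (N + n * c) * ?v\<^sup>2"
        by (intro mult_right_mono power_mono) (auto simp: power2_sum)
      also have "\<dots> = ((1 + ?r) ^ (N + n * c) * ?v)\<^sup>2" by (simp add: power_mult_distrib power_mult[symmetric] mult.commute)
      also have "\<dots> \<le> B\<^sup>2" using \<alpha> len by (intro power_mono derivs_boundedD[OF B]) (auto simp: A_def)
      finally show ?thesis using P0 by (simp add: inv field_simps)
    qed
    have "(\<Sum>\<alpha>\<in>A. LINT x|M. (1 + (list_norm (map x [0..<n]))\<^sup>2) ^ N * (cmod (partials \<alpha> g (map x [0..<n])))\<^sup>2)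
        \<le> (\<Sum>\<alpha>\<in>A. LINT x|M. B\<^sup>2 * (\<Prod>i<n. \<omega> (x i)))"
    proof (intro sum_mono integral_mono')
      show "integrable M (\<lambda>x. B\<^sup>2 * (\<Prod>i<n. \<omega> (x i)))" using w_int by simp
      show "0 \<le> B\<^sup>2 * (\<Prod>i<n. \<omega> (x i))" for x by (intro mult_nonneg_nonneg prod_nonneg) (auto simp: \<omega>_nonneg)
      show "(1 + (list_norm (map x [0..<n]))\<^sup>2) ^ N * (cmod (partials \<alpha> g (map x [0..<n])))\<^sup>2 \<le> B\<^sup>2 * (\<Prod>i<n. \<omega> (x i))"
        if "\<alpha> \<in> A" for \<alpha> x
        using pw[OF that, of "map x [0..<n]"] by simp
    qed
    also have "\<dots> = real (card A) * I * B\<^sup>2" by (simp add: I_def mult_ac)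
    finally have "sobolev_norm n N l g \<le> sqrt (real (card A) * I * B\<^sup>2)"
      unfolding sobolev_norm_def M_def[symmetric] A_def[symmetric] by (rule real_sqrt_le_mono)
    also have "\<dots> = sqrt (real (card A) * I) * B" using B0 by (simp add: real_sqrt_mult)
    finally show "sobolev_norm n N l g \<le> sqrt (real (card A) * I) * B" .
  qed (use I0 in simp)
qed

lemma sobolev_norm_nonneg: "0 \<le> sobolev_norm n N l g"
  unfolding sobolev_norm_def by (auto intro!: sum_nonneg integral_nonneg_AE)

lemma sobolev_norm_zero: "sobolev_norm n N l (\<lambda>_. 0) = 0"
proof -
  have "partials \<alpha> (\<lambda>_. 0) = (\<lambda>_. 0 :: complex)" for \<alpha> :: "(nat \<times> 'a) list"
  proof (induction \<alpha>)
    case (Cons ib \<alpha>)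
    then show ?case by (simp add: partials_Cons partial_def[abs_def])
  qed simp
  then show ?thesis by (simp add: sobolev_norm_def)
qed

lemma sobolev_sum_schwartz:
  assumes "g \<in> schwartz n"
  shows "sobolev_sum N l g = sobolev_norm n (N n) (l n) g"
proof -
  have "(\<Sum>k. (sobolev_norm k (N k) (l k) (component k g))\<^sup>2) = (\<Sum>k\<in>{n}. (sobolev_norm k (N k) (l k) (component k g))\<^sup>2)"
    by (rule suminf_finite) (auto simp: component_schwartz[OF assms] sobolev_norm_zero)
  then show ?thesis by (simp add: sobolev_sum_def component_schwartz[OF assms] sobolev_norm_nonneg)
qed

text \<open>In both branches of the definition the norm is at most the sum of p and the Sobolev
  part, and on a single summand the latter is just one Sobolev norm.\<close>

lemma hilbert_norm_of_bound:
  fixes p :: "'d::finite test_seq \<Rightarrow> real"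
  assumes dom: "sobolev_dominated p" and p: "hilbert_seminorm p"
  obtains C M k where "C \<ge> 0"
    "\<And>g B. g \<in> schwartz n \<Longrightarrow> derivs_bounded n M k g B \<Longrightarrow> hilbert_norm_of p N l g \<le> C * B"
proof -
  obtain C1 N1 l1 where 1: "C1 \<ge> 0" "\<And>g B. g \<in> schwartz n \<Longrightarrow> derivs_bounded n N1 l1 g B \<Longrightarrow> p g \<le> C1 * B"
    by (rule sobolev_dominated_bound[OF dom p, of n]) blast
  obtain C2 N2 where 2: "C2 \<ge> 0" "\<And>(g :: 'd test_seq) B. derivs_bounded n N2 (l n) g B \<Longrightarrow> sobolev_norm n (N n) (l n) g \<le> C2 * B"
    by (rule sobolev_norm_bound[of n "l n" "N n"]) blast
  show ?thesis
  proof (rule that[of "C1 + C2" "max N1 N2" "max l1 (l n)"])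
    fix g :: "'d test_seq" and B assume g: "g \<in> schwartz n" and B: "derivs_bounded n (max N1 N2) (max l1 (l n)) g B"
    have p0: "0 \<le> p g" by (rule hilbert_seminorm_scale(2)[OF p schwartz_borchers[OF g]])
    have b1: "p g \<le> C1 * B" by (rule 1(2)[OF g derivs_bounded_mono[OF B]]) auto
    have b2: "sobolev_sum N l g \<le> C2 * B"
      unfolding sobolev_sum_schwartz[OF g] by (rule 2(2)[OF derivs_bounded_mono[OF B]]) auto
    have s0: "0 \<le> sobolev_sum N l g" unfolding sobolev_sum_schwartz[OF g] by (rule sobolev_norm_nonneg)
    have "hilbert_norm_of p N l g \<le> p g + sobolev_sum N l g"
      unfolding hilbert_norm_of_def using p0 s0 sqrt_sum_squares_le_sum[of "p g" "sobolev_sum N l g"] by simp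
    then show "hilbert_norm_of p N l g \<le> (C1 + C2) * B" using b1 b2 by (simp add: distrib_right)
  qed (use 1 2 in auto)
qed

section \<open>The indefinite inner product\<close>

text \<open>The disjunction covers antilinear maps too: both kinds are real-linear, which is enough
  for arguments by density.\<close>

lemma bounded_linear_real_of_complex:
  fixes G :: "'a::complex_hilbert \<Rightarrow> complex"
  assumes "\<And>u v. G (u + v) = G u + G v" "\<And>c u. G (c *\<^sub>C u) = c * G u \<or> G (c *\<^sub>C u) = cnj c * G u"
    and "\<And>u. cmod (G u) \<le> norm u * C"
  shows "bounded_linear G"
proof (rule bounded_linear_intro[where K = C])
  show "G (r *\<^sub>R x) = r *\<^sub>R G x" for r x
    using assms(2)[of "complex_of_real r" x] by (auto simp: scaleC_of_real scaleR_conv_of_real)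
qed (use assms in auto)

lemma bounded_sesquilinear_right: "bounded_sesquilinear G \<Longrightarrow> bounded_linear (G v)"
  and bounded_sesquilinear_left: "bounded_sesquilinear G \<Longrightarrow> bounded_linear (\<lambda>u. G u v)"
proof -
  assume G: "bounded_sesquilinear G"
  then obtain C where C: "\<And>u v. cmod (G u v) \<le> C * norm u * norm v" unfolding bounded_sesquilinear_def by blast
  have C': "cmod (G v u) \<le> norm u * (C * norm v)" "cmod (G u v) \<le> norm u * (C * norm v)" for u v
    using C[of v u] C[of u v] by (simp_all add: mult_ac)
  show "bounded_linear (G v)"
    by (rule bounded_linear_real_of_complex[where C = "C * norm v"])
       (use G C' in \<open>simp_all add: bounded_sesquilinear_def\<close>)
  show "bounded_linear (\<lambda>u. G u v)"
    by (rule bounded_linear_real_of_complex[where C = "C * norm v"])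
       (use G C' in \<open>simp_all add: bounded_sesquilinear_def\<close>)
qed

lemma continuous_eq_on_dense:
  fixes f g :: "'a::real_normed_vector \<Rightarrow> 'b::real_normed_vector"
  assumes "bounded_linear f" "bounded_linear g" "closure S = UNIV" "\<And>x. x \<in> S \<Longrightarrow> f x = g x"
  shows "f x = g x"
proof -
  have "continuous_on (closure S) (\<lambda>x. f x - g x)"
    by (intro continuous_on_diff linear_continuous_on assms)
  moreover have "\<And>x. x \<in> S \<Longrightarrow> f x - g x = 0" using assms by simp
  moreover have "x \<in> closure S" by (simp add: assms)
  ultimately have "f x - g x = 0" by (rule continuous_constant_on_closure)
  then show ?thesis by simp
qed

lemma proper_orthochronous_1: "proper_orthochronous (mat 1 :: 'd::{finite,zero} spacetime_matrix)"
  unfolding proper_orthochronous_def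
proof (intro conjI allI)
  show "(mat 1 :: 'd spacetime_matrix) $ 0 $ 0 > 0" by (simp add: mat_def)
qed simp_all

section \<open>The field theory with mass gap: its form, adjoints and spectral condition\<close>

locale massive_qft =
  wightman_functional W p + associated_qft W p N l \<iota> F quot \<eta>2 abs_\<eta>2 sign_\<eta>2 emb \<eta>0 Q
  for W :: "'d::{finite,zero} test_seq \<Rightarrow> complex"
    and p :: "'d test_seq \<Rightarrow> real"
    and N l :: "nat \<Rightarrow> nat"
    and \<iota> :: "'d test_seq \<Rightarrow> 'h1::complex_hilbert"
    and F :: "'h1 \<Rightarrow> 'h1 \<Rightarrow> complex"
    and quot :: "'h1 \<Rightarrow> 'h2::complex_hilbert"
    and \<eta>2 abs_\<eta>2 sign_\<eta>2 :: "'h2 \<Rightarrow> 'h2"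
    and emb :: "'h2 \<Rightarrow> 'h::complex_hilbert"
    and \<eta>0 :: "'h \<Rightarrow> 'h"
    and Q :: "('d, 'h) iqft" +
  fixes m :: real
  assumes dim: "CARD('d) \<ge> 2" and sobolev: "sobolev_dominated p"
    and mass_pos: "m > 0" and gap: "spectral_ideal ({0} \<union> V\<^sub>+ m) \<subseteq> functional_kernel W"
begin

abbreviation (input) "\<Omega> \<equiv> vacuum Q"

lemma W_linear: "linear_on_borchers W"
  using continuous by (simp add: borchers_dual_def)

lemma quot_surj: "surj quot" and quot_clinear: "bounded_clinear quot"
  using quot by (auto simp: hilbert_quotient_def)

lemma state_linear: "linear_on_borchers (state Q)"
  using \<iota>_linear
  by (simp add: linear_on_borchers_def state bounded_clinear_simps[OF quot_clinear]
      bounded_clinear_simps[OF emb_linear])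

lemma state_add: "f \<in> borchers \<Longrightarrow> g \<in> borchers \<Longrightarrow> state Q (\<lambda>xs. f xs + g xs) = state Q f + state Q g"
  and state_scale: "f \<in> borchers \<Longrightarrow> state Q (\<lambda>xs. c * f xs) = c *\<^sub>C state Q f"
  using state_linear by (auto simp: linear_on_borchers_def)

lemma state_linear_combination:
  "f \<in> borchers \<Longrightarrow> g \<in> borchers \<Longrightarrow>
     state Q (\<lambda>xs. c * f xs + d * g xs) = c *\<^sub>C state Q f + d *\<^sub>C state Q g"
  by (simp add: state_add state_scale borchers_scale)

lemma state_dense: "closure (state Q ` borchers) = UNIV"
  using emb_dense by (simp add: state)

text \<open>Hermiticity of W gives the identity on the image of the Borchers algebra; density
  extends it in one argument and then in the other.\<close>

lemma F_hermitian: "F v w = cnj (F w v)"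
proof -
  note right = bounded_sesquilinear_right[OF F_bounded] and left = bounded_sesquilinear_left[OF F_bounded]
  note cl = bounded_linear_compose[OF bounded_linear_cnj left] bounded_linear_compose[OF bounded_linear_cnj right]
  have 1: "F (\<iota> f) (\<iota> g) = cnj (F (\<iota> g) (\<iota> f))" if "f \<in> borchers" "g \<in> borchers" for f g
  proof -
    have "star g \<otimes>\<^sub>B f \<in> borchers" using that by (intro borchers_tensor borchers_star)
    from hermitian[OF this] show ?thesis
      using that by (simp add: F_eq star_tensor)
  qed
  have 2: "F v (\<iota> g) = cnj (F (\<iota> g) v)" if "g \<in> borchers" for v g
    by (rule continuous_eq_on_dense[OF left cl(2) \<iota>_dense]) (use 1 that in auto)
  show ?thesis
    by (rule continuous_eq_on_dense[OF right cl(1) \<iota>_dense]) (use 2 in auto)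
qed

text \<open>What is given about \<eta>2 is its relation to F and to its modulus. Linearity and
  symmetry come from F because \<open>quot\<close> is surjective, and boundedness from the equality
  of the norms of \<eta>2 x and |\<eta>2| x.\<close>

lemma \<eta>2_self_adjoint: "self_adjoint \<eta>2"
  unfolding self_adjoint_def
proof (intro conjI allI bounded_clinearI)
  note qs = bounded_clinear_simps[OF quot_clinear]
  have ext: "y = z" if "\<And>v. cinner (quot v) y = cinner (quot v) z" for y z
    by (rule cinner_ext) (metis that quot_surj surjD)
  have add: "\<eta>2 (x + y) = \<eta>2 x + \<eta>2 y" for x y
  proof -
    obtain a b where ab: "x = quot a" "y = quot b" using quot_surj by (meson surjD)
    show ?thesis unfolding ab qs(1)[symmetric]
      using F_bounded by (intro ext) (simp add: cinner_add_right \<eta>2[symmetric] bounded_sesquilinear_def)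
  qed
  show scale: "\<eta>2 (c *\<^sub>C x) = c *\<^sub>C \<eta>2 x" for c x
  proof -
    obtain a where a: "x = quot a" using quot_surj by (meson surjD)
    show ?thesis unfolding a qs(5)[symmetric]
      using F_bounded by (intro ext) (simp add: cinner_scaleC_right \<eta>2[symmetric] bounded_sesquilinear_def)
  qed
  have A: "positive_op abs_\<eta>2" by (rule is_abs_of_positive[OF abs_\<eta>2])
  obtain K where K: "\<And>x. norm (abs_\<eta>2 x) \<le> norm x * K"
    using bounded_linear.bounded[OF bounded_clinear_bounded_linear[OF positive_op_clinear[OF A]]] by blast
  show "bounded_linear \<eta>2"
  proof (rule bounded_linear_intro[where K = K])
    show "\<eta>2 (r *\<^sub>R x) = r *\<^sub>R \<eta>2 x" for r x
      using scale[of "complex_of_real r" x] by (simp add: scaleC_of_real)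
    fix x
    have "cinner (\<eta>2 x) (\<eta>2 x) = cinner (abs_\<eta>2 x) (abs_\<eta>2 x)"
      by (simp add: is_abs_of_square[OF abs_\<eta>2, symmetric] positive_op_sym[OF A])
    then have "(norm (\<eta>2 x))\<^sup>2 = (norm (abs_\<eta>2 x))\<^sup>2" unfolding cinner_self using of_real_eq_iff by blast
    then have "norm (\<eta>2 x) = norm (abs_\<eta>2 x)" by simp
    then show "norm (\<eta>2 x) \<le> norm x * K" using K by simp
  qed (rule add)
  show "cinner (\<eta>2 x) y = cinner x (\<eta>2 y)" for x y
  proof -
    obtain a b where ab: "x = quot a" "y = quot b" using quot_surj by (meson surjD)
    show ?thesis unfolding ab
      using F_hermitian[of a b] \<eta>2[of a b] \<eta>2[of b a] cinner_commute by metis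
  qed
qed

text \<open>A vector killed by \<eta>2 comes from the kernel of F, which has distance 0 from itself
  and is therefore mapped to 0 by \<open>quot\<close>.\<close>

lemma \<eta>2_injective:
  assumes "\<eta>2 x = 0"
  shows "x = 0"
proof -
  obtain v where v: "x = quot v" using quot_surj by (meson surjD)
  have "\<forall>w. F w v = 0" using assms by (simp add: \<eta>2 v)
  then have "infdist v {v. \<forall>w. F w v = 0} = 0" by (intro infdist_zero) simp
  then have "norm (quot v) = 0" using quot by (simp add: hilbert_quotient_def)
  then show ?thesis by (simp add: v)
qed

text \<open>From here on the inner product of states is expressed through W alone, so algebra in the
  Borchers algebra replaces computations with the metric operator.\<close>

lemma indef_state:
  assumes "f \<in> borchers" "g \<in> borchers"
  shows "indef Q (state Q f) (state Q g) = W (star f \<otimes>\<^sub>B g)"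
proof -
  have "indef Q (state Q f) (state Q g) = cinner (quot (\<iota> f)) (abs_\<eta>2 (sign_\<eta>2 (quot (\<iota> g))))"
    by (simp add: metric_indef state \<eta>0_emb emb_cinner)
  also have "\<dots> = F (\<iota> f) (\<iota> g)"
    by (simp add: abs_sign[OF \<eta>2_self_adjoint \<eta>2_injective abs_\<eta>2 sign_\<eta>2] \<eta>2)
  finally show ?thesis by (simp add: F_eq assms)
qed

lemma indef_bounded_linear: "bounded_linear (indef Q x)"
  using bounded_linear_compose[OF bounded_linear_cinner_right bounded_clinear_bounded_linear[OF \<eta>0_linear]]
  by (simp add: metric_indef[abs_def])

lemma indef_scale: "indef Q x (c *\<^sub>C y) = c * indef Q x y"
  and indef_scale_left: "indef Q (c *\<^sub>C x) y = cnj c * indef Q x y"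
  by (simp_all add: metric_indef bounded_clinear_simps[OF \<eta>0_linear] cinner_algebra)

lemma sp_linear: "sp Q (x - y) z = sp Q x z - sp Q y z"
proof -
  have "sp Q ((x - y) + y) z = sp Q (x - y) z + sp Q y z"
    using sp unfolding equivalent_scalar_product_def bounded_sesquilinear_def by blast
  then show ?thesis by simp
qed

lemma sp_definite:
  assumes "sp Q x x = 0"
  shows "x = 0"
proof -
  obtain c where "c > 0" "\<And>x. c * (norm x)\<^sup>2 \<le> Re (sp Q x x)"
    using sp unfolding equivalent_scalar_product_def by blast
  with assms have "c > 0" "c * (norm x)\<^sup>2 \<le> 0" by (metis zero_complex.sel(1))+
  then show ?thesis by (simp add: mult_le_0_iff)
qed

lemma sp_ext:
  assumes "\<And>g. g \<in> borchers \<Longrightarrow> sp Q x (state Q g) = sp Q y (state Q g)"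
  shows "x = y"
proof -
  have b: "bounded_linear (sp Q z)" for z
    using sp unfolding equivalent_scalar_product_def by (intro bounded_sesquilinear_right) blast
  have "sp Q x z = sp Q y z" for z
    by (rule continuous_eq_on_dense[OF b b state_dense]) (use assms in auto)
  then have "sp Q (x - y) (x - y) = 0" by (simp add: sp_linear)
  then have "x - y = 0" by (rule sp_definite)
  then show ?thesis by simp
qed

lemma indef_hermitian: "indef Q x y = cnj (indef Q y x)"
proof -
  have h: "sp Q u v = cnj (sp Q v u)" for u v using sp unfolding equivalent_scalar_product_def by blast
  show ?thesis
    unfolding indef_def metric_self_adjoint[of x y, symmetric] by (rule h)
qed

text \<open>Nondegeneracy tested on the dense domain only: the metric operator is invertible, and
  \<open>sp Q\<close> is definite and continuous.\<close>

lemma indef_ext_left: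
  assumes "\<And>g. g \<in> borchers \<Longrightarrow> indef Q x (state Q g) = indef Q y (state Q g)"
  shows "x = y"
proof -
  have "metric Q x = metric Q y"
    by (rule sp_ext) (use assms in \<open>simp add: metric_self_adjoint indef_def\<close>)
  then show ?thesis by (metis metric_involution)
qed

lemma indef_ext:
  assumes "\<And>g. g \<in> borchers \<Longrightarrow> indef Q (state Q g) x = indef Q (state Q g) y"
  shows "x = y"
  by (rule indef_ext_left) (subst (1 2) indef_hermitian, simp add: assms)

lemma indef_vacuum: "f \<in> borchers \<Longrightarrow> indef Q \<Omega> (state Q f) = W f"
  by (simp add: vacuum_def indef_state borchers_unit)

lemma indef_state_vacuum: "f \<in> borchers \<Longrightarrow> indef Q (state Q f) \<Omega> = W (star f)"
  by (simp add: vacuum_def indef_state borchers_unit)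

lemma rep_translation:
  assumes "g \<in> borchers"
  shows "rep Q (mat 1) a (state Q g) = state Q (translate a g)"
  using rep[OF proper_orthochronous_1 assms] by (simp add: poincare_translation)

lemma W_translate:
  assumes "f \<in> borchers"
  shows "W (translate a f) = W f"
  using invariant[OF proper_orthochronous_1 assms] by (simp add: poincare_translation)

text \<open>The adjoint is a definite description, so besides the adjoint relation uniqueness is
  required; it holds because the domain is dense. The two metric operators cancel.\<close>

lemma eta_adjoint_field:
  assumes f: "f \<in> borchers" and g: "g \<in> borchers"
  shows "eta_adjoint Q (field_op Q f) (state Q g) = state Q (star f \<otimes>\<^sub>B g)"
proof -
  have sfg: "star f \<otimes>\<^sub>B g \<in> borchers" by (intro borchers_tensor borchers_star f g)
  have w: "\<forall>\<Psi>\<in>dom Q. sp Q (metric Q (state Q (star f \<otimes>\<^sub>B g))) \<Psi> = sp Q (metric Q (state Q g)) (field_op Q f \<Psi>)"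
  proof
    fix \<Psi> assume "\<Psi> \<in> dom Q"
    then obtain k where k: "k \<in> borchers" "\<Psi> = state Q k" by (auto simp: dom_def)
    have "sp Q (metric Q (state Q (star f \<otimes>\<^sub>B g))) \<Psi> = indef Q (state Q (star f \<otimes>\<^sub>B g)) (state Q k)"
      by (simp add: metric_self_adjoint indef_def k)
    also have "\<dots> = W (star g \<otimes>\<^sub>B (f \<otimes>\<^sub>B k))"
      by (simp add: indef_state sfg k star_tensor tensor_assoc)
    also have "\<dots> = indef Q (state Q g) (state Q (f \<otimes>\<^sub>B k))"
      by (simp add: indef_state g borchers_tensor f k)
    also have "\<dots> = sp Q (metric Q (state Q g)) (field_op Q f \<Psi>)"
      by (simp add: metric_self_adjoint indef_def k field_op f)
    finally show "sp Q (metric Q (state Q (star f \<otimes>\<^sub>B g))) \<Psi> = sp Q (metric Q (state Q g)) (field_op Q f \<Psi>)" .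
  qed
  have "adjoint_op Q (field_op Q f) (metric Q (state Q g)) = metric Q (state Q (star f \<otimes>\<^sub>B g))"
    unfolding adjoint_op_def
  proof (rule the_equality, rule w)
    fix w' assume w': "\<forall>\<Psi>\<in>dom Q. sp Q w' \<Psi> = sp Q (metric Q (state Q g)) (field_op Q f \<Psi>)"
    show "w' = metric Q (state Q (star f \<otimes>\<^sub>B g))"
      by (rule sp_ext) (use w w' in \<open>auto simp: dom_def\<close>)
  qed
  then show ?thesis by (simp add: eta_adjoint_def metric_involution)
qed

text \<open>Here Sobolev domination enters: the vector of f is bounded by the Hilbert norm of f,
  hence by finitely many weighted derivatives. A bounded functional composed with
  \<open>state Q\<close> is thus tempered in each degree.\<close>

lemma tempered_state:
  assumes L: "bounded_linear L" and scale: "\<And>c x. L (c *\<^sub>C x) = c * L x"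
  shows "tempered n (\<lambda>f. L (state Q f))"
  unfolding tempered_def
proof (intro conjI ballI allI)
  fix f g :: "'d test_seq" and c d assume "f \<in> schwartz n" "g \<in> schwartz n"
  then have "f \<in> borchers" "g \<in> borchers" using schwartz_borchers by auto
  then show "L (state Q (\<lambda>xs. c * f xs + d * g xs)) = c * L (state Q f) + d * L (state Q g)"
    by (simp add: state_linear_combination linear_add[OF bounded_linear.linear[OF L]] scale)
next
  obtain C M k where C: "C \<ge> 0"
    "\<And>g B. g \<in> schwartz n \<Longrightarrow> derivs_bounded n M k g B \<Longrightarrow> hilbert_norm_of p N l g \<le> C * B"
    by (rule hilbert_norm_of_bound[OF sobolev seminorm, of n N l]) blast
  obtain K where K: "K \<ge> 0" "\<And>x. norm (L (emb (quot x))) \<le> norm x * K"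
    using bounded_linear.nonneg_bounded[OF bounded_linear_compose[OF L bounded_linear_compose[OF
        bounded_clinear_bounded_linear[OF emb_linear] bounded_clinear_bounded_linear[OF quot_clinear]]]] by auto
  show "\<exists>C\<ge>0. \<exists>N l. \<forall>g\<in>schwartz n. \<forall>B.
        (\<forall>\<alpha>\<in>multi_indices n. length \<alpha> \<le> l \<longrightarrow>
           (\<forall>xs. length xs = n \<longrightarrow> (1 + list_norm xs) ^ N * cmod (partials \<alpha> g xs) \<le> B)) \<longrightarrow>
        cmod (L (state Q g)) \<le> C * B"
    unfolding derivs_bounded_def[symmetric]
  proof (rule exI[of _ "K * C"], intro conjI, use K C in simp, rule exI[of _ M], rule exI[of _ k], intro ballI allI impI)
    fix g :: "'d test_seq" and B assume g: "g \<in> schwartz n" and B: "derivs_bounded n M k g B"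
    have "cmod (L (state Q g)) \<le> norm (\<iota> g) * K" using K(2)[of "\<iota> g"] by (simp add: state)
    also have "norm (\<iota> g) = hilbert_norm_of p N l g" by (rule \<iota>_norm[OF schwartz_borchers[OF g]])
    also have "\<dots> * K \<le> C * B * K" by (intro mult_right_mono C(2)[OF g B] K(1))
    finally show "cmod (L (state Q g)) \<le> K * C * B" by (simp add: mult_ac)
  qed
qed

lemma tempered_indef: "tempered n (\<lambda>f. indef Q x (state Q f))"
  by (rule tempered_state[OF indef_bounded_linear indef_scale])

text \<open>The smeared sequence generates elements of the left ideal, so W kills its product with
  every \<open>star g\<close>. Its vector is then orthogonal to the domain in the indefinite form
  and vanishes by nondegeneracy.\<close>

lemma convolve_spectral_zero:
  assumes f: "f \<in> schwartz n" and \<phi>: "\<And>j. schwartz1 (\<phi> j)" and E: "closed E" "E \<inter> ({0} \<union> V\<^sub>+ m) = {}"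
    and supp: "\<And>k. (\<Prod>j\<in>UNIV. fourier1 (\<phi> j) (mink_sign j * k $ j)) \<noteq> 0 \<Longrightarrow> k \<in> E"
  shows "state Q (convolve f (prod_fun \<phi>)) = 0"
proof (rule indef_ext)
  fix g :: "'d test_seq" assume g: "g \<in> borchers"
  let ?s = "convolve f (prod_fun \<phi>)"
  have s: "?s = smear_translates f (prod_seq \<phi>)" by (simp add: smear_translates_convolve)
  have sb: "?s \<in> borchers" by (rule schwartz_borchers[OF schwartz_convolve[OF f rapid_prod_fun_schwartz1[OF \<phi>]]])
  have "closure {k. fourier (prod_seq \<phi>) k \<noteq> 0} \<subseteq> E"
    using supp by (intro closure_minimal E) (auto simp: fourier_prod_seq[OF \<phi>])
  then have "closure {k. fourier (prod_seq \<phi>) k \<noteq> 0} \<inter> ({0} \<union> V\<^sub>+ m) = {}" using E(2) by blast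
  then have gen: "?s \<in> {smear_translates f h | f h. f \<in> borchers \<and> h \<in> schwartz 1 \<and>
      closure {k. fourier h k \<noteq> 0} \<inter> ({0} \<union> V\<^sub>+ m) = {}}"
    using s schwartz_borchers[OF f] schwartz_prod_seq[of \<phi>, OF \<phi>] by blast
  have "star g \<otimes>\<^sub>B ?s \<in> spectral_ideal ({0} \<union> V\<^sub>+ m)"
    unfolding spectral_ideal_def hull_def
  proof (rule InterI)
    fix I :: "'d test_seq set" assume "I \<in> {t. left_ideal t \<and> {smear_translates f h | f h. f \<in> borchers \<and> h \<in> schwartz 1 \<and>
      closure {k. fourier h k \<noteq> 0} \<inter> ({0} \<union> V\<^sub>+ m) = {}} \<subseteq> t}"
    then have "left_ideal I" "?s \<in> I" using gen by auto
    then show "star g \<otimes>\<^sub>B ?s \<in> I" using borchers_star[OF g] by (simp add: left_ideal_def)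
  qed
  then have "W (star g \<otimes>\<^sub>B ?s) = 0" using gap by (auto simp: functional_kernel_def)
  then show "indef Q (state Q g) (state Q ?s) = indef Q (state Q g) 0"
    using indef_scale[of "state Q g" 0 0] by (simp add: indef_state g sb linear_0[OF bounded_linear.linear[OF indef_bounded_linear]])
qed

end

text \<open>The integral formula makes linearity in one factor of the smearing function evident; it
  is used to compare smearings whose transforms differ in one direction only.\<close>

lemma tempered_prod_linear:
  fixes T :: "'d::finite test_seq \<Rightarrow> complex"
  assumes T: "tempered n T" and f: "f \<in> schwartz n" and \<phi>: "\<And>j. schwartz1 (\<phi> j)"
    and vw: "schwartz1 v" "schwartz1 w"
  shows "T (convolve f (prod_fun (\<phi>(b := \<lambda>s. c * v s + d * w s)))) =
    c * T (convolve f (prod_fun (\<phi>(b := v)))) + d * T (convolve f (prod_fun (\<phi>(b := w))))"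
proof -
  let ?h = "\<lambda>x. prod_fun (\<phi>(b := x))"
  have r: "rapid (?h x)" if "schwartz1 x" for x
    by (rule rapid_prod_fun_schwartz1) (use \<phi> that in simp)
  obtain K M where K: "\<And>a. cmod (T (translate a f)) \<le> K * (1 + norm a) ^ M"
    using tempered_translate_bound[OF T f] by blast
  have Fm: "(\<lambda>a. T (translate a f)) \<in> borel_measurable borel"
    by (rule borel_measurable_continuous_onI[OF tempered_translate_continuous[OF T f]])
  note int = rapid_integrable_poly_bounded[OF r Fm K]
  have "T (convolve f (?h (\<lambda>s. c * v s + d * w s))) =
      (LINT a|lborel. T (translate a f) * ?h (\<lambda>s. c * v s + d * w s) a)"
    by (rule tempered_convolve_eq[OF T f r[OF schwartz1_linear_combination[OF vw]]])
  also have "\<dots> = (LINT a|lborel. c * (T (translate a f) * ?h v a) + d * (T (translate a f) * ?h w a))"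
    by (intro Bochner_Integration.integral_cong)
       (auto simp: prod_fun_linear[of "\<lambda>s. c * v s + d * w s" c v d w] algebra_simps)
  also have "\<dots> = c * (LINT a|lborel. T (translate a f) * ?h v a) + d * (LINT a|lborel. T (translate a f) * ?h w a)"
    using int[OF vw(1)] int[OF vw(2)] by simp
  finally show ?thesis
    by (simp add: tempered_convolve_eq[OF T f r[OF vw(1)]] tempered_convolve_eq[OF T f r[OF vw(2)]])
qed

text \<open>For an invariant functional the integrand is constant up to the kernel, so only the
  value of the transform at 0 survives.\<close>

lemma tempered_convolve_invariant:
  assumes T: "tempered n T" and f: "f \<in> schwartz n" and inv: "\<And>a. T (translate a f) = T f"
    and \<phi>: "\<And>j. schwartz1 (\<phi> j)"
  shows "T (convolve f (prod_fun \<phi>)) = T f * (\<Prod>j\<in>UNIV. fourier1 (\<phi> j) 0)"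
  by (simp add: tempered_convolve_eq[OF T f rapid_prod_fun_schwartz1[OF \<phi>]] inv integral_prod_fun[OF \<phi>])

text \<open>Translations of smeared vectors become shifts of the smearing function, hence factors in
  its Fourier transform.\<close>

lemma convolve_shift:
  fixes f :: "'d::finite test_seq"
  assumes f: "f \<in> schwartz n" and k: "rapid k"
  shows "convolve f (\<lambda>a. k (a - c)) = translate c (convolve f k)"
proof
  fix xs :: "'d spacetime list"
  have [measurable]: "k \<in> borel_measurable borel" by (rule rapid_measurable[OF k])
  have [measurable]: "(\<lambda>a. translate a f xs) \<in> borel_measurable borel"
    by (rule borel_measurable_continuous_onI[OF translate_continuous[OF f]])
  have "(LINT a|lborel. translate a f xs * k (a - c)) = (LINT a|distr lborel borel ((+) c). translate a f xs * k (a - c))"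
    by (simp add: lborel_distr_plus)
  also have "\<dots> = (LINT a|lborel. translate (c + a) f xs * k ((c + a) - c))"
    by (rule integral_distr) measurable
  also have "\<dots> = translate c (convolve f k) xs"
    by (simp add: convolve_def translate_def o_def algebra_simps)
  finally show "convolve f (\<lambda>a. k (a - c)) xs = translate c (convolve f k) xs" by (simp add: convolve_def)
qed

lemma prod_fun_shift:
  "prod_fun (\<phi>(b := \<lambda>s. w (s - t))) a = prod_fun (\<phi>(b := w)) (a - t *\<^sub>R axis b 1)"
  unfolding prod_fun_def by (rule prod.cong) (auto simp: axis_def)

text \<open>The transform acquires a zero at 0 for n > 0, and it depends on v only through the
  values of its transform; functions whose transforms agree near 0 keep doing so.\<close>

lemma fourier1_diff_op_power:
  assumes "schwartz1 v"
  shows "fourier1 ((diff_op ^^ n) v) \<kappa> = (iexp \<kappa> - 1) ^ n * fourier1 v \<kappa>"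
proof (induction n)
  case (Suc n)
  let ?v = "(diff_op ^^ n) v"
  have v: "schwartz1 ?v" by (rule schwartz1_diff_op_power[OF assms])
  have d: "diff_op ?v = (\<lambda>s. ?v (s - 1) - ?v s)" by (rule ext) (rule diff_op_def)
  have "fourier1 (diff_op ?v) \<kappa> = fourier1 (\<lambda>s. ?v (s - 1)) \<kappa> - fourier1 ?v \<kappa>"
    unfolding d by (rule fourier1_diff[OF schwartz1_shift[OF v] v])
  then show ?case by (simp add: fourier1_shift Suc algebra_simps)
qed simp

section \<open>Uniqueness of the vacuum and irreducibility\<close>

text \<open>If the differences of order n + 1 vanish, those of order n are constant and equal to
  their limit, which is 0 for n > 0. Descending from K reaches order 1, after which the sequence
  itself is constant.\<close>

lemma vanishing_differences_limit:
  fixes s :: "nat \<Rightarrow> nat \<Rightarrow> complex"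
  assumes diff: "\<And>n i. s (Suc n) i = s n (Suc i) - s n i" and zero: "\<And>i. s K i = 0" and K: "K > 0"
    and lim: "\<And>n. s n \<longlonglongrightarrow> L n" and L: "\<And>n. n > 0 \<Longrightarrow> L n = 0"
  shows "s 0 i = L 0"
proof -
  have const: "s n i = L n" if "\<And>i. s (Suc n) i = 0" for n i
  proof -
    have "s n i = s n 0" for i
    proof (induction i)
      case (Suc i)
      then show ?case using diff[of n i] that[of i] by simp
    qed simp
    then have "s n = (\<lambda>_. s n 0)" by (intro ext)
    with lim[of n] have "(\<lambda>_::nat. s n 0) \<longlonglongrightarrow> L n" by simp
    then have "s n 0 = L n" by (simp add: LIMSEQ_const_iff)
    with \<open>s n i = s n 0\<close> show ?thesis by simp
  qed
  have "\<forall>i. s (K - d) i = 0" if "d < K" for d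
    using that
  proof (induction d)
    case (Suc d)
    then have *: "K - d = Suc (K - Suc d)" "K - Suc d > 0" by auto
    show ?case
      using const[of "K - Suc d"] Suc *(1) L[OF *(2)] by simp
  qed (simp add: zero)
  from this[of "K - 1"] K have "\<forall>i. s (Suc 0) i = 0" by simp
  then show ?thesis using const by blast
qed

lemma schwartz1_spread:
  assumes "schwartz1 u" "c \<noteq> 0"
  shows "schwartz1 (\<lambda>s. complex_of_real c * u (c * s))"
  using schwartz1_linear_combination[OF schwartz1_affine[OF assms] schwartz1_affine[OF assms],
      where c = "complex_of_real c" and d = 0, of 0 0]
  by simp

lemma schwartz1_diff: "schwartz1 u \<Longrightarrow> schwartz1 v \<Longrightarrow> schwartz1 (\<lambda>s. u s - v s)"
  using schwartz1_linear_combination[of u v 1 "-1"] by simp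

lemma fourier1_add:
  assumes "schwartz1 u" "schwartz1 v"
  shows "fourier1 (\<lambda>s. u s + v s) \<kappa> = fourier1 u \<kappa> + fourier1 v \<kappa>"
  unfolding fourier1_def
  using fourier1_integrable[OF schwartz1_L1[OF assms(1)]] fourier1_integrable[OF schwartz1_L1[OF assms(2)]]
  by (simp add: distrib_left)

text \<open>All points are translated by the same vector, so translation commutes with reversing the
  list.\<close>

lemma star_convolve: "star (convolve f k) = convolve (star f) (\<lambda>a. cnj (k a))"
proof
  fix xs :: "'a spacetime list"
  have "star (convolve f k) xs = (LINT a|lborel. cnj (translate a f (rev xs) * k a))"
    unfolding star_def convolve_def by (rule Bochner_Integration.integral_cnj[symmetric])
  then show "star (convolve f k) xs = convolve (star f) (\<lambda>a. cnj (k a)) xs"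
    by (simp add: convolve_def translate_def star_def rev_map)
qed

lemma mink_axis:
  fixes b :: "'d::{finite,zero}"
  assumes "b \<noteq> 0"
  shows "axis b 1 \<cdot>\<^sub>M axis b 1 = -1"
proof -
  have "(\<Sum>j\<in>UNIV - {0}. (axis b 1 :: 'd spacetime) $ j * axis b 1 $ j) = (\<Sum>j\<in>UNIV - {0}. if j = b then 1 else 0)"
    by (rule sum.cong) (auto simp: axis_def)
  also have "\<dots> = 1" using assms by simp
  finally show ?thesis using assms by (simp add: mink_def axis_def)
qed

lemma mink_self_le: "k \<cdot>\<^sub>M k \<le> (k $ 0)\<^sup>2"
  unfolding mink_def by (simp add: power2_eq_square sum_nonneg)

text \<open>The parameter c is the radius on which the transform equals 1; the transform vanishes
  from radius 2 c on.\<close>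

lemma plateau_schwartz1:
  assumes "c > 0"
  obtains u where "schwartz1 u" "\<And>\<kappa>. fourier1 u \<kappa> = complex_of_real (plateau (\<kappa> / c))"
proof -
  have "bump (2 * c) (\<lambda>\<kappa>. plateau (1 / c * \<kappa>))"
    unfolding bump_def
  proof (intro conjI allI impI)
    show "C_n n (\<lambda>\<kappa>. plateau (1 / c * \<kappa>))" for n by (rule C_n_plateau)
    show "plateau (1 / c * x) = 0" if "2 * c < \<bar>x\<bar>" for x
      using that assms by (intro plateau_0) (simp add: field_simps)
  qed
  from schwartz1_with_fourier1[OF this] show ?thesis using that by (metis mult.commute times_divide_eq_right mult.right_neutral)
qed

context massive_qft
begin

text \<open>The smeared vector only involves momenta with \<open>\<bar>k\<^sup>0\<bar> < m\<close>, so by the mass gap only \<open>k = 0\<close>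
  contributes. Translating it in a space-like direction gives a sequence whose iterated differences
  of high order vanish, because \<open>u\<close> may be replaced by the spread out \<open>u (s / \<Lambda>) / \<Lambda>\<close> with
  arbitrarily large \<open>\<Lambda>\<close>. The cluster property makes the sequence converge, so it is constant.\<close>

lemma low_energy_smearing:
  assumes f: "f \<in> schwartz n" and \<phi>0: "schwartz1 \<phi>0" "\<And>\<kappa>. \<bar>\<kappa>\<bar> > \<mu> \<Longrightarrow> fourier1 \<phi>0 \<kappa> = 0" "fourier1 \<phi>0 0 = 1"
    and \<mu>: "\<mu> < m" and u: "schwartz1 u" "\<And>\<kappa>. \<bar>\<kappa>\<bar> \<le> \<delta> \<Longrightarrow> fourier1 u \<kappa> = 1" and \<delta>: "\<delta> > 0"
  shows "state Q (convolve f (prod_fun (\<lambda>j. if j = 0 then \<phi>0 else u))) = W f *\<^sub>C \<Omega>"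
proof (rule indef_ext)
  fix g :: "'d test_seq" assume g: "g \<in> borchers"
  define \<phi> where "\<phi> = (\<lambda>j::'d. if j = 0 then \<phi>0 else u)"
  have \<phi>: "schwartz1 (\<phi> j)" for j using \<phi>0 u by (simp add: \<phi>_def)
  \<comment> \<open>The dimension bound provides a spatial axis, along which translations are
    space-like.\<close>
  obtain b :: 'd where b: "b \<noteq> 0"
  proof -
    have "(UNIV :: 'd set) \<noteq> {0}" using dim by (metis card_1_singleton_iff One_nat_def Suc_1 not_less_eq_eq order_refl)
    then show ?thesis using that by blast
  qed
  \<comment> \<open>Only the factor along b varies; the factor that restricts the energy remains in
    place.\<close>
  define h where "h w = prod_fun (\<phi>(b := w))" for w
  have hs: "schwartz1 ((\<phi>(b := w)) j)" if "schwartz1 w" for w j using \<phi> that by simp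
  have rh: "rapid (h w)" if "schwartz1 w" for w
    unfolding h_def by (rule rapid_prod_fun_schwartz1[OF hs[OF that]])
  define T where "T f = indef Q (state Q g) (state Q f)" for f
  have T: "tempered n T" unfolding T_def by (rule tempered_indef)
  define Y where "Y w = T (convolve f (h w))" for w
  define sh where "sh i w = (\<lambda>s. w (s - real i) :: complex)" for i w
  have sh_s: "schwartz1 (sh i w)" if "schwartz1 w" for i w unfolding sh_def by (rule schwartz1_shift[OF that])
  have Y_diff: "Y (\<lambda>s. v s - w s) = Y v - Y w" if "schwartz1 v" "schwartz1 w" for v w
    using tempered_prod_linear[OF T f \<phi> that, where b = b and c = 1 and d = "-1"] by (simp add: Y_def h_def)
  have prod1: "(\<Prod>j\<in>UNIV. fourier1 ((\<phi>(b := w)) j) 0) = fourier1 w 0" for w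
  proof -
    have "(\<Prod>j\<in>UNIV. fourier1 ((\<phi>(b := w)) j) 0) = fourier1 w 0 * (\<Prod>j\<in>UNIV - {b}. fourier1 ((\<phi>(b := w)) j) 0)"
      by (subst prod.remove[of _ b]) auto
    also have "(\<Prod>j\<in>UNIV - {b}. fourier1 ((\<phi>(b := w)) j) 0) = 1"
      using \<phi>0(3) u(2)[of 0] \<delta> by (intro prod.neutral) (auto simp: \<phi>_def)
    finally show ?thesis by simp
  qed
  have W_conv: "W (convolve f (h w)) = W f * fourier1 w 0" if w: "schwartz1 w" for w
  proof -
    let ?T = "\<lambda>f. indef Q \<Omega> (state Q f)"
    have eq: "?T f = W f" if "f \<in> schwartz n" for f using that by (intro indef_vacuum schwartz_borchers)
    have "?T (convolve f (prod_fun (\<phi>(b := w)))) = ?T f * (\<Prod>j\<in>UNIV. fourier1 ((\<phi>(b := w)) j) 0)"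
      using f by (intro tempered_convolve_invariant[OF tempered_indef f] hs w)
        (simp add: eq schwartz_translate W_translate schwartz_borchers)
    then show ?thesis
      unfolding prod1 h_def using f schwartz_convolve[OF f rh[OF w]] by (simp add: eq h_def)
  qed
  \<comment> \<open>Shifting the factor along b translates the smeared sequence along that axis, so
    the cluster property yields the limit.\<close>
  have lim: "(\<lambda>i. Y (sh i w)) \<longlonglongrightarrow> W (star g) * W f * fourier1 w 0" if w: "schwartz1 w" for w
  proof -
    let ?c = "convolve f (h w)" and ?e = "axis b 1 :: 'd spacetime"
    have c: "?c \<in> schwartz n" by (rule schwartz_convolve[OF f rh[OF w]])
    have "spacelike ?e" using mink_axis[OF b] by (simp add: spacelike_def)
    from cluster[OF borchers_star[OF g] schwartz_borchers[OF c] this]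
    have "((\<lambda>t. W (star g \<otimes>\<^sub>B translate (t *\<^sub>R ?e) ?c)) \<longlongrightarrow> W (star g) * W ?c) at_top"
      by (simp add: poincare_translation)
    from filterlim_compose[OF this filterlim_real_sequentially]
    have "(\<lambda>i. W (star g \<otimes>\<^sub>B translate (real i *\<^sub>R ?e) ?c)) \<longlonglongrightarrow> W (star g) * W ?c" .
    moreover have "Y (sh i w) = W (star g \<otimes>\<^sub>B translate (real i *\<^sub>R ?e) ?c)" for i
    proof -
      have "h (sh i w) = (\<lambda>a. h w (a - real i *\<^sub>R ?e))"
        unfolding h_def sh_def by (rule ext) (rule prod_fun_shift)
      then have "convolve f (h (sh i w)) = translate (real i *\<^sub>R ?e) ?c"
        by (simp add: convolve_shift[OF f rh[OF w]])
      then show ?thesis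
        using g schwartz_borchers[OF schwartz_translate[OF c]] by (simp add: Y_def T_def indef_state)
    qed
    ultimately show ?thesis by (simp add: W_conv[OF w] mult.assoc)
  qed
  \<comment> \<open>If the transform of w vanishes near 0, the remaining momenta satisfy |k 0| <=
    \<mu> and |k b| >= d. The second condition excludes 0; the first excludes the mass shells
    because k . k <= (k 0)^2 < m^2.\<close>
  have zero: "Y w = 0" if w: "schwartz1 w" and d: "d > 0" "\<And>\<kappa>. \<bar>\<kappa>\<bar> < d \<Longrightarrow> fourier1 w \<kappa> = 0" for w d
  proof -
    let ?E = "{k :: 'd spacetime. \<bar>k $ 0\<bar> \<le> \<mu> \<and> d \<le> \<bar>k $ b\<bar>}"
    have "state Q (convolve f (prod_fun (\<phi>(b := w)))) = 0"
    proof (rule convolve_spectral_zero[OF f hs[OF w], where E = ?E])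
      show "closed ?E"
        by (intro closed_Collect_conj closed_Collect_le continuous_intros)
      have "k \<notin> V\<^sub>+ m" if "\<bar>k $ 0\<bar> \<le> \<mu>" for k :: "'d spacetime"
      proof -
        have "k \<cdot>\<^sub>M k \<le> \<bar>k $ 0\<bar>\<^sup>2" using mink_self_le[of k] by simp
        also have "\<dots> \<le> \<mu>\<^sup>2" using that by (intro power_mono) auto
        also have "\<dots> < m\<^sup>2" using that \<mu> by (intro power_strict_mono) auto
        finally show ?thesis by (simp add: forward_mass_shells_def)
      qed
      then show "?E \<inter> ({0} \<union> V\<^sub>+ m) = {}" using d(1) by auto
    next
      fix k :: "'d spacetime"
      assume nz: "(\<Prod>j\<in>UNIV. fourier1 ((\<phi>(b := w)) j) (mink_sign j * k $ j)) \<noteq> 0"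
      then have nz: "fourier1 ((\<phi>(b := w)) j) (mink_sign j * k $ j) \<noteq> 0" for j by simp
      have "\<not> \<bar>mink_sign (0::'d) * k $ 0\<bar> > \<mu>"
        using nz[of 0] b \<phi>0(2)[of "mink_sign (0::'d) * k $ 0"] by (auto simp: \<phi>_def)
      moreover have "\<not> \<bar>mink_sign b * k $ b\<bar> < d"
        using nz[of b] d(2)[of "mink_sign b * k $ b"] by auto
      ultimately show "k \<in> ?E" using b by (simp add: mink_sign_def)
    qed
    then show ?thesis
      by (simp add: Y_def T_def h_def linear_0[OF bounded_linear.linear[OF indef_bounded_linear]])
  qed
  obtain K0 M where K0: "K0 \<ge> 0" "\<And>a. cmod (T (translate a f)) \<le> K0 * (1 + norm a) ^ M"
    using tempered_translate_bound[OF T f] by blast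
  \<comment> \<open>M powers of the weight absorb the growth of the translated functional, and two
    more make the integral in the direction b converge.\<close>
  define K where "K = M + 2"
  obtain C where C: "\<And>\<Lambda> s. \<Lambda> \<ge> 1 \<Longrightarrow>
      (1 + \<bar>s\<bar>) ^ K * cmod ((diff_op ^^ K) (\<lambda>s. complex_of_real (1 / \<Lambda>) * u (1 / \<Lambda> * s)) s) \<le> C / \<Lambda>"
    by (rule spread_diff_op_bound[OF u(1), of K]) blast
  \<comment> \<open>\<open>s k\<close> is the k-th difference of the sequence obtained by shifting u
    along b in integer steps.\<close>
  define s where "s k i = Y (sh i ((diff_op ^^ k) u))" for k i
  have s_diff: "s (Suc k) i = s k (Suc i) - s k i" for k i
  proof -
    let ?v = "(diff_op ^^ k) u"
    have v: "schwartz1 ?v" by (rule schwartz1_diff_op_power[OF u(1)])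
    have "sh i (diff_op ?v) = (\<lambda>t. sh (Suc i) ?v t - sh i ?v t)"
      by (rule ext) (simp add: sh_def diff_op_def algebra_simps)
    then show ?thesis by (simp add: s_def Y_diff[OF sh_s[OF v] sh_s[OF v]])
  qed
  have s_zero: "s K i = 0" for i
  proof -
    \<comment> \<open>An integrable majorant independent of \<Lambda>: in the direction b the two
      spare powers, elsewhere the growth weight times the fixed factors.\<close>
    define G where "G j t = (if j = b then inverse ((1 + \<bar>t\<bar>)\<^sup>2) else (1 + \<bar>t\<bar>) ^ M * cmod (\<phi> j t))" for j :: 'd and t :: real
    have G_int: "integrable lborel (G j)" for j
    proof (cases "j = b")
      case True
      have "integrable lborel (\<lambda>t::real. inverse ((1 + \<bar>t\<bar>)\<^sup>2))"
      proof (rule Bochner_Integration.integrable_bound[OF integrable_inverse_1_plus_square_lborel])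
        show "AE t in (lborel :: real measure). norm (inverse ((1 + \<bar>t\<bar>)\<^sup>2)) \<le> norm (inverse (1 + t\<^sup>2))"
        proof (rule AE_I2)
          fix t :: real
          have "inverse ((1 + \<bar>t\<bar>)\<^sup>2) \<le> inverse (1 + t\<^sup>2)"
            by (rule le_imp_inverse_le) (auto simp: power2_sum add_pos_nonneg)
          then show "norm (inverse ((1 + \<bar>t\<bar>)\<^sup>2)) \<le> norm (inverse (1 + t\<^sup>2))" by simp
        qed
      qed measurable
      then show ?thesis by (simp add: G_def[abs_def] True)
    next
      case False
      then show ?thesis using schwartz1_integrable[OF \<phi>] by (simp add: G_def[abs_def])
    qed
    define A where "A = K0 * ((1 + real i) ^ K * C) * (LINT a|lborel. (\<Prod>j\<in>UNIV. G j ((a :: 'd spacetime) $ j)))"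
    have le: "cmod (s K i) \<le> A / \<Lambda>" if \<Lambda>: "\<Lambda> \<ge> 1" for \<Lambda>
    proof -
      define U where "U = (\<lambda>t. complex_of_real (1 / \<Lambda>) * u (1 / \<Lambda> * t))"
      have U: "schwartz1 U" unfolding U_def using \<Lambda> by (intro schwartz1_spread[OF u(1)]) simp
      define v where "v = (diff_op ^^ K) U"
      have v: "schwartz1 v" unfolding v_def by (rule schwartz1_diff_op_power[OF U])
      have v_bound: "(1 + \<bar>t\<bar>) ^ K * cmod (v t) \<le> C / \<Lambda>" for t using C[OF \<Lambda>] by (simp add: v_def U_def)
      have C0: "C / \<Lambda> \<ge> 0" by (rule order_trans[OF _ v_bound[of 0]]) simp
      let ?v0 = "(diff_op ^^ K) u"
      have v0: "schwartz1 ?v0" by (rule schwartz1_diff_op_power[OF u(1)])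
      \<comment> \<open>Both u and its spread version have transform 1 near 0. The shift and the
        differences multiply both transforms by the same factor, so the difference of the two
        functions has no momenta near 0 along b.\<close>
      have "Y (\<lambda>t. sh i ?v0 t - sh i v t) = 0"
      proof (rule zero[OF schwartz1_diff[OF sh_s[OF v0] sh_s[OF v]], of "\<delta> / \<Lambda>"])
        fix \<kappa> assume \<kappa>: "\<bar>\<kappa>\<bar> < \<delta> / \<Lambda>"
        have "\<delta> / \<Lambda> \<le> \<delta>" using \<Lambda> \<delta> by (simp add: divide_le_eq)
        then have 1: "fourier1 u \<kappa> = 1" using \<kappa> by (intro u(2)) linarith
        have "fourier1 U \<kappa> = fourier1 u (\<kappa> / (1 / \<Lambda>))"
          unfolding U_def using \<Lambda> by (intro fourier1_scale) simp
        also have "\<dots> = 1"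
          using \<kappa> \<Lambda> by (intro u(2)) (simp add: abs_mult less_divide_eq)
        finally have 2: "fourier1 U \<kappa> = 1" .
        show "fourier1 (\<lambda>t. sh i ?v0 t - sh i v t) \<kappa> = 0"
          unfolding fourier1_diff[OF sh_s[OF v0] sh_s[OF v]] unfolding sh_def fourier1_shift v_def
            fourier1_diff_op_power[OF u(1)] fourier1_diff_op_power[OF U] 1 2 by simp
      qed (use \<delta> \<Lambda> in simp)
      then have "s K i = Y (sh i v)" by (simp add: s_def Y_diff[OF sh_s[OF v0] sh_s[OF v]])
      also have "\<dots> = (LINT a|lborel. T (translate a f) * h (sh i v) a)"
        unfolding Y_def by (rule tempered_convolve_eq[OF T f rh[OF sh_s[OF v]]])
      also have "cmod \<dots> \<le> (LINT a|lborel. K0 * ((1 + real i) ^ K * (C / \<Lambda>)) * (\<Prod>j\<in>UNIV. G j ((a :: 'd spacetime) $ j)))"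
      proof (rule order_trans[OF integral_norm_bound integral_mono'])
        show "integrable lborel (\<lambda>a. K0 * ((1 + real i) ^ K * (C / \<Lambda>)) * (\<Prod>j\<in>UNIV. G j ((a :: 'd spacetime) $ j)))"
          using integrable_prod_vec[of G, OF G_int] by simp
        have G0: "G j t \<ge> 0" for j t by (simp add: G_def)
        show "0 \<le> K0 * ((1 + real i) ^ K * (C / \<Lambda>)) * (\<Prod>j\<in>UNIV. G j ((a :: 'd spacetime) $ j))" for a
          using K0(1) C0 by (intro mult_nonneg_nonneg prod_nonneg) (auto simp: G0)
        show "norm (T (translate a f) * h (sh i v) a) \<le>
            K0 * ((1 + real i) ^ K * (C / \<Lambda>)) * (\<Prod>j\<in>UNIV. G j ((a :: 'd spacetime) $ j))" for a
        proof -
          let ?X = "\<lambda>j. (1 + \<bar>a $ j\<bar>) ^ M * cmod ((\<phi>(b := sh i v)) j (a $ j))"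
          let ?t = "a $ b"
          have "(1 + \<bar>?t\<bar>) ^ K * cmod (v (?t - real i)) \<le> ((1 + real i) * (1 + \<bar>?t - real i\<bar>)) ^ K * cmod (v (?t - real i))"
          proof (intro mult_right_mono power_mono)
            show "1 + \<bar>?t\<bar> \<le> (1 + real i) * (1 + \<bar>?t - real i\<bar>)"
            proof -
              have "0 \<le> real i * \<bar>?t - real i\<bar>" by simp
              moreover have "\<bar>?t\<bar> \<le> \<bar>?t - real i\<bar> + real i" by simp
              moreover have "(1 + real i) * (1 + \<bar>?t - real i\<bar>) = 1 + real i + \<bar>?t - real i\<bar> + real i * \<bar>?t - real i\<bar>"
                by (simp add: algebra_simps)
              ultimately show ?thesis by linarith
            qed
          qed auto
          also have "\<dots> = (1 + real i) ^ K * ((1 + \<bar>?t - real i\<bar>) ^ K * cmod (v (?t - real i)))"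
            unfolding power_mult_distrib by (simp only: mult.assoc)
          also have "\<dots> \<le> (1 + real i) ^ K * (C / \<Lambda>)" by (intro mult_left_mono v_bound) simp
          finally have "(1 + \<bar>?t\<bar>) ^ M * ((1 + \<bar>?t\<bar>)\<^sup>2 * cmod (v (?t - real i))) \<le> (1 + real i) ^ K * (C / \<Lambda>)"
            by (simp only: K_def power_add mult.assoc)
          then have "(1 + \<bar>?t\<bar>)\<^sup>2 * ?X b \<le> (1 + real i) ^ K * (C / \<Lambda>)"
            by (simp add: sh_def mult.left_commute)
          moreover have "(1 + \<bar>?t\<bar>)\<^sup>2 > 0" by (simp add: add_pos_nonneg)
          ultimately have "?X b \<le> (1 + real i) ^ K * (C / \<Lambda>) / (1 + \<bar>?t\<bar>)\<^sup>2"
            by (simp only: pos_le_divide_eq mult.commute)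
          then have Xb: "?X b \<le> (1 + real i) ^ K * (C / \<Lambda>) * G b ?t" by (simp add: G_def divide_inverse)
          have X: "?X j = G j (a $ j)" if "j \<noteq> b" for j using that by (simp add: G_def)
          have "(\<Prod>j\<in>UNIV. ?X j) = ?X b * (\<Prod>j\<in>UNIV - {b}. ?X j)"
            by (rule prod.remove) auto
          also have "(\<Prod>j\<in>UNIV - {b}. ?X j) = (\<Prod>j\<in>UNIV - {b}. G j (a $ j))"
            by (rule prod.cong[OF refl], rule X) simp
          finally have "(\<Prod>j\<in>UNIV. ?X j) = ?X b * (\<Prod>j\<in>UNIV - {b}. G j (a $ j))" .
          also have "\<dots> \<le> (1 + real i) ^ K * (C / \<Lambda>) * G b ?t * (\<Prod>j\<in>UNIV - {b}. G j (a $ j))"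
            by (intro mult_right_mono Xb prod_nonneg) (auto simp: G0)
          also have "\<dots> = (1 + real i) ^ K * (C / \<Lambda>) * (\<Prod>j\<in>UNIV. G j (a $ j))"
            by (subst (2) prod.remove[of _ b]) auto
          finally have P: "(\<Prod>j\<in>UNIV. ?X j) \<le> (1 + real i) ^ K * (C / \<Lambda>) * (\<Prod>j\<in>UNIV. G j (a $ j))" .
          have "norm (T (translate a f) * h (sh i v) a) \<le> K0 * (1 + norm a) ^ M * cmod (h (sh i v) a)"
            unfolding norm_mult by (intro mult_right_mono K0(2)) simp
          also have "\<dots> = K0 * ((1 + norm a) ^ M * cmod (h (sh i v) a))" by simp
          also have "\<dots> \<le> K0 * (\<Prod>j\<in>UNIV. ?X j)"
            unfolding h_def by (intro mult_left_mono prod_fun_weight K0(1))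
          also have "\<dots> \<le> K0 * ((1 + real i) ^ K * (C / \<Lambda>) * (\<Prod>j\<in>UNIV. G j (a $ j)))"
            by (intro mult_left_mono P K0(1))
          finally show ?thesis by (simp only: mult.assoc)
        qed
      qed
      also have "\<dots> = A / \<Lambda>" by (simp add: A_def)
      finally show ?thesis .
    qed
    show ?thesis
    proof (rule ccontr)
      assume "s K i \<noteq> 0"
      then have pos: "cmod (s K i) > 0" by simp
      \<comment> \<open>Large enough for A / \<Lambda> to be at most half of the supposedly nonzero
        value.\<close>
      define \<Lambda> where "\<Lambda> = max 1 (2 * \<bar>A\<bar> / cmod (s K i))"
      have "cmod (s K i) \<le> A / \<Lambda>" by (rule le) (simp add: \<Lambda>_def)
      moreover have \<Lambda>: "\<Lambda> > 0" by (simp add: \<Lambda>_def)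
      ultimately have "cmod (s K i) * \<Lambda> \<le> \<bar>A\<bar>" by (simp add: pos_le_divide_eq)
      moreover have "2 * \<bar>A\<bar> \<le> cmod (s K i) * \<Lambda>"
      proof -
        have "2 * \<bar>A\<bar> / cmod (s K i) \<le> \<Lambda>" by (simp add: \<Lambda>_def)
        then show ?thesis using pos by (simp add: divide_le_eq mult.commute)
      qed
      moreover have "0 < cmod (s K i) * \<Lambda>" using pos \<Lambda> by simp
      ultimately show False by linarith
    qed
  qed
  have s_lim: "s k \<longlonglongrightarrow> W (star g) * W f * fourier1 ((diff_op ^^ k) u) 0" for k
    unfolding s_def by (rule lim[OF schwartz1_diff_op_power[OF u(1)]])
  \<comment> \<open>The limits of positive order vanish because of the zero of exp (i \<kappa>) - 1
    at 0.\<close>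
  have "s 0 0 = W (star g) * W f * fourier1 ((diff_op ^^ 0) u) 0"
  proof (rule vanishing_differences_limit[OF s_diff s_zero _ s_lim])
    show "W (star g) * W f * fourier1 ((diff_op ^^ k) u) 0 = 0" if "k > 0" for k
      using that by (simp add: fourier1_diff_op_power[OF u(1)])
  qed (simp add: K_def)
  also have "s 0 0 = indef Q (state Q g) (state Q (convolve f (prod_fun \<phi>)))"
  proof -
    have "\<phi>(b := u) = \<phi>" using b by (auto simp: \<phi>_def)
    then show ?thesis by (simp add: s_def Y_def T_def h_def sh_def)
  qed
  also have "W (star g) * W f * fourier1 ((diff_op ^^ 0) u) 0 = indef Q (state Q g) (W f *\<^sub>C \<Omega>)"
    using u(2)[of 0] \<delta> by (simp add: indef_scale indef_state_vacuum[OF g])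
  finally show "indef Q (state Q g) (state Q (convolve f (prod_fun (\<lambda>j. if j = 0 then \<phi>0 else u)))) =
      indef Q (state Q g) (W f *\<^sub>C \<Omega>)" unfolding \<phi>_def .
qed

lemma W_add: "f \<in> borchers \<Longrightarrow> g \<in> borchers \<Longrightarrow> W (\<lambda>xs. f xs + g xs) = W f + W g"
  using W_linear by (simp add: linear_on_borchers_def)

text \<open>Both sides are additive, so an identity known for one number of points at a time passes
  to finite sequences.\<close>

lemma vector_functional_eq_multiple:
  assumes L: "bounded_linear L" and schw: "\<And>n f. f \<in> schwartz n \<Longrightarrow> L (state Q f) = W f * c"
    and f: "f \<in> borchers"
  shows "L (state Q f) = W f * c"
proof (rule borchers_component_induct[OF f])
  fix f g assume "f \<in> borchers" "g \<in> borchers" "L (state Q f) = W f * c" "L (state Q g) = W g * c"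
  then show "L (state Q (\<lambda>xs. f xs + g xs)) = W (\<lambda>xs. f xs + g xs) * c"
    by (simp add: state_add W_add linear_add[OF bounded_linear.linear[OF L]] distrib_right)
qed (rule schw)

theorem translation_invariant_vectors: "{v. translation_invariant Q v} = {c *\<^sub>C \<Omega> | c. True}"
proof (intro equalityI subsetI)
  fix v assume "v \<in> {v. translation_invariant Q v}"
  then have inv: "indef Q v (state Q (translate a f)) = indef Q v (state Q f)" if "f \<in> borchers" for a f
    using that by (auto simp: translation_invariant_def dom_def rep_translation)
  \<comment> \<open>Radius m / 4 for the plateau makes the transform vanish beyond m / 2, strictly
    inside the gap.\<close>
  obtain \<phi>0 where \<phi>0: "schwartz1 \<phi>0" "\<And>\<kappa>. fourier1 \<phi>0 \<kappa> = complex_of_real (plateau (\<kappa> / (m / 4)))"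
    by (rule plateau_schwartz1[of "m / 4"]) (use mass_pos in auto)
  obtain u where u: "schwartz1 u" "\<And>\<kappa>. fourier1 u \<kappa> = complex_of_real (plateau (\<kappa> / 1))"
    by (rule plateau_schwartz1[of 1]) auto
  let ?\<phi> = "\<lambda>j::'d. if j = 0 then \<phi>0 else u"
  have "indef Q v (state Q f) = W f * indef Q v \<Omega>" if f: "f \<in> schwartz n" for n f
  proof -
    have "indef Q v (state Q (convolve f (prod_fun ?\<phi>))) = indef Q v (state Q f) * (\<Prod>j\<in>UNIV. fourier1 (?\<phi> j) 0)"
      by (rule tempered_convolve_invariant[OF tempered_indef f])
         (use inv schwartz_borchers[OF f] \<phi>0 u in auto)
    moreover have "(\<Prod>j\<in>UNIV. fourier1 (?\<phi> j) 0) = 1"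
      by (intro prod.neutral) (auto simp: \<phi>0 u plateau_1)
    moreover have "state Q (convolve f (prod_fun ?\<phi>)) = W f *\<^sub>C \<Omega>"
    proof (rule low_energy_smearing[OF f \<phi>0(1) _ _ _ u(1), where \<mu> = "m / 2" and \<delta> = 1])
      show "fourier1 \<phi>0 \<kappa> = 0" if "\<bar>\<kappa>\<bar> > m / 2" for \<kappa>
      proof -
        have "2 \<le> \<bar>\<kappa> / (m / 4)\<bar>" using that mass_pos by (simp add: pos_le_divide_eq)
        then show ?thesis by (simp only: \<phi>0(2) plateau_0 of_real_0)
      qed
    qed (use mass_pos in \<open>auto simp: \<phi>0 u plateau_1\<close>)
    ultimately show ?thesis by (simp add: indef_scale)
  qed
  from vector_functional_eq_multiple[OF indef_bounded_linear this]
  \<comment> \<open>The conjugate appears because the form is antilinear in its first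
    argument.\<close>
  have "indef Q v (state Q f) = indef Q (cnj (indef Q v \<Omega>) *\<^sub>C \<Omega>) (state Q f)" if "f \<in> borchers" for f
    using that by (simp add: indef_scale_left indef_vacuum mult.commute)
  then have "v = cnj (indef Q v \<Omega>) *\<^sub>C \<Omega>" by (rule indef_ext_left)
  then show "v \<in> {c *\<^sub>C \<Omega> | c. True}" by blast
next
  fix v assume "v \<in> {c *\<^sub>C \<Omega> | c. True}"
  then obtain c where v: "v = c *\<^sub>C \<Omega>" by blast
  show "v \<in> {v. translation_invariant Q v}"
    by (auto simp: translation_invariant_def dom_def rep_translation v indef_scale_left
        indef_vacuum borchers_translate W_translate)
qed

text \<open>\<open>\<langle>\<Omega>, C U(a) \<phi>(f) \<Omega>\<rangle>\<close> equals the complex conjugate of \<open>\<langle>C \<Omega>, U(a) \<phi>(f\<^sup>*) \<Omega>\<rangle>\<close>, so that its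
  Fourier transform in \<open>a\<close> is supported both in the spectrum and in minus the spectrum.\<close>

lemma commutant_vacuum_expectation:
  assumes C: "C \<in> weak_commutant Q (field_algebra Q)" and f: "f \<in> borchers"
  shows "indef Q \<Omega> (C (state Q f)) = W f * indef Q \<Omega> (C \<Omega>)"
proof -
  have Cl: "bounded_clinear C" and comm: "\<And>\<Psi>1 \<Psi>2 L. \<Psi>1 \<in> dom Q \<Longrightarrow> \<Psi>2 \<in> dom Q \<Longrightarrow> L \<in> field_algebra Q \<Longrightarrow>
      indef Q \<Psi>1 (C (L \<Psi>2)) = indef Q (eta_adjoint Q L \<Psi>1) (C \<Psi>2)"
    using C by (auto simp: weak_commutant_def)
  define T1 where "T1 f = indef Q \<Omega> (C (state Q f))" for f
  define T2 where "T2 f = indef Q (C \<Omega>) (state Q f)" for f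
  have L: "bounded_linear (\<lambda>x. indef Q \<Omega> (C x))"
    by (rule bounded_linear_compose[OF indef_bounded_linear bounded_clinear_bounded_linear[OF Cl]])
  have T1: "tempered n T1" for n
    unfolding T1_def by (rule tempered_state[OF L]) (simp add: bounded_clinear_simps[OF Cl] indef_scale)
  \<comment> \<open>The commutation relation is taken with the vacuum on both sides, which moves the
    field from C to the left as its adjoint.\<close>
  have T12: "T1 f = cnj (T2 (star f))" if f: "f \<in> borchers" for f
  proof -
    have "indef Q (state Q unit_seq) (C (field_op Q f (state Q unit_seq))) =
        indef Q (eta_adjoint Q (field_op Q f) (state Q unit_seq)) (C (state Q unit_seq))"
      by (rule comm) (auto simp: dom_def field_algebra_def borchers_unit f)
    then have "T1 f = indef Q (state Q (star f)) (C \<Omega>)"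
      by (simp add: T1_def vacuum_def field_op f borchers_unit eta_adjoint_field)
    then show ?thesis unfolding T2_def by (subst (asm) indef_hermitian)
  qed
  have "T1 f = W f * indef Q \<Omega> (C \<Omega>)" if f: "f \<in> schwartz n" for n f
  proof -
    let ?\<kappa> = "indef Q \<Omega> (C \<Omega>)"
    obtain u where u: "schwartz1 u" "\<And>\<kappa>. fourier1 u \<kappa> = complex_of_real (plateau (\<kappa> / 1))"
      by (rule plateau_schwartz1[of 1]) auto
    \<comment> \<open>An approximate identity recovers T1 f from smeared values. These are shown to
      be independent of i once the band width exceeds the mass scale.\<close>
    define U where "U i = (\<lambda>s. complex_of_real (real (Suc i)) * u (real (Suc i) * s))" for i
    obtain K M where K: "K \<ge> 0" "\<And>a. cmod (T1 (translate a f)) \<le> K * (1 + norm a) ^ M"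
      using tempered_translate_bound[OF T1 f] by blast
    have "(\<lambda>i. LINT a|lborel. T1 (translate a f) * prod_fun (\<lambda>_. U i) a) \<longlonglongrightarrow> T1 (translate 0 f)"
      unfolding U_def
      by (rule approximate_identity[OF tempered_translate_continuous[OF T1 f] K(2) K(1) u(1)])
         (simp add: u plateau_1)
    then have lim: "(\<lambda>i. LINT a|lborel. T1 (translate a f) * prod_fun (\<lambda>_. U i) a) \<longlonglongrightarrow> T1 f" by simp
    \<comment> \<open>The bound on i ensures d <= c, so that the narrow plateau of radius d around
      energy 0 fits inside the plateau of radius c in the transform of \<open>U i\<close>.\<close>
    have eq: "(LINT a|lborel. T1 (translate a f) * prod_fun (\<lambda>_. U i) a) = W f * ?\<kappa>" if i: "real (Suc i) \<ge> m" for i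
    proof -
      define c where "c = real (Suc i)"
      define d where "d = m / 4"
      have d: "d > 0" "d \<le> c" "c > 0" using mass_pos i by (auto simp: d_def c_def)
      have Ui: "schwartz1 (U i)" unfolding U_def by (intro schwartz1_spread u) simp
      have FU: "fourier1 (U i) \<kappa> = complex_of_real (plateau (\<kappa> / c))" for \<kappa>
        unfolding U_def c_def by (subst fourier1_scale) (simp_all add: u)
      define \<phi> where "\<phi> = (\<lambda>_::'d. U i)"
      \<comment> \<open>Only the energy factor varies; the spatial factors remain
        \<open>U i\<close>.\<close>
      define Z where "Z w = T1 (convolve f (prod_fun (\<phi>(0 := w))))" for w
      have \<phi>s: "schwartz1 ((\<phi>(0 := w)) j)" if "schwartz1 w" for w j using that Ui by (simp add: \<phi>_def)
      have Z_linear: "Z (\<lambda>s. x * v s + y * w s) = x * Z v + y * Z w" if "schwartz1 v" "schwartz1 w" for v w x y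
        unfolding Z_def by (rule tempered_prod_linear[OF T1 f _ that]) (simp add: \<phi>_def Ui)
      \<comment> \<open>The band of \<open>U i\<close> with a neighbourhood of 0 removed. Because of
        this hole it can be divided smoothly into positive and negative frequencies.\<close>
      define \<psi> where "\<psi> \<kappa> = plateau (1 / c * \<kappa>) + (-1) * plateau (1 / d * \<kappa>)" for \<kappa>
      have \<psi>_small: "\<psi> \<kappa> = 0" if "\<bar>\<kappa>\<bar> \<le> d" for \<kappa>
        using that d by (simp add: \<psi>_def plateau_1 abs_mult)
      have b: "bump (2 * c) (\<lambda>\<kappa>. \<psi> \<kappa> * smooth_step (e * \<kappa> + 0))" for e
        unfolding bump_def
      proof (intro conjI allI impI)
        show "C_n k (\<lambda>\<kappa>. \<psi> \<kappa> * smooth_step (e * \<kappa> + 0))" for k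
          unfolding \<psi>_def by (intro C_n_mult C_n_add C_n_const C_n_plateau C_n_affine C_n_smooth_step)
        fix x assume x: "2 * c < \<bar>x\<bar>"
        then have "\<bar>1 / c * x\<bar> \<ge> 2" "\<bar>1 / d * x\<bar> \<ge> 2" using d by (auto simp: abs_mult pos_le_divide_eq)
        then show "\<psi> x * smooth_step (e * x + 0) = 0" by (simp only: \<psi>_def plateau_0) simp
      qed
      obtain vp where vp: "schwartz1 vp" "\<And>\<kappa>. fourier1 vp \<kappa> = complex_of_real (\<psi> \<kappa> * smooth_step (1 / d * \<kappa> + 0))"
        by (rule schwartz1_with_fourier1[OF b[of "1 / d"]]) blast
      obtain vm where vm: "schwartz1 vm" "\<And>\<kappa>. fourier1 vm \<kappa> = complex_of_real (\<psi> \<kappa> * smooth_step (- 1 / d * \<kappa> + 0))"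
        by (rule schwartz1_with_fourier1[OF b[of "- 1 / d"]]) blast
      obtain v0 where v0: "schwartz1 v0" "\<And>\<kappa>. fourier1 v0 \<kappa> = complex_of_real (plateau (\<kappa> / d))"
        by (rule plateau_schwartz1[OF d(1)]) blast
      \<comment> \<open>For |\<kappa>| > d exactly one of the two steps is 1 and the other 0; for
        smaller |\<kappa>| the factor \<psi> vanishes.\<close>
      have split: "\<psi> \<kappa> * smooth_step (1 / d * \<kappa> + 0) + \<psi> \<kappa> * smooth_step (- 1 / d * \<kappa> + 0) = \<psi> \<kappa>" for \<kappa>
      proof (cases "\<bar>\<kappa>\<bar> \<le> d")
        case False
        then consider "\<kappa> > d" | "\<kappa> < - d" by linarith
        then show ?thesis
          by cases (use d in \<open>simp_all add: smooth_step_1 smooth_step_0 field_simps\<close>)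
      qed (simp add: \<psi>_small)
      let ?w1 = "\<lambda>s. 1 * U i s + (-1) * v0 s" and ?w2 = "\<lambda>s. 1 * vp s + 1 * vm s"
      let ?w = "\<lambda>s. 1 * ?w1 s + (-1) * ?w2 s"
      have w1: "schwartz1 ?w1" and w2: "schwartz1 ?w2"
        by (rule schwartz1_linear_combination[OF Ui v0(1)] schwartz1_linear_combination[OF vp(1) vm(1)])+
      have w: "schwartz1 ?w" by (rule schwartz1_linear_combination[OF w1 w2])
      have Fw: "fourier1 ?w \<kappa> = 0" for \<kappa>
      proof -
        have "?w = (\<lambda>s. ?w1 s - ?w2 s)" by (rule ext) simp
        then have "fourier1 ?w \<kappa> = fourier1 ?w1 \<kappa> - fourier1 ?w2 \<kappa>" by (simp only: fourier1_diff[OF w1 w2])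
        also have "fourier1 ?w1 \<kappa> = complex_of_real (\<psi> \<kappa>)"
          using fourier1_diff[OF Ui v0(1), of \<kappa>] by (simp add: FU v0 \<psi>_def)
        also have "fourier1 ?w2 \<kappa> = complex_of_real (\<psi> \<kappa>)"
          using fourier1_add[OF vp(1) vm(1), of \<kappa>] split[of \<kappa>] by (simp only: vp vm mult_1 of_real_add[symmetric])
        finally show ?thesis by simp
      qed
      have state0: "T1 g = 0" if "state Q g = 0" for g
        using that by (simp add: T1_def bounded_clinear_simps[OF Cl] linear_0[OF bounded_linear.linear[OF indef_bounded_linear]])
      have nz0: "fourier1 v (k $ 0) \<noteq> 0"
        if "(\<Prod>j\<in>UNIV. fourier1 ((x(0 := v)) j) (mink_sign j * k $ j)) \<noteq> 0" for v x and k :: "'d spacetime"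
      proof -
        have "fourier1 ((x(0 := v)) j) (mink_sign j * k $ j) \<noteq> 0" for j using that by simp
        from this[of 0] show ?thesis by (simp add: mink_sign_def)
      qed
      let ?E = "{k :: 'd spacetime. k $ 0 \<le> - d}"
      have E: "closed ?E" "?E \<inter> ({0} \<union> V\<^sub>+ m) = {}"
        using d by (auto simp: forward_mass_shells_def intro!: closed_Collect_le continuous_intros)
      \<comment> \<open>Injectivity of the Fourier transform is avoided: a smearing function with
        vanishing transform has its momenta in the empty set, so the spectral condition already
        annihilates it.\<close>
      have Zw: "Z ?w = 0"
        unfolding Z_def
      proof (rule state0, rule convolve_spectral_zero[OF f \<phi>s[OF w], where E = "{}"])
        fix k :: "'d spacetime"
        assume "(\<Prod>j\<in>UNIV. fourier1 ((\<phi>(0 := ?w)) j) (mink_sign j * k $ j)) \<noteq> 0"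
        from nz0[OF this] Fw[of "k $ 0"] show "k \<in> {}" by (rule notE)
      qed auto
      \<comment> \<open>Energies at most -d lie outside the spectrum, so the smeared vector
        vanishes.\<close>
      have Zm: "Z vm = 0"
        unfolding Z_def
      proof (rule state0, rule convolve_spectral_zero[OF f \<phi>s[OF vm(1)] E])
        fix k :: "'d spacetime"
        assume "(\<Prod>j\<in>UNIV. fourier1 ((\<phi>(0 := vm)) j) (mink_sign j * k $ j)) \<noteq> 0"
        then have "\<psi> (k $ 0) * smooth_step (- 1 / d * k $ 0 + 0) \<noteq> 0" using nz0[of \<phi> vm k] vm(2) by simp
        then have "\<not> \<bar>k $ 0\<bar> \<le> d" "\<not> - 1 / d * k $ 0 + 0 \<le> 0" using \<psi>_small smooth_step_0 by auto
        then show "k \<in> ?E" using d by (auto simp: not_le zero_less_mult_iff divide_less_0_iff)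
      qed
      \<comment> \<open>Positive energies may occur in the vector itself. In the adjoint sequence
        they become energies at most -d, so its vector vanishes and T2 carries this back to
        T1.\<close>
      have Zp: "Z vp = 0"
      proof -
        define \<phi>' where "\<phi>' = (\<lambda>j s. cnj ((\<phi>(0 := vp)) j s))"
        have \<phi>': "schwartz1 (\<phi>' j)" for j unfolding \<phi>'_def by (rule schwartz1_cnj[OF \<phi>s[OF vp(1)]])
        have "star (convolve f (prod_fun (\<phi>(0 := vp)))) = convolve (star f) (prod_fun \<phi>')"
          unfolding star_convolve by (simp add: prod_fun_def[abs_def] \<phi>'_def cnj_prod)
        moreover have "state Q (convolve (star f) (prod_fun \<phi>')) = 0"
        proof (rule convolve_spectral_zero[OF schwartz_star[OF f] \<phi>' E])
          fix k :: "'d spacetime"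
          assume "(\<Prod>j\<in>UNIV. fourier1 (\<phi>' j) (mink_sign j * k $ j)) \<noteq> 0"
          then have "fourier1 (\<phi>' j) (mink_sign j * k $ j) \<noteq> 0" for j by simp
          from this[of 0] have "fourier1 vp (- (k $ 0)) \<noteq> 0"
            unfolding \<phi>'_def by (simp add: mink_sign_def fourier1_cnj)
          then have "\<psi> (- (k $ 0)) * smooth_step (1 / d * - (k $ 0) + 0) \<noteq> 0" by (simp add: vp(2))
          then have "\<not> \<bar>- (k $ 0)\<bar> \<le> d" "\<not> 1 / d * - (k $ 0) + 0 \<le> 0" using \<psi>_small smooth_step_0 by auto
          then show "k \<in> ?E" using d by (auto simp: not_le zero_less_mult_iff divide_less_0_iff)
        qed
        moreover have "convolve f (prod_fun (\<phi>(0 := vp))) \<in> borchers"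
          by (rule schwartz_borchers[OF schwartz_convolve[OF f rapid_prod_fun_schwartz1[OF \<phi>s[OF vp(1)]]]])
        ultimately show ?thesis
          unfolding Z_def by (simp add: T12 T2_def linear_0[OF bounded_linear.linear[OF indef_bounded_linear]])
      qed
      \<comment> \<open>The remaining energy factor is supported in |\<kappa>| <= m / 2, where the
        smearing lemma for low energies applies.\<close>
      have Z0: "Z v0 = W f * ?\<kappa>"
      proof -
        have "\<phi>(0 := v0) = (\<lambda>j. if j = 0 then v0 else U i)" by (auto simp: \<phi>_def)
        moreover have "state Q (convolve f (prod_fun (\<lambda>j. if j = 0 then v0 else U i))) = W f *\<^sub>C \<Omega>"
        proof (rule low_energy_smearing[OF f v0(1) _ _ _ Ui, where \<mu> = "m / 2" and \<delta> = c])
          show "fourier1 v0 \<kappa> = 0" if "\<bar>\<kappa>\<bar> > m / 2" for \<kappa>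
          proof -
            have "2 \<le> \<bar>\<kappa> / d\<bar>" using that mass_pos by (simp add: pos_le_divide_eq d_def)
            then show ?thesis by (simp only: v0(2) plateau_0 of_real_0)
          qed
          show "fourier1 (U i) \<kappa> = 1" if "\<bar>\<kappa>\<bar> \<le> c" for \<kappa>
            unfolding FU using that d by (simp add: plateau_1)
        qed (use mass_pos d in \<open>auto simp: v0 plateau_1\<close>)
        ultimately show ?thesis by (simp add: Z_def T1_def bounded_clinear_simps[OF Cl] indef_scale)
      qed
      have "0 = Z (U i) - Z v0 - (Z vp + Z vm)"
        using Zw Z_linear[OF w1 w2, of 1 "-1"] Z_linear[OF Ui v0(1), of 1 "-1"] Z_linear[OF vp(1) vm(1), of 1 1] by simp
      then have "Z (U i) = W f * ?\<kappa>" by (simp add: Zp Zm Z0)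
      moreover have "Z (U i) = (LINT a|lborel. T1 (translate a f) * prod_fun (\<lambda>_. U i) a)"
      proof -
        have "\<phi>(0 := U i) = (\<lambda>_. U i)" by (auto simp: \<phi>_def)
        then show ?thesis unfolding Z_def
          by (simp add: tempered_convolve_eq[OF T1 f rapid_prod_fun_schwartz1[of "\<lambda>_. U i", OF Ui]])
      qed
      ultimately show ?thesis by simp
    qed
    obtain i0 where "m \<le> real i0" using real_arch_simple by blast
    then have "\<forall>\<^sub>F i in sequentially. (LINT a|lborel. T1 (translate a f) * prod_fun (\<lambda>_. U i) a) = W f * ?\<kappa>"
      by (intro eventually_sequentiallyI[of i0] eq) linarith
    then have "(\<lambda>i. LINT a|lborel. T1 (translate a f) * prod_fun (\<lambda>_. U i) a) \<longlonglongrightarrow> W f * ?\<kappa>"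
      by (rule tendsto_eventually)
    with lim show ?thesis by (rule LIMSEQ_unique)
  qed
  then show ?thesis
    unfolding T1_def by (intro vector_functional_eq_multiple[OF L _ f])
qed

theorem field_algebra_irreducible: "irreducible_algebra Q (field_algebra Q)"
  unfolding irreducible_algebra_def
proof (intro equalityI subsetI)
  fix C assume C: "C \<in> weak_commutant Q (field_algebra Q)"
  let ?\<kappa> = "indef Q \<Omega> (C \<Omega>)"
  have Cl: "bounded_clinear C" and comm: "\<And>\<Psi>1 \<Psi>2 L. \<Psi>1 \<in> dom Q \<Longrightarrow> \<Psi>2 \<in> dom Q \<Longrightarrow> L \<in> field_algebra Q \<Longrightarrow>
      indef Q \<Psi>1 (C (L \<Psi>2)) = indef Q (eta_adjoint Q L \<Psi>1) (C \<Psi>2)"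
    using C by (auto simp: weak_commutant_def)
  have on_state: "C (state Q k) = ?\<kappa> *\<^sub>C state Q k" if k: "k \<in> borchers" for k
  proof (rule indef_ext)
    fix g :: "'d test_seq" assume g: "g \<in> borchers"
    \<comment> \<open>Commuting C with the field of \<open>star g\<close> expresses an arbitrary
      matrix element as a vacuum one.\<close>
    have "indef Q (state Q unit_seq) (C (field_op Q (star g) (state Q k))) =
        indef Q (eta_adjoint Q (field_op Q (star g)) (state Q unit_seq)) (C (state Q k))"
      by (rule comm) (auto simp: dom_def field_algebra_def borchers_unit k borchers_star g)
    then have "indef Q \<Omega> (C (state Q (star g \<otimes>\<^sub>B k))) = indef Q (state Q g) (C (state Q k))"
      by (simp add: vacuum_def field_op k borchers_unit borchers_star g eta_adjoint_field)
    moreover have "indef Q \<Omega> (C (state Q (star g \<otimes>\<^sub>B k))) = W (star g \<otimes>\<^sub>B k) * ?\<kappa>"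
      by (intro commutant_vacuum_expectation[OF C] borchers_tensor borchers_star g k)
    ultimately show "indef Q (state Q g) (C (state Q k)) = indef Q (state Q g) (?\<kappa> *\<^sub>C state Q k)"
      by (simp add: indef_scale indef_state g k mult.commute)
  qed
  have "C v = ?\<kappa> *\<^sub>C v" for v
    by (rule continuous_eq_on_dense[OF bounded_clinear_bounded_linear[OF Cl]
          bounded_clinear_bounded_linear[OF bounded_clinear_scaleC] state_dense])
       (use on_state in auto)
  then have "C = (\<lambda>v. ?\<kappa> *\<^sub>C v)" by (rule ext)
  then show "C \<in> {\<lambda>v. c *\<^sub>C v | c. True}" by blast
next
  fix C assume "C \<in> {\<lambda>v::'h. c *\<^sub>C v | c. True}"
  then obtain c where C: "C = (\<lambda>v. c *\<^sub>C v)" by blast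
  \<comment> \<open>For the converse inclusion both sides equal the value of W on the product of
    \<open>star g\<close>, f and k.\<close>
  have "indef Q (state Q g) (state Q (f \<otimes>\<^sub>B k)) = indef Q (state Q (star f \<otimes>\<^sub>B g)) (state Q k)"
    if "f \<in> borchers" "g \<in> borchers" "k \<in> borchers" for f g k
    using that by (simp add: indef_state borchers_tensor borchers_star star_tensor tensor_assoc)
  then show "C \<in> weak_commutant Q (field_algebra Q)"
    by (auto simp: weak_commutant_def C bounded_clinear_scaleC dom_def field_algebra_def
        indef_scale field_op eta_adjoint_field)
qed

end

theorem theorem3p4:
  fixes W :: "'d::{finite,zero} test_seq \<Rightarrow> complex"
    and p :: "'d test_seq \<Rightarrow> real"
    and Q :: "('d, 'h::complex_hilbert) iqft"
    and \<iota> :: "'d test_seq \<Rightarrow> 'h1::complex_hilbert"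
    and quot :: "'h1 \<Rightarrow> 'h2::complex_hilbert"
    and m :: real
  assumes "CARD('d) \<ge> 2"
    and "wightman_functional W p"
    and "sobolev_dominated p"
    and "associated_qft W p N l \<iota> F quot \<eta>2 abs_\<eta>2 sign_\<eta>2 emb \<eta>0 Q"
    and "m > 0"
    and "spectral_ideal ({0} \<union> V\<^sub>+ m) \<subseteq> functional_kernel W"
  shows "irreducible_algebra Q (field_algebra Q) \<and>
         {v. translation_invariant Q v} = {c *\<^sub>C vacuum Q | c. True}"
proof -
  interpret massive_qft W p N l \<iota> F quot \<eta>2 abs_\<eta>2 sign_\<eta>2 emb \<eta>0 Q m
    by (intro massive_qft.intro massive_qft_axioms.intro assms)
  show ?thesis
    by (intro conjI field_algebra_irreducible translation_invariant_vectors)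
qed

end
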